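(* Up to isomorphism there are exactly $88$ simple Yetter-Drinfel'd modules over $H$; $32$ of them are one-dimensional and the other $56$ are two-dimensional. A complete list of pairwise non-isomorphic simple Yetter-Drinfel'd modules over $H$ consists of the $32$ one-dimensional modules (S0) and the $56$ two-dimensional modules (S1)–(S4) described in the context.
   Context: $\Bbbk$ is an algebraically closed field of characteristic $0$ and $\xi\in\Bbbk$ is a primitive $4$-th root of $1$. $G=\langle x,y\mid x^4=1=y^2,\ xy=yx\rangle$, and $\mathbb{Z}_2=\{1,t\}$ acts on $G$ by group automorphisms via $x\triangleleft t=xy$, $y\triangleleft t=y$. Put $\sigma(x^iy^j;t,t)=(-1)^{i(i-1)/2}$ and $\tau(x^iy^j,x^ky^l;t)=(-1)^{jk}$. The Hopf algebra $H=H_{c:\sigma_0}$ is the $16$-dimensional Hopf algebra with basis $\{e_g,\ e_gt : g\in G\}$, generated as an algebra by $e_g$ ($g\in G$) and $t$ with $1=\sum_g e_g$, $e_ge_h=\delta_{g,h}e_g$, $te_g=e_{g\triangleleft t}t$, $t^2=\sum_{g}\sigma(g;t,t)e_g$; coalgebra structure $\Delta(e_g)=\sum_{hk=g}e_h\otimes e_k$, $\Delta(t)=\big[\sum_{g,h}\tau(g,h;t)e_g\otimes e_h\big](t\otimes t)$, $\epsilon(e_g)=\delta_{g,1}$, $\epsilon(t)=1$; antipode $\mathcal{S}(e_g)=e_{g^{-1}}$, $\mathcal{S}(e_gt)=\sigma(g^{-1};t,t)^{-1}\tau(g^{-1},g;t)^{-1}e_{(g\triangleleft t)^{-1}}t$.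 A (left-right) Yetter-Drinfel'd module over $H$ is a left $H$-module $V$ with a right $H$-comodule structure $\rho:V\to V\otimes H$, $\rho(v)=v_0\otimes v_1$, such that $\rho(h\cdot v)=h_2\cdot v_0\otimes h_3v_1\mathcal{S}^{-1}(h_1)$ for $h\in H$, $v\in V$. The category of these is identified with the category of left modules over the Drinfel'd double $\mathcal{D}(H)$, with $f\in H^*$ acting by $f\cdot v=\langle f,v_1\rangle v_0$. Let $\zeta_g,\chi_g$ ($g\in G$) be the basis of $H^*$ dual to $\{e_g,e_gt\}$ ($\zeta_g$ dual to $e_g$, $\chi_g$ dual to $e_gt$); thus $\rho(v)=\sum_{g\in G}\big(\zeta_g v\otimes e_g+\chi_g v\otimes e_gt\big)$, and a Yetter-Drinfel'd module is specified by the actions of $e_g,t,\zeta_g,\chi_g$. List of modules. Two-dimensional spaces have basis $v,w$; $\mathrm{diag}(\alpha,\beta)$ means $v\mapsto\alpha v$, $w\mapsto\beta w$; and $0\le k\le 3$, $0\le l\le 1$. (S0) $V_{\mu,i}^{\pm}=\Bbbk v$ for $\mu=x^ay^b\in\{1,y,x^2,x^2y\}$, $i\in\{0,1,2,3\}$ and a sign $\pm$: $e_gv=\delta_{g,\mu}v$, $tv=\pm\varepsilon_\mu v$ with $\varepsilon_1=\varepsilon_y=1$, $\varepsilon_{x^2}=\varepsilon_{x^2y}=\xi$; $\zeta_{x^ky^l}v=\xi^{ik}(-1)^{bl}v$; $\chi_g=0$. (S1) $W_{\mu,i,s}$ for $\mu\in\{x,x^3\}$, $i\in\{0,1,2,3\}$,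 $s\in\{+,-\}$: $\chi_g=0$; $e_g=\mathrm{diag}(\delta_{g,\mu},\delta_{g,\mu y})$; $tv=w$, $tw=\nu v$ with $\nu=1$ if $\mu=x$ and $\nu=-1$ if $\mu=x^3$; $\zeta_{x^ky^l}=\zeta_x^k\zeta_y^l$, where $\zeta_x=\mathrm{diag}(\xi^i,\xi^i)$, $\zeta_y=\mathrm{diag}(-1,1)$ if $s=+$, and $\zeta_x=\mathrm{diag}(-\xi^i,\xi^i)$, $\zeta_y=\mathrm{diag}(1,-1)$ if $s=-$. (S2) $X_{\mu,i}$ for $\mu\in\{1,y,x^2,x^2y\}$, $i\in\{0,1\}$: $\chi_g=0$; $e_g=\delta_{g,\mu}\,\mathrm{id}$; $tv=w$, $tw=\nu v$ with $\nu=1$ if $\mu\in\{1,y\}$ and $\nu=-1$ if $\mu\in\{x^2,x^2y\}$; $\zeta_{x^ky^l}=\zeta_x^k\zeta_y^l$, where $\zeta_x=\mathrm{diag}(\xi^i,-\xi^i)$, and $\zeta_y=-\mathrm{id}$ if $\mu\in\{1,x^2\}$, $\zeta_y=\mathrm{id}$ if $\mu\in\{y,x^2y\}$. (S3) $Y_{\mu,j}$ for $\mu\in\{x,x^3\}$, $1\le j\le 8$: the eight values of $j$ correspond to the triples $(a,b,\lambda)$ with $a,b\in\{1,-1\}$ and $\lambda\in\Bbbk$ such that $\lambda^2=-ab$ if $\mu=x$, and $\lambda^2=ab$ if $\mu=x^3$; $\zeta_g=0$; $e_g=\mathrm{diag}(\delta_{g,\mu},\delta_{g,\mu y})$; $tv=\lambda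 w$, $tw=-ab\lambda v$; $\chi_{x^ky^l}=\chi_x^k\chi_y^l$, where $\chi_xv=w$, $\chi_xw=av$, $\chi_y=\mathrm{diag}(b,-b)$. (S4) $Z_{\mu,j}$ for $\mu\in\{1,x^2\}$, $1\le j\le 8$: the eight values of $j$ correspond to the triples $(a,b,\lambda)$ with $a,b\in\{1,-1\}$ and $\lambda\in\Bbbk$ such that $\lambda^2=1$ if $\mu=1$, and $\lambda^2=-1$ if $\mu=x^2$; $\zeta_g=0$; $e_g=\mathrm{diag}(\delta_{g,\mu},\delta_{g,\mu y})$; $t=\mathrm{diag}(\lambda,b\lambda)$; $\chi_{x^ky^l}=\chi_x^k\chi_y^l$, where $\chi_xv=w$, $\chi_xw=av$, $\chi_y=\mathrm{diag}(b,-b)$.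
   Formalization: In (S4) the action of t is taken to be diag(λ, −bλ) instead of diag(λ, bλ): with the printed sign the compatibility of t with the coaction fails (it forces tw = −bλw), so none of those 16 spaces would be a Yetter-Drinfel'd module. *)

theory Defs
  imports "HOL-Analysis.Analysis" "HOL-Computational_Algebra.Polynomial"
begin

section \<open>Finite-dimensional Hopf algebras and Yetter-Drinfel'd modules\<close>

text \<open>
  A Hopf algebra with a fixed finite basis indexed by \<open>'b\<close> lives on the coordinate space
  \<open>'k ^ 'b\<close>.  Tensor products are taken in coordinates with respect to that basis:
  \<open>H \<otimes> H\<close> is \<open>'k ^ ('b \<times> 'b)\<close>, and an element \<open>\<Sum>b. u\<^sub>b \<otimes> b\<close> of \<open>V \<otimes> H\<close> is the
  family \<open>\<chi> b. u\<^sub>b\<close> in \<open>'v ^ 'b\<close>.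
\<close>

abbreviation bas :: "'b::finite \<Rightarrow> 'k::zero_neq_one ^ 'b" where
  "bas b \<equiv> axis b 1"

definition tens :: "'k::times ^ 'b::finite \<Rightarrow> 'k ^ 'c::finite \<Rightarrow> 'k ^ ('b \<times> 'c)" where
  "tens a b = (\<chi> p. a $ fst p * b $ snd p)"

record ('b::finite, 'k) hopf =
  mul :: "'k ^ 'b \<Rightarrow> 'k ^ 'b \<Rightarrow> 'k ^ 'b"
  unit :: "'k ^ 'b"
  comult :: "'k ^ 'b \<Rightarrow> 'k ^ ('b \<times> 'b)"
  counit :: "'k ^ 'b \<Rightarrow> 'k"
  antipode :: "'k ^ 'b \<Rightarrow> 'k ^ 'b"

definition mul2 ::
    "('b::finite, 'k::field) hopf \<Rightarrow> 'k ^ ('b \<times> 'b) \<Rightarrow> 'k ^ ('b \<times> 'b) \<Rightarrow> 'k ^ ('b \<times> 'b)" where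
  "mul2 H x y = (\<Sum>p\<in>UNIV. \<Sum>q\<in>UNIV. (x $ p * y $ q) *s
      tens (mul H (bas (fst p)) (bas (fst q))) (mul H (bas (snd p)) (bas (snd q))))"

definition hopf_algebra :: "('b::finite, 'k::field) hopf \<Rightarrow> bool" where
  "hopf_algebra H \<longleftrightarrow>
     (\<forall>a. Vector_Spaces.linear (*s) (*s) (mul H a)) \<and>
     (\<forall>b. Vector_Spaces.linear (*s) (*s) (\<lambda>a. mul H a b)) \<and>
     (\<forall>a b c. mul H (mul H a b) c = mul H a (mul H b c)) \<and>
     (\<forall>a. mul H (unit H) a = a \<and> mul H a (unit H) = a) \<and>
     Vector_Spaces.linear (*s) (*s) (comult H) \<and>
     Vector_Spaces.linear (*s) (*) (counit H) \<and>
     (\<forall>a p q r. (\<Sum>s\<in>UNIV. comult H a $ (s, r) * comult H (bas s) $ (p, q)) =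
                (\<Sum>s\<in>UNIV. comult H a $ (p, s) * comult H (bas s) $ (q, r))) \<and>
     (\<forall>a. (\<Sum>p\<in>UNIV. (comult H a $ p * counit H (bas (fst p))) *s bas (snd p)) = a \<and>
          (\<Sum>p\<in>UNIV. (comult H a $ p * counit H (bas (snd p))) *s bas (fst p)) = a) \<and>
     (\<forall>a b. comult H (mul H a b) = mul2 H (comult H a) (comult H b)) \<and>
     comult H (unit H) = tens (unit H) (unit H) \<and>
     (\<forall>a b. counit H (mul H a b) = counit H a * counit H b) \<and>
     counit H (unit H) = 1 \<and>
     Vector_Spaces.linear (*s) (*s) (antipode H) \<and>
     (\<forall>a. (\<Sum>p\<in>UNIV. comult H a $ p *s mul H (antipode H (bas (fst p))) (bas (snd p)))
              = counit H a *s unit H \<and>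
          (\<Sum>p\<in>UNIV. comult H a $ p *s mul H (bas (fst p)) (antipode H (bas (snd p))))
              = counit H a *s unit H)"

definition comult3 :: "('b::finite, 'k::field) hopf \<Rightarrow> 'k ^ 'b \<Rightarrow> 'k ^ ('b \<times> 'b \<times> 'b)" where
  "comult3 H a = (\<chi> t. case t of (p, q, r) \<Rightarrow>
     \<Sum>s\<in>UNIV. comult H a $ (s, r) * comult H (bas s) $ (p, q))"

text \<open>
  The underlying space \<open>vs\<close> of a module is a subspace of an ambient vector space given by
  \<open>sc\<close>; the values of \<open>act\<close> and \<open>coact\<close> matter only on \<open>vs\<close>.
\<close>

record ('b::finite, 'k, 'v) yd =
  vs :: "'v set"
  act :: "'k ^ 'b \<Rightarrow> 'v \<Rightarrow> 'v"
  coact :: "'v \<Rightarrow> 'v ^ 'b"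

definition left_module ::
    "('b::finite, 'k::field) hopf \<Rightarrow> ('k \<Rightarrow> 'v::ab_group_add \<Rightarrow> 'v) \<Rightarrow> ('b, 'k, 'v) yd \<Rightarrow> bool" where
  "left_module H sc M \<longleftrightarrow>
     (\<forall>a. \<forall>v\<in>vs M. act M a v \<in> vs M) \<and>
     (\<forall>a. \<forall>v\<in>vs M. \<forall>w\<in>vs M. act M a (v + w) = act M a v + act M a w) \<and>
     (\<forall>a c. \<forall>v\<in>vs M. act M a (sc c v) = sc c (act M a v)) \<and>
     (\<forall>a b. \<forall>v\<in>vs M. act M (a + b) v = act M a v + act M b v) \<and>
     (\<forall>a c. \<forall>v\<in>vs M. act M (c *s a) v = sc c (act M a v)) \<and>
     (\<forall>v\<in>vs M. act M (unit H) v = v) \<and>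
     (\<forall>a b. \<forall>v\<in>vs M. act M (mul H a b) v = act M a (act M b v))"

definition right_comodule ::
    "('b::finite, 'k::field) hopf \<Rightarrow> ('k \<Rightarrow> 'v::ab_group_add \<Rightarrow> 'v) \<Rightarrow> ('b, 'k, 'v) yd \<Rightarrow> bool" where
  "right_comodule H sc M \<longleftrightarrow>
     (\<forall>v\<in>vs M. \<forall>b. coact M v $ b \<in> vs M) \<and>
     (\<forall>v\<in>vs M. \<forall>w\<in>vs M. coact M (v + w) = coact M v + coact M w) \<and>
     (\<forall>c. \<forall>v\<in>vs M. coact M (sc c v) = (\<chi> b. sc c (coact M v $ b))) \<and>
     (\<forall>v\<in>vs M. \<forall>p q. coact M (coact M v $ q) $ p =
        (\<Sum>b\<in>UNIV. sc (comult H (bas b) $ (p, q)) (coact M v $ b))) \<and>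
     (\<forall>v\<in>vs M. (\<Sum>b\<in>UNIV. sc (counit H (bas b)) (coact M v $ b)) = v)"

text \<open>
  Compatibility \<open>\<rho>(a\<cdot>v) = a\<^sub>2\<cdot>v\<^sub>0 \<otimes> a\<^sub>3 v\<^sub>1 S\<^sup>-\<^sup>1(a\<^sub>1)\<close>, coordinate by coordinate.
\<close>

definition yd_compatible ::
    "('b::finite, 'k::field) hopf \<Rightarrow> ('k \<Rightarrow> 'v::ab_group_add \<Rightarrow> 'v) \<Rightarrow> ('b, 'k, 'v) yd \<Rightarrow> bool" where
  "yd_compatible H sc M \<longleftrightarrow>
     (\<forall>a. \<forall>v\<in>vs M. \<forall>d. coact M (act M a v) $ d =
        (\<Sum>p\<in>UNIV. \<Sum>q\<in>UNIV. \<Sum>r\<in>UNIV. \<Sum>b\<in>UNIV.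
           sc (comult3 H a $ (p, q, r) *
                  mul H (mul H (bas r) (bas b)) (inv (antipode H) (bas p)) $ d)
                 (act M (bas q) (coact M v $ b))))"

definition yd_module ::
    "('b::finite, 'k::field) hopf \<Rightarrow> ('k \<Rightarrow> 'v::ab_group_add \<Rightarrow> 'v) \<Rightarrow> ('b, 'k, 'v) yd \<Rightarrow> bool" where
  "yd_module H sc M \<longleftrightarrow>
     vector_space sc \<and> module.subspace sc (vs M) \<and>
     left_module H sc M \<and> right_comodule H sc M \<and> yd_compatible H sc M"

definition yd_submodule ::
    "('k::field \<Rightarrow> 'v::ab_group_add \<Rightarrow> 'v) \<Rightarrow> ('b::finite, 'k, 'v) yd \<Rightarrow> 'v set \<Rightarrow> bool" where
  "yd_submodule sc M U \<longleftrightarrow>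
     U \<subseteq> vs M \<and> module.subspace sc U \<and>
     (\<forall>a. \<forall>u\<in>U. act M a u \<in> U) \<and> (\<forall>u\<in>U. \<forall>b. coact M u $ b \<in> U)"

definition simple_yd_module ::
    "('b::finite, 'k::field) hopf \<Rightarrow> ('k \<Rightarrow> 'v::ab_group_add \<Rightarrow> 'v) \<Rightarrow> ('b, 'k, 'v) yd \<Rightarrow> bool" where
  "simple_yd_module H sc M \<longleftrightarrow>
     yd_module H sc M \<and> vs M \<noteq> {0} \<and>
     (\<forall>U. yd_submodule sc M U \<longrightarrow> U = {0} \<or> U = vs M)"

definition yd_iso ::
    "('k::field \<Rightarrow> 'v::ab_group_add \<Rightarrow> 'v) \<Rightarrow> ('k \<Rightarrow> 'w::ab_group_add \<Rightarrow> 'w) \<Rightarrow>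
     ('b::finite, 'k, 'v) yd \<Rightarrow> ('b, 'k, 'w) yd \<Rightarrow> bool" where
  "yd_iso sc sc' M N \<longleftrightarrow>
     (\<exists>f. bij_betw f (vs M) (vs N) \<and>
          (\<forall>v\<in>vs M. \<forall>w\<in>vs M. f (v + w) = f v + f w) \<and>
          (\<forall>c. \<forall>v\<in>vs M. f (sc c v) = sc' c (f v)) \<and>
          (\<forall>a. \<forall>v\<in>vs M. f (act M a v) = act N a (f v)) \<and>
          (\<forall>v\<in>vs M. \<forall>b. coact N (f v) $ b = f (coact M v $ b)))"

text \<open>Isomorphism classes of the simple modules carried by subspaces of one ambient space.\<close>

definition simple_yd_classes ::
    "('b::finite, 'k::field) hopf \<Rightarrow> ('k \<Rightarrow> 'v::ab_group_add \<Rightarrow> 'v) \<Rightarrow> ('b, 'k, 'v) yd set set" where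
  "simple_yd_classes H sc =
     Collect (simple_yd_module H sc) //
     {(M, N). simple_yd_module H sc M \<and> simple_yd_module H sc N \<and> yd_iso sc sc M N}"

definition primitive_root_of_unity :: "nat \<Rightarrow> 'k::monoid_mult \<Rightarrow> bool" where
  "primitive_root_of_unity n z \<longleftrightarrow> z ^ n = 1 \<and> (\<forall>m. 0 < m \<and> m < n \<longrightarrow> z ^ m \<noteq> 1)"


section \<open>The Hopf algebra \<open>H\<^sub>c\<close>\<close>

text \<open>
  The group \<open>G = \<langle>x, y | x\<^sup>4 = 1 = y\<^sup>2, xy = yx\<rangle>\<close> is written additively as \<open>\<int>/4 \<times> \<int>/2\<close>,
  with \<open>x\<^sup>i y\<^sup>j\<close> the pair \<open>(i, j)\<close>.
\<close>

type_synonym G = "4 \<times> 2"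

definition xy :: "nat \<Rightarrow> nat \<Rightarrow> G" where
  "xy i j = (of_nat i, of_nat j)"

definition xexp :: "G \<Rightarrow> nat" where "xexp g = nat (Rep_bit0 (fst g))"
definition yexp :: "G \<Rightarrow> nat" where "yexp g = nat (Rep_bit0 (snd g))"

definition tri :: "G \<Rightarrow> G" where
  "tri g = xy (xexp g) (xexp g + yexp g)"

definition sigma_t :: "G \<Rightarrow> 'k::field" where
  "sigma_t g = (-1) ^ (xexp g * (xexp g - 1) div 2)"

definition tau_t :: "G \<Rightarrow> G \<Rightarrow> 'k::field" where
  "tau_t g h = (-1) ^ (yexp g * xexp h)"

text \<open>
  \<open>Inl g\<close> indexes \<open>e\<^sub>g\<close> and \<open>Inr g\<close> indexes \<open>e\<^sub>g t\<close>.  The coordinates below encode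
  \<open>e\<^sub>g e\<^sub>h = \<delta>\<^bsub>g,h\<^esub> e\<^sub>g\<close>, \<open>e\<^sub>g (e\<^sub>h t) = \<delta>\<^bsub>g,h\<^esub> e\<^sub>g t\<close>, \<open>(e\<^sub>g t) e\<^sub>h = \<delta>\<^bsub>g\<triangleleft>t,h\<^esub> e\<^sub>g t\<close> and
  \<open>(e\<^sub>g t) (e\<^sub>h t) = \<delta>\<^bsub>g\<triangleleft>t,h\<^esub> \<sigma>(g) e\<^sub>g\<close>, and
  \<open>\<Delta>(e\<^sub>g t) = \<Delta>(e\<^sub>g) \<Delta>(t) = \<Sum>hk=g. \<tau>(h,k) e\<^sub>h t \<otimes> e\<^sub>k t\<close>.
\<close>

definition Hc :: "(G + G, 'k::field) hopf" where
  "Hc = \<lparr>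
     mul = (\<lambda>a b. \<chi> p. case p of
        Inl g \<Rightarrow> a $ Inl g * b $ Inl g + a $ Inr g * b $ Inr (tri g) * sigma_t g
      | Inr g \<Rightarrow> a $ Inl g * b $ Inr g + a $ Inr g * b $ Inl (tri g)),
     unit = (\<Sum>g\<in>UNIV. bas (Inl g)),
     comult = (\<lambda>a. \<chi> p. case p of
        (Inl g, Inl h) \<Rightarrow> a $ Inl (g + h)
      | (Inr g, Inr h) \<Rightarrow> tau_t g h * a $ Inr (g + h)
      | _ \<Rightarrow> 0),
     counit = (\<lambda>a. a $ Inl 0 + a $ Inr 0),
     antipode = (\<lambda>a. \<Sum>g\<in>UNIV. a $ Inl g *s bas (Inl (- g)) +
        (a $ Inr g * inverse (sigma_t (- g)) * inverse (tau_t (- g) g)) *s bas (Inr (- tri g)))\<rparr>"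

definition e_H :: "G \<Rightarrow> 'k::field ^ (G + G)" where "e_H g = bas (Inl g)"
definition t_H :: "'k::field ^ (G + G)" where "t_H = (\<Sum>g\<in>UNIV. bas (Inr g))"

subsection \<open>Presentation of \<open>H\<^sub>c\<close> and verification of the Hopf algebra axioms\<close>

lemma xexp_lt: "xexp g < 4" and yexp_lt: "yexp g < 2"
  using bit0.Rep_less_n[of "fst g"] bit0.Rep_less_n[of "snd g"] by (simp_all add: xexp_def yexp_def)

lemma xy_exp: "xy (xexp g) (yexp g) = g"
proof -
  have *: "of_nat (nat (Rep_bit0 z)) = z" for z :: "'n::finite bit0"
    using Rep_bit0[of z] by (simp add: bit0.of_nat_eq bit0.Rep_mod bit0.Rep_inverse del: card_bit0)
  show ?thesis by (cases g) (simp add: xy_def xexp_def yexp_def *)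
qed

lemma xexp_xy: "xexp (xy i j) = i mod 4" and yexp_xy: "yexp (xy i j) = j mod 2"
  using bit0.Rep_Abs_mod[where 'a="2", of "int i"] bit0.Rep_Abs_mod[where 'a="1", of "int j"]
  by (simp_all add: xy_def xexp_def yexp_def bit0.of_nat_eq nat_mod_distrib)

lemma xy_eq_iff: "xy i j = xy k l \<longleftrightarrow> i mod 4 = k mod 4 \<and> j mod 2 = l mod 2"
  by (metis xexp_xy yexp_xy xy_exp)

lemma xy_cases: obtains i j where "g = xy i j" "i \<in> {0,1,2,3}" "j \<in> {0,1}"
  using that[of "xexp g" "yexp g"] xexp_lt[of g] yexp_lt[of g] by (fastforce simp: xy_exp)

lemma xy_add: "xy i j + xy k l = xy (i + k) (j + l)"
  by (simp add: xy_def)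

lemma xy_0: "xy 0 0 = 0"
  by (simp add: xy_def zero_prod_def)

lemma tri_xy: "tri (xy i j) = xy i (i + j)"
  using mod_add_cong[of "i mod 4" 2 i j j] mod_mod_cancel[of 2 4 i]
  by (simp add: tri_def xexp_xy yexp_xy xy_eq_iff mod_add_right_eq)

lemma minus_xy: "- xy i j = xy (3 * i) j"
proof -
  have "xy i j + xy (3 * i) j = 0"
    unfolding xy_add xy_0[symmetric] xy_eq_iff by simp
  then show ?thesis by (simp add: minus_unique)
qed

lemma tri_involution [simp]: "tri (tri g) = g"
  by (cases g rule: xy_cases) (auto simp: tri_xy xy_eq_iff)

lemma tri_eq_iff: "tri g = h \<longleftrightarrow> g = tri h"
  by auto

lemma tri_add: "tri (g + h) = tri g + tri h"
  by (cases g rule: xy_cases, cases h rule: xy_cases) (simp add: tri_xy xy_add xy_eq_iff ac_simps)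

lemma tri_0 [simp]: "tri 0 = 0"
  by (simp add: tri_xy flip: xy_0)

lemma tri_minus: "tri (- g) = - tri g"
  by (metis tri_add tri_0 add_eq_0_iff)

lemma sigma_0: "sigma_t 0 = 1"
  by (simp add: sigma_t_def xexp_xy flip: xy_0)

lemma tau_xy: "tau_t (xy i j) (xy k l) = (-1) ^ (j * k)"
  unfolding tau_t_def xexp_xy yexp_xy by (cases "even j"; cases "even k") (simp_all add: minus_one_power_iff dvd_mod_iff)

lemma sigma_tri [simp]: "sigma_t (tri g) = sigma_t g"
  using xexp_lt[of g] by (simp add: sigma_t_def tri_def xexp_xy)

lemma sigma_add: "sigma_t (g + h) = (sigma_t g * sigma_t h * tau_t g h * tau_t (tri g) (tri h) :: 'k::field)"
  by (cases g rule: xy_cases, cases h rule: xy_cases)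
    (auto simp: sigma_t_def tau_t_def tri_xy xy_add xexp_xy yexp_xy)

lemma tau_add: "tau_t (g + h) k = (tau_t g k * tau_t h k :: 'k::field)"
  "tau_t g (h + k) = (tau_t g h * tau_t g k :: 'k::field)"
  by (cases g rule: xy_cases, cases h rule: xy_cases, cases k rule: xy_cases,
      simp add: tau_xy xy_add algebra_simps flip: power_add)+

lemma sigma_square: "sigma_t g * sigma_t g = (1 :: 'k::field)"
  by (simp add: sigma_t_def flip: power_mult_distrib)

lemma tau_square: "tau_t g h * tau_t g h = (1 :: 'k::field)"
  by (simp add: tau_t_def flip: power_mult_distrib)

lemma sum_UNIV_Plus:
  "(\<Sum>p\<in>UNIV. f p) = (\<Sum>g\<in>UNIV. f (Inl g)) + (\<Sum>g\<in>UNIV. f (Inr g))"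
  for f :: "'a::finite + 'b::finite \<Rightarrow> 'c::comm_monoid_add"
  by (simp add: UNIV_Plus_UNIV[symmetric] sum.Plus del: UNIV_Plus_UNIV)

lemma sum_UNIV_prod: "(\<Sum>p\<in>UNIV. f p) = (\<Sum>a\<in>UNIV. \<Sum>b\<in>UNIV. f (a, b))"
  for f :: "'a::finite \<times> 'b::finite \<Rightarrow> 'c::comm_monoid_add"
  by (simp add: UNIV_Times_UNIV[symmetric] sum.cartesian_product del: UNIV_Times_UNIV)

lemma sum_UNIV2: "(\<Sum>p\<in>UNIV. f p) =
    (\<Sum>g\<in>UNIV. \<Sum>h\<in>UNIV. f (Inl g, Inl h)) + (\<Sum>g\<in>UNIV. \<Sum>h\<in>UNIV. f (Inl g, Inr h)) +
    ((\<Sum>g\<in>UNIV. \<Sum>h\<in>UNIV. f (Inr g, Inl h)) + (\<Sum>g\<in>UNIV. \<Sum>h\<in>UNIV. f (Inr g, Inr h)))"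
  for f :: "('a::finite + 'b::finite) \<times> ('c::finite + 'd::finite) \<Rightarrow> 'e::comm_monoid_add"
  by (simp only: sum_UNIV_prod sum_UNIV_Plus sum.distrib add_ac)

lemma all_Plus: "(\<forall>p. P p) \<longleftrightarrow> (\<forall>g. P (Inl g)) \<and> (\<forall>g. P (Inr g))"
  by (metis sumE)

lemma vec2_eq_iff: "x = y \<longleftrightarrow>
    (\<forall>g h. x $ (Inl g, Inl h) = y $ (Inl g, Inl h)) \<and> (\<forall>g h. x $ (Inl g, Inr h) = y $ (Inl g, Inr h)) \<and>
    (\<forall>g h. x $ (Inr g, Inl h) = y $ (Inr g, Inl h)) \<and> (\<forall>g h. x $ (Inr g, Inr h) = y $ (Inr g, Inr h))"
  for x y :: "'k ^ (('a::finite + 'b::finite) \<times> ('c::finite + 'd::finite))"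
  unfolding vec_eq_iff split_paired_All all_Plus by blast

lemma mul_Hc: "mul Hc a b $ Inl g = a $ Inl g * b $ Inl g + a $ Inr g * b $ Inr (tri g) * sigma_t g"
  "mul Hc a b $ Inr g = a $ Inl g * b $ Inr g + a $ Inr g * b $ Inl (tri g)"
  by (simp_all add: Hc_def)

lemma bas_nth: "bas p $ q = of_bool (q = p)"
  by (simp add: axis_def)

lemma unit_Hc: "unit Hc $ Inl g = 1" "unit Hc $ Inr g = 0"
  by (simp_all add: Hc_def bas_nth of_bool_def sum.delta)

lemma comult_Hc:
  "comult Hc a $ (Inl g, Inl h) = a $ Inl (g + h)"
  "comult Hc a $ (Inr g, Inr h) = tau_t g h * a $ Inr (g + h)"
  "comult Hc a $ (Inl g, Inr h) = 0"
  "comult Hc a $ (Inr g, Inl h) = 0"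
  by (simp_all add: Hc_def)

lemma counit_Hc: "counit Hc a = a $ Inl 0 + a $ Inr 0"
  by (simp add: Hc_def)

lemma sum_delta_bool:
  "(\<Sum>g\<in>UNIV. F g * of_bool (x = g)) = F x"
  "(\<Sum>g\<in>UNIV. of_bool (x = g) * F g) = F x"
  "(\<Sum>g\<in>UNIV. F g * of_bool (g = x)) = F x"
  "(\<Sum>g\<in>UNIV. of_bool (g = x) * F g) = F x"
  for F :: "'a::finite \<Rightarrow> 'k::field"
proof -
  have "(\<Sum>g\<in>UNIV. if x = g then F g else 0) = F x"
    by simp
  moreover have "F g * of_bool (x = g) = (if x = g then F g else 0)" for g
    by simp
  ultimately show *: "(\<Sum>g\<in>UNIV. F g * of_bool (x = g)) = F x"
    by (simp only:)
  then show "(\<Sum>g\<in>UNIV. of_bool (x = g) * F g) = F x"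
    "(\<Sum>g\<in>UNIV. F g * of_bool (g = x)) = F x"
    "(\<Sum>g\<in>UNIV. of_bool (g = x) * F g) = F x"
    by (simp_all only: eq_commute[of _ x] mult.commute[of "of_bool _"])
qed

lemma e_H_nth: "e_H g $ Inl h = (of_bool (h = g) :: 'k::field)" "e_H g $ Inr h = (0 :: 'k)"
  by (simp_all add: e_H_def bas_nth)

lemma t_H_nth: "t_H $ Inl g = (0 :: 'k::field)" "t_H $ Inr g = (1 :: 'k)"
  by (simp_all add: t_H_def bas_nth of_bool_def)

lemma Hc_relations:
  "unit Hc = (\<Sum>g\<in>UNIV. e_H g :: 'k::field ^ (G + G))"
  "mul Hc (e_H g) (e_H h) = (if g = h then e_H g else 0 :: 'k ^ (G + G))"
  "mul Hc t_H (e_H g) = (mul Hc (e_H (tri g)) t_H :: 'k ^ (G + G))"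
  "mul Hc t_H t_H = (\<Sum>g\<in>UNIV. sigma_t g *s e_H g :: 'k ^ (G + G))"
  "mul Hc (e_H g) t_H = (bas (Inr g) :: 'k ^ (G + G))"
proof -
  show "unit Hc = (\<Sum>g\<in>UNIV. e_H g :: 'k ^ (G + G))"
    by (simp add: Hc_def e_H_def)
  show "mul Hc (e_H g) (e_H h) = (if g = h then e_H g else 0 :: 'k ^ (G + G))"
    by (auto simp: vec_eq_iff all_Plus mul_Hc e_H_nth)
  show "mul Hc t_H (e_H g) = (mul Hc (e_H (tri g)) t_H :: 'k ^ (G + G))"
    by (auto simp: vec_eq_iff all_Plus mul_Hc e_H_nth t_H_nth of_bool_def)
  show "mul Hc t_H t_H = (\<Sum>g\<in>UNIV. sigma_t g *s e_H g :: 'k ^ (G + G))"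
    by (simp add: vec_eq_iff all_Plus mul_Hc e_H_nth t_H_nth sum_delta_bool del: sum_mult_of_bool_eq sum_of_bool_mult_eq)
  show "mul Hc (e_H g) t_H = (bas (Inr g) :: 'k ^ (G + G))"
    by (auto simp: vec_eq_iff all_Plus mul_Hc e_H_nth t_H_nth bas_nth)
qed

lemma mul2_Hc:
  "mul2 Hc x y $ (u, v) = (\<Sum>p\<in>UNIV. \<Sum>q\<in>UNIV. x $ p * y $ q *
      (mul Hc (bas (fst p)) (bas (fst q)) $ u * mul Hc (bas (snd p)) (bas (snd q)) $ v))"
  by (simp add: mul2_def tens_def)

lemma sum2_delta:
  fixes F :: "'a::finite \<Rightarrow> 'b::finite \<Rightarrow> 'k::field"
  shows "(\<Sum>a\<in>UNIV. \<Sum>b\<in>UNIV. F a b * (of_bool (u = a) * of_bool (v = b))) = F u v"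
proof -
  have "(\<Sum>a\<in>UNIV. \<Sum>b\<in>UNIV. F a b * (of_bool (u = a) * of_bool (v = b))) =
    (\<Sum>a\<in>UNIV. (\<Sum>b\<in>UNIV. F a b * of_bool (v = b)) * of_bool (u = a))"
    unfolding sum_distrib_right by (intro sum.cong refl) (simp only: mult_ac)
  then show ?thesis by (simp only: sum_delta_bool)
qed

lemma mul_bas_nth:
  "mul Hc (bas (Inl a)) (bas (Inl b)) $ Inl g = (of_bool (a = g) * of_bool (b = g) :: 'k::field)"
  "mul Hc (bas (Inl a)) (bas (Inr b)) $ Inr g = (of_bool (a = g) * of_bool (b = g) :: 'k::field)"
  "mul Hc (bas (Inr a)) (bas (Inl b)) $ Inr g = (of_bool (a = g) * of_bool (b = tri g) :: 'k::field)"
  "mul Hc (bas (Inr a)) (bas (Inr b)) $ Inl g = (of_bool (a = g) * of_bool (b = tri g) * sigma_t g :: 'k::field)"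
  "mul Hc (bas (Inl a)) (bas (Inl b)) $ Inr g = (0 :: 'k)"
  "mul Hc (bas (Inl a)) (bas (Inr b)) $ Inl g = (0 :: 'k)"
  "mul Hc (bas (Inr a)) (bas (Inl b)) $ Inl g = (0 :: 'k)"
  "mul Hc (bas (Inr a)) (bas (Inr b)) $ Inr g = (0 :: 'k)"
  by (auto simp: mul_Hc bas_nth of_bool_def)

lemma sum4_delta:
  fixes X Y :: "'a::finite \<Rightarrow> 'a \<Rightarrow> 'k::field"
  shows "(\<Sum>a\<in>UNIV. \<Sum>c\<in>UNIV. \<Sum>b\<in>UNIV. \<Sum>d\<in>UNIV.
      X a c * Y b d * ((of_bool (a = g) * of_bool (b = g') * K) * (of_bool (c = h) * of_bool (d = h') * L)))
    = X g h * Y g' h' * (K * L)" (is "?S = _")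
proof -
  have "(\<Sum>b\<in>UNIV. \<Sum>d\<in>UNIV.
      X a c * Y b d * ((of_bool (a = g) * of_bool (b = g') * K) * (of_bool (c = h) * of_bool (d = h') * L)))
    = (X a c * K * L * Y g' h') * (of_bool (g = a) * of_bool (h = c))" (is "?l = ?r") for a c
  proof -
    have "?l = (\<Sum>b\<in>UNIV. \<Sum>d\<in>UNIV. (X a c * K * L * of_bool (a = g) * of_bool (c = h) * Y b d) *
         (of_bool (g' = b) * of_bool (h' = d)))"
      by (intro sum.cong refl) (simp only: eq_commute[of g'] eq_commute[of h'] mult_ac)
    also have "\<dots> = X a c * K * L * of_bool (a = g) * of_bool (c = h) * Y g' h'"
      by (rule sum2_delta)
    finally show ?thesis by (simp only: eq_commute[of g] eq_commute[of h] mult_ac)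
  qed
  then have "?S = (\<Sum>a\<in>UNIV. \<Sum>c\<in>UNIV. (X a c * K * L * Y g' h') * (of_bool (g = a) * of_bool (h = c)))"
    by (simp only:)
  also have "\<dots> = X g h * K * L * Y g' h'"
    by (rule sum2_delta)
  finally show ?thesis by (simp only: mult_ac)
qed

lemma mul2_diagonal:
  fixes x y :: "'k::field ^ ((G + G) \<times> (G + G))"
  assumes "\<And>g h. x $ (Inl g, Inr h) = 0" "\<And>g h. x $ (Inr g, Inl h) = 0"
    and "\<And>g h. y $ (Inl g, Inr h) = 0" "\<And>g h. y $ (Inr g, Inl h) = 0"
  shows "mul2 Hc x y $ (Inl g, Inl h) = x $ (Inl g, Inl h) * y $ (Inl g, Inl h) +
      x $ (Inr g, Inr h) * y $ (Inr (tri g), Inr (tri h)) * (sigma_t g * sigma_t h)"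
    and "mul2 Hc x y $ (Inr g, Inr h) = x $ (Inl g, Inl h) * y $ (Inr g, Inr h) +
      x $ (Inr g, Inr h) * y $ (Inl (tri g), Inl (tri h))"
    and "mul2 Hc x y $ (Inl g, Inr h) = 0"
    and "mul2 Hc x y $ (Inr g, Inl h) = 0"
  using sum4_delta[of "\<lambda>g h. x $ (Inl g, Inl h)" "\<lambda>g h. y $ (Inl g, Inl h)" g g 1 h h 1]
    sum4_delta[of "\<lambda>g h. x $ (Inl g, Inl h)" "\<lambda>g h. y $ (Inr g, Inr h)" g g 1 h h 1]
    sum4_delta[of "\<lambda>g h. x $ (Inr g, Inr h)" "\<lambda>g h. y $ (Inl g, Inl h)" g "tri g" 1 h "tri h" 1]
    sum4_delta[of "\<lambda>g h. x $ (Inr g, Inr h)" "\<lambda>g h. y $ (Inr g, Inr h)" g "tri g" "sigma_t g" h "tri h" "sigma_t h"]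
  by (simp_all add: mul2_Hc sum_UNIV2 assms mul_bas_nth sum.distrib del: sum_mult_of_bool_eq sum_of_bool_mult_eq)

lemma Hc_coalgebra_generators:
  "comult Hc (e_H g) = (\<Sum>h\<in>UNIV. tens (e_H h) (e_H (g - h)) :: 'k::field ^ ((G + G) \<times> (G + G)))"
  "comult Hc t_H = (mul2 Hc (\<Sum>g\<in>UNIV. \<Sum>h\<in>UNIV. tau_t g h *s tens (e_H g) (e_H h)) (tens t_H t_H)
     :: 'k ^ ((G + G) \<times> (G + G)))"
  "counit Hc (e_H g) = (of_bool (g = 0) :: 'k)"
  "counit Hc t_H = (1 :: 'k)"
proof -
  define J :: "'k ^ ((G + G) \<times> (G + G))"
    where "J = (\<Sum>g\<in>UNIV. \<Sum>h\<in>UNIV. tau_t g h *s tens (e_H g) (e_H h))"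
  define T :: "'k ^ ((G + G) \<times> (G + G))" where "T = tens t_H t_H"
  have J: "J $ (Inl g, Inl h) = tau_t g h" "J $ (Inl g, Inr h) = 0"
    "J $ (Inr g, Inl h) = 0" "J $ (Inr g, Inr h) = 0" for g h
    using sum2_delta[of tau_t g h]
    by (simp_all add: J_def tens_def e_H_nth del: sum_mult_of_bool_eq sum_of_bool_mult_eq)
  have T: "T $ (Inl g, Inl h) = 0" "T $ (Inl g, Inr h) = 0"
    "T $ (Inr g, Inl h) = 0" "T $ (Inr g, Inr h) = 1" for g h
    by (simp_all add: T_def tens_def t_H_nth)
  have "comult Hc t_H = mul2 Hc J T"
    by (simp add: vec2_eq_iff J T comult_Hc mul2_diagonal t_H_nth)
  then show "comult Hc t_H = (mul2 Hc (\<Sum>g\<in>UNIV. \<Sum>h\<in>UNIV. tau_t g h *s tens (e_H g) (e_H h)) (tens t_H t_H)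
     :: 'k ^ ((G + G) \<times> (G + G)))"
    by (simp only: J_def T_def)
  show "counit Hc (e_H g) = (of_bool (g = 0) :: 'k)" "counit Hc t_H = (1 :: 'k)"
    by (auto simp: counit_Hc e_H_def bas_nth t_H_nth)
  have "(\<Sum>h\<in>UNIV. of_bool (a = h) * of_bool (b = g - h)) = (of_bool (a + b = g) :: 'k)" for a b
    by (subst sum_delta_bool) (auto simp: algebra_simps)
  then show "comult Hc (e_H g) = (\<Sum>h\<in>UNIV. tens (e_H h) (e_H (g - h)) :: 'k ^ ((G + G) \<times> (G + G)))"
    by (auto simp: vec2_eq_iff tens_def comult_Hc e_H_def bas_nth)
qed

lemma antipode_Hc_nth:
  "antipode Hc a $ Inl g = a $ Inl (- g)"
  "antipode Hc a $ Inr g = a $ Inr (- tri g) * inverse (sigma_t (tri g)) * inverse (tau_t (tri g) (- tri g))"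
proof -
  show "antipode Hc a $ Inl g = a $ Inl (- g)"
    using sum_delta_bool(3)[of "\<lambda>g. a $ Inl g" "- g"]
    by (simp add: Hc_def bas_nth equation_minus_iff[of g] del: sum_mult_of_bool_eq sum_of_bool_mult_eq)
  have *: "g = - tri h \<longleftrightarrow> h = - tri g" for h
    by (metis tri_minus tri_involution minus_minus)
  show "antipode Hc a $ Inr g = a $ Inr (- tri g) * inverse (sigma_t (tri g)) * inverse (tau_t (tri g) (- tri g))"
    using sum_delta_bool(3)[of "\<lambda>h. a $ Inr h * inverse (sigma_t (- h)) * inverse (tau_t (- h) h)" "- tri g"]
    by (simp add: Hc_def bas_nth * del: sum_mult_of_bool_eq sum_of_bool_mult_eq)
qed

lemma tau_0: "tau_t 0 g = 1" "tau_t g 0 = 1"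
  by (simp_all add: tau_t_def xexp_xy yexp_xy flip: xy_0)

lemma tau_minus: "tau_t (- g) h = (tau_t g h :: 'k::field)" "tau_t g (- h) = (tau_t g h :: 'k::field)"
proof -
  have "tau_t (- g) h * tau_t g h = (1 :: 'k)" "tau_t g (- h) * tau_t g h = (1 :: 'k)"
    by (simp_all add: tau_0 flip: tau_add)
  then show "tau_t (- g) h = (tau_t g h :: 'k)" "tau_t g (- h) = (tau_t g h :: 'k)"
    using tau_square[of g h, where 'k='k] by (metis mult.assoc mult.left_neutral mult.right_neutral)+
qed

lemma sigma_minus_tri: "sigma_t (- tri g) = sigma_t (- g)"
  by (simp flip: tri_minus)

lemma counit_bas: "counit Hc (bas (Inl g)) = (of_bool (0 = g) :: 'k::field)"
  "counit Hc (bas (Inr g)) = (of_bool (0 = g) :: 'k)"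
  by (simp_all add: counit_Hc bas_nth)

lemma antipode_bas: "antipode Hc (bas (Inl g)) = (bas (Inl (- g)) :: 'k::field ^ (G + G))"
  "antipode Hc (bas (Inr g)) =
     ((inverse (sigma_t (- g)) * inverse (tau_t (- g) g)) *s bas (Inr (- tri g)) :: 'k ^ (G + G))"
proof -
  have *: "- tri h = g \<longleftrightarrow> h = - tri g" for g h
    by (metis tri_minus tri_involution minus_minus)
  have **: "- h = g \<longleftrightarrow> h = - g" for g h :: G
    by (metis minus_minus)
  show "antipode Hc (bas (Inl g)) = (bas (Inl (- g)) :: 'k::field ^ (G + G))"
    by (simp add: vec_eq_iff all_Plus antipode_Hc_nth bas_nth ** del: split_paired_All)
  show "antipode Hc (bas (Inr g)) =
     ((inverse (sigma_t (- g)) * inverse (tau_t (- g) g)) *s bas (Inr (- tri g)) :: 'k ^ (G + G))"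
    by (auto simp: vec_eq_iff all_Plus antipode_Hc_nth bas_nth * tri_minus tau_minus sigma_minus_tri)
qed

lemma antipode_mul_nth:
  fixes c defines "c \<equiv> \<lambda>g. inverse (sigma_t (- g)) * inverse (tau_t (- g) g) :: 'k::field"
  shows "mul Hc (antipode Hc (bas (Inl g))) (bas (Inl k)) $ Inl u = (of_bool (- u = g) * of_bool (u = k) :: 'k)"
    and "mul Hc (antipode Hc (bas (Inl g))) (bas (Inl k)) $ Inr u = (0 :: 'k)"
    and "mul Hc (antipode Hc (bas (Inr g))) (bas (Inr k)) $ Inl u =
      c g * sigma_t u * (of_bool (- tri u = g) * of_bool (tri u = k))"
    and "mul Hc (antipode Hc (bas (Inr g))) (bas (Inr k)) $ Inr u = (0 :: 'k)"
    and "mul Hc (bas (Inl g)) (antipode Hc (bas (Inl k))) $ Inl u = (of_bool (u = g) * of_bool (- u = k) :: 'k)"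
    and "mul Hc (bas (Inl g)) (antipode Hc (bas (Inl k))) $ Inr u = (0 :: 'k)"
    and "mul Hc (bas (Inr g)) (antipode Hc (bas (Inr k))) $ Inl u =
      c k * sigma_t u * (of_bool (u = g) * of_bool (- u = k))"
    and "mul Hc (bas (Inr g)) (antipode Hc (bas (Inr k))) $ Inr u = (0 :: 'k)"
proof -
  have 1: "u = - g \<longleftrightarrow> - u = g" for u g :: G
    by (metis minus_minus)
  have 2: "u = - tri g \<longleftrightarrow> - tri u = g" for u g
    by (metis tri_minus tri_involution minus_minus)
  have 3: "tri u = - tri g \<longleftrightarrow> - u = g" for u g
    by (metis tri_minus tri_involution minus_minus)
  show "mul Hc (antipode Hc (bas (Inl g))) (bas (Inl k)) $ Inl u = (of_bool (- u = g) * of_bool (u = k) :: 'k)"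
    "mul Hc (antipode Hc (bas (Inl g))) (bas (Inl k)) $ Inr u = (0 :: 'k)"
    "mul Hc (antipode Hc (bas (Inr g))) (bas (Inr k)) $ Inl u =
      c g * sigma_t u * (of_bool (- tri u = g) * of_bool (tri u = k))"
    "mul Hc (antipode Hc (bas (Inr g))) (bas (Inr k)) $ Inr u = (0 :: 'k)"
    "mul Hc (bas (Inl g)) (antipode Hc (bas (Inl k))) $ Inl u = (of_bool (u = g) * of_bool (- u = k) :: 'k)"
    "mul Hc (bas (Inl g)) (antipode Hc (bas (Inl k))) $ Inr u = (0 :: 'k)"
    "mul Hc (bas (Inr g)) (antipode Hc (bas (Inr k))) $ Inl u =
      c k * sigma_t u * (of_bool (u = g) * of_bool (- u = k))"
    "mul Hc (bas (Inr g)) (antipode Hc (bas (Inr k))) $ Inr u = (0 :: 'k)"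
    by (simp_all add: antipode_bas mul_Hc bas_nth 1 2 3 c_def)
      (metis tri_minus tri_involution minus_minus)+
qed

lemma antipode_law:
  fixes a :: "'k::field ^ (G + G)"
  shows "(\<Sum>p\<in>UNIV. comult Hc a $ p *s mul Hc (antipode Hc (bas (fst p))) (bas (snd p)))
              = counit Hc a *s unit Hc" (is "?L = _")
    and "(\<Sum>p\<in>UNIV. comult Hc a $ p *s mul Hc (bas (fst p)) (antipode Hc (bas (snd p))))
              = counit Hc a *s unit Hc" (is "?R = _")
proof -
  let ?c = "\<lambda>g. inverse (sigma_t (- g)) * inverse (tau_t (- g) g) :: 'k"
  have nz: "sigma_t g \<noteq> (0 :: 'k)" "tau_t g h \<noteq> (0 :: 'k)" for g h
    by (simp_all add: sigma_t_def tau_t_def)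
  have "?L $ Inl u =
      (\<Sum>g\<in>UNIV. \<Sum>k\<in>UNIV. a $ Inl (g + k) * (of_bool (- u = g) * of_bool (u = k))) +
      (\<Sum>g\<in>UNIV. \<Sum>k\<in>UNIV. (tau_t g k * a $ Inr (g + k) * ?c g * sigma_t u) *
          (of_bool (- tri u = g) * of_bool (tri u = k)))" for u
    by (simp only: sum_component vector_add_component vector_smult_component sum_UNIV2 comult_Hc fst_conv snd_conv
        antipode_mul_nth sum.distrib mult.assoc mult_zero_left mult_zero_right sum.neutral_const add_0_left add_0_right)
  then have "?L $ Inl u = a $ Inl 0 + a $ Inr 0" for u
    by (simp only: sum2_delta) (simp add: nz tau_minus field_simps)
  moreover have "?L $ Inr u = 0" for u
    by (simp add: sum_UNIV2 comult_Hc antipode_mul_nth)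
  ultimately show "?L = counit Hc a *s unit Hc"
    by (simp only: vec_eq_iff all_Plus vector_smult_component counit_Hc unit_Hc) simp
  have "?R $ Inl u =
      (\<Sum>g\<in>UNIV. \<Sum>k\<in>UNIV. a $ Inl (g + k) * (of_bool (u = g) * of_bool (- u = k))) +
      (\<Sum>g\<in>UNIV. \<Sum>k\<in>UNIV. (tau_t g k * a $ Inr (g + k) * ?c k * sigma_t u) *
          (of_bool (u = g) * of_bool (- u = k)))" for u
    by (simp only: sum_component vector_add_component vector_smult_component sum_UNIV2 comult_Hc fst_conv snd_conv
        antipode_mul_nth sum.distrib mult.assoc mult_zero_left mult_zero_right sum.neutral_const add_0_left add_0_right)
  then have "?R $ Inl u = a $ Inl 0 + a $ Inr 0" for u
    by (simp only: sum2_delta) (simp add: nz tau_minus field_simps)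
  moreover have "?R $ Inr u = 0" for u
    by (simp add: sum_UNIV2 comult_Hc antipode_mul_nth)
  ultimately show "?R = counit Hc a *s unit Hc"
    by (simp only: vec_eq_iff all_Plus vector_smult_component counit_Hc unit_Hc) simp
qed

lemma hopf_algebra_Hc: "hopf_algebra (Hc :: (G + G, 'k::field) hopf)"
  unfolding hopf_algebra_def
proof (intro conjI allI)
  fix a b c :: "'k ^ (G + G)" and p q r
  show "Vector_Spaces.linear (*s) (*s) (comult Hc :: 'k ^ (G + G) \<Rightarrow> _)"
    by (unfold_locales; simp add: vec2_eq_iff comult_Hc algebra_simps)+
  show "Vector_Spaces.linear (*s) (*s) (mul Hc a)" "Vector_Spaces.linear (*s) (*s) (\<lambda>a. mul Hc a b)"
    "Vector_Spaces.linear (*s) (*s) (antipode Hc :: 'k ^ (G + G) \<Rightarrow> _)"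
    by (unfold_locales; simp add: vec_eq_iff all_Plus mul_Hc antipode_Hc_nth algebra_simps)+
  show "Vector_Spaces.linear (*s) (*) (counit Hc :: 'k ^ (G + G) \<Rightarrow> _)"
    by (unfold_locales; simp add: counit_Hc algebra_simps)+
  show "mul Hc (mul Hc a b) c = mul Hc a (mul Hc b c)"
    by (simp add: vec_eq_iff all_Plus mul_Hc algebra_simps)
  show "mul Hc (unit Hc) a = a" "mul Hc a (unit Hc) = a"
    by (simp_all add: vec_eq_iff all_Plus mul_Hc unit_Hc)
  show "comult Hc (mul Hc a b) = mul2 Hc (comult Hc a) (comult Hc b)"
    by (simp add: vec2_eq_iff comult_Hc mul_Hc mul2_diagonal tri_add sigma_add algebra_simps)
  show "comult Hc (unit Hc) = (tens (unit Hc) (unit Hc) :: 'k ^ ((G + G) \<times> (G + G)))"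
    by (simp add: vec2_eq_iff comult_Hc unit_Hc tens_def)
  show "counit Hc (mul Hc a b) = counit Hc a * counit Hc b"
    by (simp add: counit_Hc mul_Hc algebra_simps sigma_0)
  show "counit Hc (unit Hc) = (1 :: 'k)"
    by (simp add: counit_Hc unit_Hc)
  show "(\<Sum>s\<in>UNIV. comult Hc a $ (s, r) * comult Hc (bas s) $ (p, q)) =
      (\<Sum>s\<in>UNIV. comult Hc a $ (p, s) * comult Hc (bas s) $ (q, r))"
    by (cases p; cases q; cases r)
      (simp_all add: sum_UNIV_Plus comult_Hc bas_nth mult.assoc[symmetric] sum_delta_bool tau_add,
       simp_all add: ac_simps)
  show "(\<Sum>p\<in>UNIV. (comult Hc a $ p * counit Hc (bas (fst p))) *s bas (snd p)) = a"
    "(\<Sum>p\<in>UNIV. (comult Hc a $ p * counit Hc (bas (snd p))) *s bas (fst p)) = a"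
    using sum2_delta[of "\<lambda>g h. a $ Inl (g + h)" 0] sum2_delta[of "\<lambda>g h. tau_t g h * a $ Inr (g + h)" 0]
      sum2_delta[of "\<lambda>g h. a $ Inl (g + h)" _ 0] sum2_delta[of "\<lambda>g h. tau_t g h * a $ Inr (g + h)" _ 0]
    by (simp_all add: vec_eq_iff all_Plus sum_UNIV2 comult_Hc counit_bas bas_nth tau_0 mult_ac
        del: sum_mult_of_bool_eq sum_of_bool_mult_eq)
  show "(\<Sum>p\<in>UNIV. comult Hc a $ p *s mul Hc (antipode Hc (bas (fst p))) (bas (snd p)))
              = counit Hc a *s unit Hc"
    "(\<Sum>p\<in>UNIV. comult Hc a $ p *s mul Hc (bas (fst p)) (antipode Hc (bas (snd p))))
              = counit Hc a *s unit Hc"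
    by (rule antipode_law)+
qed

lemma antipode_involution: "antipode Hc (antipode Hc a) = (a :: 'k::field ^ (G + G))"
proof -
  have nz: "sigma_t g \<noteq> (0 :: 'k)" "tau_t g h \<noteq> (0 :: 'k)" for g h
    by (simp_all add: sigma_t_def tau_t_def)
  have "sigma_t g * sigma_t (- g) * tau_t g g * tau_t (tri g) (tri g) = (1 :: 'k)" for g
    using sigma_add[of g "- g", where 'k='k] by (simp add: sigma_0 tri_minus tau_minus)
  then show ?thesis
    by (simp add: vec_eq_iff all_Plus antipode_Hc_nth tri_minus tau_minus sigma_minus_tri nz field_simps
        del: split_paired_All)
qed

lemma inv_antipode: "inv (antipode Hc) = (antipode Hc :: 'k::field ^ (G + G) \<Rightarrow> _)"
  by (rule inv_equality) (rule antipode_involution)+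

section \<open>The list of modules\<close>

text \<open>
  All listed modules are realised inside the ambient space \<open>'k ^ 2\<close> with basis
  \<open>v = axis 1 1\<close>, \<open>w = axis 2 1\<close>.  A module is assembled from the operators by which
  \<open>e\<^sub>g\<close>, \<open>t\<close>, \<open>\<zeta>\<^sub>g\<close> and \<open>\<chi>\<^sub>g\<close> act.
\<close>

definition yd_of_ops ::
    "('k::field ^ 2) set \<Rightarrow> (G \<Rightarrow> 'k ^ 2 \<Rightarrow> 'k ^ 2) \<Rightarrow> ('k ^ 2 \<Rightarrow> 'k ^ 2) \<Rightarrow>
     (G \<Rightarrow> 'k ^ 2 \<Rightarrow> 'k ^ 2) \<Rightarrow> (G \<Rightarrow> 'k ^ 2 \<Rightarrow> 'k ^ 2) \<Rightarrow> (G + G, 'k, 'k ^ 2) yd" where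
  "yd_of_ops U E T Z C = \<lparr>
     vs = U,
     act = (\<lambda>a u. \<Sum>g\<in>UNIV. a $ Inl g *s E g u + a $ Inr g *s E g (T u)),
     coact = (\<lambda>u. \<chi> p. case p of Inl g \<Rightarrow> Z g u | Inr g \<Rightarrow> C g u)\<rparr>"

text \<open>\<open>diag \<alpha> \<beta>\<close>: \<open>v \<mapsto> \<alpha> v, w \<mapsto> \<beta> w\<close>; \<open>adiag \<alpha> \<beta>\<close>: \<open>v \<mapsto> \<alpha> w, w \<mapsto> \<beta> v\<close>.\<close>

definition diag :: "'k::field \<Rightarrow> 'k \<Rightarrow> 'k ^ 2 \<Rightarrow> 'k ^ 2" where
  "diag \<alpha> \<beta> u = vector [\<alpha> * u $ 1, \<beta> * u $ 2]"

definition adiag :: "'k::field \<Rightarrow> 'k \<Rightarrow> 'k ^ 2 \<Rightarrow> 'k ^ 2" where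
  "adiag \<alpha> \<beta> u = vector [\<beta> * u $ 2, \<alpha> * u $ 1]"

definition pows :: "('k ^ 2 \<Rightarrow> 'k ^ 2) \<Rightarrow> ('k ^ 2 \<Rightarrow> 'k ^ 2) \<Rightarrow> G \<Rightarrow> 'k ^ 2 \<Rightarrow> 'k ^ 2" where
  "pows f h g = (f ^^ xexp g) \<circ> (h ^^ yexp g)"

datatype sign = Plus | Minus

fun sign_val :: "sign \<Rightarrow> 'k::field" where
  "sign_val Plus = 1"
| "sign_val Minus = -1"

definition mod_V :: "'k::field \<Rightarrow> G \<Rightarrow> nat \<Rightarrow> sign \<Rightarrow> (G + G, 'k, 'k ^ 2) yd" where
  "mod_V \<xi> \<mu> i s = yd_of_ops (vec.span {axis 1 1})
     (\<lambda>g u. of_bool (g = \<mu>) *s u)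
     (\<lambda>u. (sign_val s * (if \<mu> \<in> {xy 0 0, xy 0 1} then 1 else \<xi>)) *s u)
     (\<lambda>g u. (\<xi> ^ (i * xexp g) * (-1) ^ (yexp \<mu> * yexp g)) *s u)
     (\<lambda>g u. 0)"

definition mod_W :: "'k::field \<Rightarrow> G \<Rightarrow> nat \<Rightarrow> sign \<Rightarrow> (G + G, 'k, 'k ^ 2) yd" where
  "mod_W \<xi> \<mu> i s = yd_of_ops UNIV
     (\<lambda>g. diag (of_bool (g = \<mu>)) (of_bool (g = \<mu> + xy 0 1)))
     (adiag 1 (if \<mu> = xy 1 0 then 1 else -1))
     (case s of Plus \<Rightarrow> pows (diag (\<xi> ^ i) (\<xi> ^ i)) (diag (-1) 1)
              | Minus \<Rightarrow> pows (diag (- (\<xi> ^ i)) (\<xi> ^ i)) (diag 1 (-1)))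
     (\<lambda>g u. 0)"

definition mod_X :: "'k::field \<Rightarrow> G \<Rightarrow> nat \<Rightarrow> (G + G, 'k, 'k ^ 2) yd" where
  "mod_X \<xi> \<mu> i = yd_of_ops UNIV
     (\<lambda>g u. of_bool (g = \<mu>) *s u)
     (adiag 1 (if \<mu> \<in> {xy 0 0, xy 0 1} then 1 else -1))
     (pows (diag (\<xi> ^ i) (- (\<xi> ^ i))) (if \<mu> \<in> {xy 0 0, xy 2 0} then diag (-1) (-1) else diag 1 1))
     (\<lambda>g u. 0)"

definition mod_Y :: "G \<Rightarrow> 'k::field \<Rightarrow> 'k \<Rightarrow> 'k \<Rightarrow> (G + G, 'k, 'k ^ 2) yd" where
  "mod_Y \<mu> a b l = yd_of_ops UNIV
     (\<lambda>g. diag (of_bool (g = \<mu>)) (of_bool (g = \<mu> + xy 0 1)))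
     (adiag l (- (a * b * l)))
     (\<lambda>g u. 0)
     (pows (adiag 1 a) (diag b (- b)))"

text \<open>
  Compatibility of \<open>t\<close> with the coaction reads, in the coordinate of \<open>e\<^bsub>xy\<^esub>t\<close>,
  \<open>\<chi>\<^bsub>xy\<^esub> t = (\<Sum>g. (-1)\<^sup>j e\<^sub>g) t \<chi>\<^sub>x\<close> with \<open>j\<close> the exponent of \<open>y\<close> in \<open>g\<close>.  On \<open>v\<close>
  it forces the minus sign in \<open>t = diag(\<lambda>, -b\<lambda>)\<close>.
\<close>

definition mod_Z :: "G \<Rightarrow> 'k::field \<Rightarrow> 'k \<Rightarrow> 'k \<Rightarrow> (G + G, 'k, 'k ^ 2) yd" where
  "mod_Z \<mu> a b l = yd_of_ops UNIV
     (\<lambda>g. diag (of_bool (g = \<mu>)) (of_bool (g = \<mu> + xy 0 1)))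
     (diag l (- (b * l)))
     (\<lambda>g u. 0)
     (pows (adiag 1 a) (diag b (- b)))"

datatype 'k label =
    LV G nat sign
  | LW G nat sign
  | LX G nat
  | LY G 'k 'k 'k
  | LZ G 'k 'k 'k

fun listed :: "'k::field \<Rightarrow> 'k label \<Rightarrow> (G + G, 'k, 'k ^ 2) yd" where
  "listed \<xi> (LV \<mu> i s) = mod_V \<xi> \<mu> i s"
| "listed \<xi> (LW \<mu> i s) = mod_W \<xi> \<mu> i s"
| "listed \<xi> (LX \<mu> i) = mod_X \<xi> \<mu> i"
| "listed \<xi> (LY \<mu> a b l) = mod_Y \<mu> a b l"
| "listed \<xi> (LZ \<mu> a b l) = mod_Z \<mu> a b l"

definition labels_S0 :: "'k::field label set" where
  "labels_S0 = {LV \<mu> i s | \<mu> i s. \<mu> \<in> {xy 0 0, xy 0 1, xy 2 0, xy 2 1} \<and> i < 4}"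

definition labels_S1 :: "'k::field label set" where
  "labels_S1 = {LW \<mu> i s | \<mu> i s. \<mu> \<in> {xy 1 0, xy 3 0} \<and> i < 4}"

definition labels_S2 :: "'k::field label set" where
  "labels_S2 = {LX \<mu> i | \<mu> i. \<mu> \<in> {xy 0 0, xy 0 1, xy 2 0, xy 2 1} \<and> i < 2}"

definition labels_S3 :: "'k::field label set" where
  "labels_S3 = {LY \<mu> a b l | \<mu> a b l. a \<in> {1, -1} \<and> b \<in> {1, -1} \<and>
     (\<mu> = xy 1 0 \<and> l ^ 2 = - (a * b) \<or> \<mu> = xy 3 0 \<and> l ^ 2 = a * b)}"

definition labels_S4 :: "'k::field label set" where
  "labels_S4 = {LZ \<mu> a b l | \<mu> a b l. a \<in> {1, -1} \<and> b \<in> {1, -1} \<and>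
     (\<mu> = xy 0 0 \<and> l ^ 2 = 1 \<or> \<mu> = xy 2 0 \<and> l ^ 2 = -1)}"

definition labels_dim2 :: "'k::field label set" where
  "labels_dim2 = labels_S1 \<union> labels_S2 \<union> labels_S3 \<union> labels_S4"

end

theory Submission
  imports Defs
begin

text \<open>
  Let \<open>E\<^sub>g\<close> and \<open>T\<close> be the operators by which \<open>e\<^sub>g\<close> and \<open>t\<close> act on a Yetter-Drinfel'd module, and let
  \<open>Z\<^sub>g\<close> and \<open>C\<^sub>g\<close> be the coordinates of the coaction, that is, the actions of \<open>\<zeta>\<^sub>g\<close> and \<open>\<chi>\<^sub>g\<close>.
  Written out in coordinates, the axioms become relations between these operators, and conversely
  operators with these relations define a module (\<open>double_rep_of_yd_module\<close>,
  \<open>yd_module_of_double_rep\<close>).  The \<open>Z\<^sub>g\<close> multiply as in \<open>G\<close>, the \<open>C\<^sub>g\<close> multiply with the cocycle \<open>\<tau>\<close>,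
  and \<open>Z\<^sub>0\<close>, \<open>C\<^sub>0\<close> are complementary projections that commute with everything.  So a simple module has
  either \<open>C = 0\<close> or \<open>Z = 0\<close>.

  If \<open>C = 0\<close>, all \<open>E\<^sub>g\<close> and \<open>Z\<^sub>g\<close> commute and are diagonalisable, and \<open>T\<close> carries a joint eigenvector
  \<open>v\<close> to a joint eigenvector, while \<open>T\<^sup>2\<close> is a scalar on \<open>v\<close>.  Hence \<open>v\<close> and \<open>T v\<close> span a submodule.
  If both have the same eigenvalues, an eigenvector of \<open>T\<close> can be chosen in the joint eigenspace and
  spans a line (S0).  Otherwise the plane is simple: either \<open>E\<close> separates \<open>v\<close> from \<open>T v\<close> (S1), or \<open>Z\<close>
  does (S2).  If \<open>Z = 0\<close>, then \<open>C\<^sub>x\<close> and \<open>C\<^sub>y\<close> anticommute, and \<open>C\<^sub>x\<close> moves the eigenspace of \<open>E\<^sub>\<mu>\<close> to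
  that of \<open>E\<^bsub>\<mu>y\<^esub>\<close>.  A joint eigenvector \<open>v\<close> of the \<open>E\<^sub>g\<close>, of \<open>C\<^sub>y\<close>, of \<open>C\<^sub>x\<^sup>2\<close> and of that one of the
  operators \<open>T\<close>, \<open>C\<^sub>x T\<close> that preserves the eigenspaces of the \<open>E\<^sub>g\<close> spans a simple plane together with \<open>C\<^sub>x v\<close>.
  This gives (S4) when \<open>T\<close> does and (S3) when \<open>C\<^sub>x T\<close> does.

  To compare arbitrary modules with the list, every label \<open>l\<close> is encoded by eigenvector equations
  (\<open>weight_vector\<close>), and four facts carry the proof.  Every nonzero module contains a weight vector
  for some label (\<open>exists_weight_vector\<close>).  A weight vector for \<open>l\<close> in \<open>M\<close> is the image of the first
  basis vector under a homomorphism from the listed module \<open>l\<close> to \<open>M\<close> (\<open>weight_vector_hom\<close>), because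
  the equations determine all operators on the plane.  The listed modules are simple
  (\<open>listed_simple\<close>), so by Schur's lemma this homomorphism is an isomorphism if \<open>M\<close> is simple.
  Finally, the listed module \<open>l'\<close> contains a weight vector for \<open>l\<close> only if \<open>l = l'\<close>
  (\<open>listed_weight_unique\<close>), so that different labels give non-isomorphic modules.  The count of
  isomorphism classes inside an ambient space with two independent vectors \<open>u\<close>, \<open>w\<close> follows by transporting
  the listed modules along the embedding of \<open>'k ^ 2\<close> that sends the basis to \<open>u\<close>, \<open>w\<close>.
\<close>

section \<open>The compatibility condition in coordinates\<close>

lemma (in vector_space) sum_scale_delta:
  fixes x :: "'i::finite \<Rightarrow> 'b"
  shows "(\<Sum>g\<in>UNIV. scale (F g * of_bool (h = g)) (x g)) = scale (F h) (x h)"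
    and "(\<Sum>g\<in>UNIV. scale (F g * of_bool (g = h)) (x g)) = scale (F h) (x h)"
    and "(\<Sum>g\<in>UNIV. scale (of_bool (h = g)) (x g)) = x h"
    and "(\<Sum>g\<in>UNIV. scale (of_bool (g = h)) (x g)) = x h"
proof -
  have 1: "scale (F g * of_bool (h = g)) (x g) = (if h = g then scale (F g) (x g) else 0)"
    and 2: "scale (F g * of_bool (g = h)) (x g) = (if h = g then scale (F g) (x g) else 0)"
    and 3: "scale (of_bool (h = g)) (x g) = (if h = g then x g else 0)"
    and 4: "scale (of_bool (g = h)) (x g) = (if h = g then x g else 0)" for g
    by auto
  show "(\<Sum>g\<in>UNIV. scale (F g * of_bool (h = g)) (x g)) = scale (F h) (x h)"
    "(\<Sum>g\<in>UNIV. scale (F g * of_bool (g = h)) (x g)) = scale (F h) (x h)"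
    "(\<Sum>g\<in>UNIV. scale (of_bool (h = g)) (x g)) = x h"
    "(\<Sum>g\<in>UNIV. scale (of_bool (g = h)) (x g)) = x h"
    unfolding 1 2 3 4 by simp_all
qed

lemma comult3_Hc:
  "comult3 Hc a $ (Inl p, Inl q, Inl r) = a $ Inl (p + q + r)"
  "comult3 Hc a $ (Inr p, Inr q, Inr r) = tau_t (p + q) r * tau_t p q * a $ Inr (p + q + r)"
  "comult3 Hc a $ (Inl p, Inr q, r') = 0"
  "comult3 Hc a $ (Inr p, Inl q, r') = 0"
  "comult3 Hc a $ (p', Inl q, Inr r) = 0"
  "comult3 Hc a $ (p', Inr q, Inl r) = 0"
  "comult3 Hc a $ (Inl p, q', Inr r) = 0"
  "comult3 Hc a $ (Inr p, q', Inl r) = 0"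
proof -
  show "comult3 Hc a $ (Inl p, Inl q, Inl r) = a $ Inl (p + q + r)"
    by (simp only: comult3_def vec_lambda_beta prod.case sum_UNIV_Plus comult_Hc bas_nth sum.distrib
        mult_zero_left sum.neutral_const sum_delta_bool sum.inject add_0_right)
  show "comult3 Hc a $ (Inr p, Inr q, Inr r) = tau_t (p + q) r * tau_t p q * a $ Inr (p + q + r)"
    by (simp only: comult3_def vec_lambda_beta prod.case sum_UNIV_Plus comult_Hc bas_nth sum.distrib
        mult_zero_left mult_zero_right sum.neutral_const sum_delta_bool sum.inject add_0_left mult.assoc[symmetric])
      (simp add: ac_simps)
  show "comult3 Hc a $ (Inl p, Inr q, r') = 0"
    "comult3 Hc a $ (Inr p, Inl q, r') = 0"
    by (simp_all add: comult3_def comult_Hc)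
  show "comult3 Hc a $ (p', Inl q, Inr r) = 0" "comult3 Hc a $ (p', Inr q, Inl r) = 0"
    by (cases p'; simp add: comult3_def comult_Hc sum_UNIV_Plus bas_nth)+
  show "comult3 Hc a $ (Inl p, q', Inr r) = 0" "comult3 Hc a $ (Inr p, q', Inl r) = 0"
    by (cases q'; simp add: comult3_def comult_Hc sum_UNIV_Plus bas_nth)+
qed

text \<open>
  In the right hand side of the compatibility condition the first, third and fourth index are
  determined by the coordinate under consideration, up to the choice between the two halves of the
  basis of \<open>H\<close>; only the sum over the second index survives.
\<close>

lemma sum_four_collapse:
  fixes F :: "'a::finite \<Rightarrow> 'b::finite \<Rightarrow> 'c::finite \<Rightarrow> 'd::finite \<Rightarrow> 'e::comm_monoid_add"
  assumes "\<And>p q r b. \<not> (p = P \<and> r = R \<and> b = B) \<Longrightarrow> \<not> (p = P' \<and> r = R' \<and> b = B') \<Longrightarrow> F p q r b = 0"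
    and "P \<noteq> P'"
  shows "(\<Sum>p\<in>UNIV. \<Sum>q\<in>UNIV. \<Sum>r\<in>UNIV. \<Sum>b\<in>UNIV. F p q r b) = (\<Sum>q\<in>UNIV. F P q R B) + (\<Sum>q\<in>UNIV. F P' q R' B')"
proof -
  have *: "(\<Sum>q\<in>UNIV. \<Sum>r\<in>UNIV. \<Sum>b\<in>UNIV. F p q r b) = (\<Sum>q\<in>UNIV. F p q r' b')"
    if "\<And>q r b. r \<noteq> r' \<or> b \<noteq> b' \<Longrightarrow> F p q r b = 0" for p r' b'
  proof (rule sum.cong[OF refl])
    fix q
    have "(\<Sum>r\<in>UNIV. \<Sum>b\<in>UNIV. F p q r b) = (\<Sum>r\<in>{r'}. \<Sum>b\<in>UNIV. F p q r b)"
      by (rule sum.mono_neutral_right) (auto intro!: sum.neutral that)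
    also have "\<dots> = (\<Sum>b\<in>UNIV. F p q r' b)" by simp
    also have "\<dots> = (\<Sum>b\<in>{b'}. F p q r' b)"
      by (rule sum.mono_neutral_right) (auto intro!: that)
    finally show "(\<Sum>r\<in>UNIV. \<Sum>b\<in>UNIV. F p q r b) = F p q r' b'" by simp
  qed
  have "(\<Sum>p\<in>UNIV. \<Sum>q\<in>UNIV. \<Sum>r\<in>UNIV. \<Sum>b\<in>UNIV. F p q r b) = (\<Sum>p\<in>{P,P'}. \<Sum>q\<in>UNIV. \<Sum>r\<in>UNIV. \<Sum>b\<in>UNIV. F p q r b)"
    by (rule sum.mono_neutral_right) (auto intro!: sum.neutral assms(1))
  also have "\<dots> = (\<Sum>q\<in>UNIV. \<Sum>r\<in>UNIV. \<Sum>b\<in>UNIV. F P q r b) + (\<Sum>q\<in>UNIV. \<Sum>r\<in>UNIV. \<Sum>b\<in>UNIV. F P' q r b)"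
    using assms(2) by simp
  also have "\<dots> = (\<Sum>q\<in>UNIV. F P q R B) + (\<Sum>q\<in>UNIV. F P' q R' B')"
    by (intro arg_cong2[where f="(+)"] *) (use assms in auto)
  finally show ?thesis .
qed

text \<open>
  The factor \<open>r b S\<^sup>-\<^sup>1(p)\<close> of the compatibility condition.
\<close>

definition conj_Hc :: "G + G \<Rightarrow> G + G \<Rightarrow> G + G \<Rightarrow> 'k::field ^ (G + G)" where
  "conj_Hc r b p = mul Hc (mul Hc (bas r) (bas b)) (inv (antipode Hc) (bas p))"

lemma inverse_sign: "inverse (sigma_t g) = (sigma_t g :: 'k::field)" "inverse (tau_t g h) = (tau_t g h :: 'k)"
  using sigma_square[of g, where 'k='k] tau_square[of g h, where 'k='k] inverse_unique by blast+

lemma eq_minus_tri: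
  "d = - p \<longleftrightarrow> - d = p" "d = - tri p \<longleftrightarrow> - tri d = p" "tri d = - tri p \<longleftrightarrow> - d = p" "tri d = - p \<longleftrightarrow> - tri d = p" for p d :: G
  by (metis minus_minus tri_minus tri_involution)+

lemma conj_coeff_Hc:
  "conj_Hc (Inl r) (Inl b) (Inl p) $ Inl d = (of_bool (d = r \<and> d = b \<and> - d = p) :: 'k::field)"
    "conj_Hc (Inl r) (Inl b) (Inl p) $ Inr d = (0 :: 'k::field)"
    "conj_Hc (Inr r) (Inl b) (Inr p) $ Inl d = (of_bool (d = r \<and> tri d = b \<and> - d = p) * (sigma_t d * sigma_t d * tau_t d d) :: 'k::field)"
    "conj_Hc (Inr r) (Inl b) (Inr p) $ Inr d = (0 :: 'k::field)"
    "conj_Hc (Inl r) (Inr b) (Inl p) $ Inr d = (of_bool (d = r \<and> d = b \<and> - tri d = p) :: 'k::field)"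
    "conj_Hc (Inl r) (Inr b) (Inl p) $ Inl d = (0 :: 'k::field)"
    "conj_Hc (Inr r) (Inr b) (Inr p) $ Inr d = (of_bool (d = r \<and> tri d = b \<and> - tri d = p) * (sigma_t d * sigma_t d * tau_t (tri d) (tri d)) :: 'k::field)"
    "conj_Hc (Inr r) (Inr b) (Inr p) $ Inl d = (0 :: 'k::field)"
  by (simp_all add: conj_Hc_def inv_antipode antipode_bas mul_Hc bas_nth inverse_sign eq_minus_tri tau_minus
      del: split_paired_All split_paired_Ex)
    (auto simp: tau_minus, (metis tri_minus tri_involution)+)

lemma coeff_Inl_zero:
  assumes "\<not> (p = Inl (- d) \<and> r = Inl d \<and> b = Inl d)"
    and "\<not> (p = Inr (- d) \<and> r = Inr d \<and> b = Inl (tri d))"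
  shows "comult3 Hc a $ (p, q, r) * conj_Hc r b p $ Inl d = (0 :: 'k::field)"
proof -
  consider (LLL) x y z where "p = Inl x" "r = Inl y" "b = Inl z" | (LLR) x y z where "p = Inl x" "r = Inl y" "b = Inr z"
    | (RRL) x y z where "p = Inr x" "r = Inr y" "b = Inl z" | (RRR) x y z where "p = Inr x" "r = Inr y" "b = Inr z"
    | (LR) x y where "p = Inl x" "r = Inr y" | (RL) x y where "p = Inr x" "r = Inl y"
    by (metis sumE)
  then show ?thesis
    by cases (use assms in \<open>auto simp only: comult3_Hc conj_coeff_Hc mult_zero_left mult_zero_right
      of_bool_def sum.inject mult_eq_0_iff split: if_split\<close>)
qed

lemma coeff_Inr_zero:
  assumes "\<not> (p = Inl (- tri d) \<and> r = Inl d \<and> b = Inr d)"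
    and "\<not> (p = Inr (- tri d) \<and> r = Inr d \<and> b = Inr (tri d))"
  shows "comult3 Hc a $ (p, q, r) * conj_Hc r b p $ Inr d = (0 :: 'k::field)"
proof -
  consider (LLL) x y z where "p = Inl x" "r = Inl y" "b = Inl z" | (LLR) x y z where "p = Inl x" "r = Inl y" "b = Inr z"
    | (RRL) x y z where "p = Inr x" "r = Inr y" "b = Inl z" | (RRR) x y z where "p = Inr x" "r = Inr y" "b = Inr z"
    | (LR) x y where "p = Inl x" "r = Inr y" | (RL) x y where "p = Inr x" "r = Inl y"
    by (metis sumE)
  then show ?thesis
    by cases (use assms in \<open>auto simp only: comult3_Hc conj_coeff_Hc mult_zero_left mult_zero_right
      of_bool_def sum.inject mult_eq_0_iff split: if_split\<close>)
qed

lemma tau_diff: "tau_t (g - h) k = (tau_t g k * tau_t h k :: 'k::field)"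
  using tau_add(1)[of g "- h" k, where 'k='k] by (simp add: tau_minus)

text \<open>
  The compatibility condition for \<open>H\<^sub>c\<close>, with \<open>f q\<close> in the role of the action of the basis vector \<open>q\<close>
  and \<open>\<rho>\<close> in that of the coaction of a vector.  The sign \<open>\<tau>(tri d, d) \<tau>(tri d, tri d)\<close> that appears on the way
  to the second equation is \<open>1\<close> because \<open>d + tri d\<close> has even \<open>x\<close>-exponent.
\<close>

lemma (in vector_space) yd_right_hand_side:
  fixes f :: "G + G \<Rightarrow> 'b \<Rightarrow> 'b" and \<rho> :: "'b ^ (G + G)" and a :: "'a ^ (G + G)"
  defines "S \<equiv> \<lambda>d. \<Sum>p\<in>UNIV. \<Sum>q\<in>UNIV. \<Sum>r\<in>UNIV. \<Sum>b\<in>UNIV.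
     scale (comult3 Hc a $ (p, q, r) * mul Hc (mul Hc (bas r) (bas b)) (inv (antipode Hc) (bas p)) $ d)
       (f q (\<rho> $ b))"
  shows "S (Inl d) = (\<Sum>q\<in>UNIV. scale (a $ Inl q) (f (Inl q) (\<rho> $ Inl d))) +
      (\<Sum>q\<in>UNIV. scale (tau_t q d * tau_t d q * a $ Inr q) (f (Inr q) (\<rho> $ Inl (tri d))))" (is ?A)
    and "S (Inr d) = (\<Sum>q\<in>UNIV. scale (a $ Inl (q + d - tri d)) (f (Inl q) (\<rho> $ Inr d))) +
      (\<Sum>q\<in>UNIV. scale (tau_t q d * tau_t (tri d) q * a $ Inr (q + d - tri d)) (f (Inr q) (\<rho> $ Inr (tri d))))" (is ?B)
proof -
  have s: "(\<Sum>q\<in>UNIV. h q) = (\<Sum>q\<in>UNIV. h (Inl q)) + (\<Sum>q\<in>UNIV. h (Inr q))" for h :: "G + G \<Rightarrow> 'b"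
    by (rule sum_UNIV_Plus)
  have t: "tau_t g h * tau_t g h = (1::'a)" "sigma_t g * sigma_t g = (1::'a)" for g h
    by (rule tau_square sigma_square)+
  have "S (Inl d) = (\<Sum>q\<in>UNIV. scale (comult3 Hc a $ (Inl (- d), q, Inl d)) (f q (\<rho> $ Inl d))) +
     (\<Sum>q\<in>UNIV. scale (comult3 Hc a $ (Inr (- d), q, Inr d) * (sigma_t d * sigma_t d * tau_t d d)) (f q (\<rho> $ Inl (tri d))))"
    unfolding S_def conj_Hc_def[symmetric]
  proof (subst sum_four_collapse[where P="Inl (- d)" and R="Inl d" and B="Inl d" and
          P'="Inr (- d)" and R'="Inr d" and B'="Inl (tri d)"], goal_cases)
    case (1 p q r b)
    then show ?case by (simp only: coeff_Inl_zero[OF 1] scale_zero_left)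
  qed (simp_all add: conj_coeff_Hc)
  also have "\<dots> = (\<Sum>q\<in>UNIV. scale (a $ Inl q) (f (Inl q) (\<rho> $ Inl d))) +
      (\<Sum>q\<in>UNIV. scale (tau_t q d * tau_t d q * a $ Inr q) (f (Inr q) (\<rho> $ Inl (tri d))))"
  proof -
    have "comult3 Hc a $ (Inr (- d), Inr q, Inr d) * (sigma_t d * sigma_t d * tau_t d d) =
      (tau_t d d * tau_t d d) * tau_t q d * tau_t d q * a $ Inr q" for q
      by (simp add: comult3_Hc tau_minus tau_add(1) tau_diff sigma_square algebra_simps)
    moreover have "comult3 Hc a $ (Inl (- d), Inl q, Inl d) = a $ Inl q" for q
      by (simp add: comult3_Hc)
    ultimately show ?thesis
      by (simp only: s comult3_Hc(3-8) t mult_1_left mult_zero_left scale_zero_left sum.neutral_const add_0_left add_0_right)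
  qed
  finally show ?A .
  have "S (Inr d) = (\<Sum>q\<in>UNIV. scale (comult3 Hc a $ (Inl (- tri d), q, Inl d)) (f q (\<rho> $ Inr d))) +
     (\<Sum>q\<in>UNIV. scale (comult3 Hc a $ (Inr (- tri d), q, Inr d) * (sigma_t d * sigma_t d * tau_t (tri d) (tri d))) (f q (\<rho> $ Inr (tri d))))"
    unfolding S_def conj_Hc_def[symmetric]
  proof (subst sum_four_collapse[where P="Inl (- tri d)" and R="Inl d" and B="Inr d" and
          P'="Inr (- tri d)" and R'="Inr d" and B'="Inr (tri d)"], goal_cases)
    case (1 p q r b)
    then show ?case by (simp only: coeff_Inr_zero[OF 1] scale_zero_left)
  qed (simp_all add: conj_coeff_Hc)
  also have "\<dots> = (\<Sum>q\<in>UNIV. scale (a $ Inl (q + d - tri d)) (f (Inl q) (\<rho> $ Inr d))) +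
      (\<Sum>q\<in>UNIV. scale (tau_t q d * tau_t (tri d) q * a $ Inr (q + d - tri d)) (f (Inr q) (\<rho> $ Inr (tri d))))"
  proof -
    have tt: "tau_t (tri d) d * tau_t (tri d) (tri d) = (1::'a)"
    proof (cases d rule: xy_cases)
      case (1 i j)
      have "(i + j) * i + (i + j) * i = 2 * ((i + j) * i)" by simp
      then have "even ((i + j) * i + (i + j) * i)" by presburger
      then show ?thesis
        by (simp only: 1 tri_xy tau_xy flip: power_add) simp
    qed
    have "comult3 Hc a $ (Inr (- tri d), Inr q, Inr d) * (sigma_t d * sigma_t d * tau_t (tri d) (tri d)) =
      (tau_t (tri d) d * tau_t (tri d) (tri d)) * tau_t q d * tau_t (tri d) q * a $ Inr (q + d - tri d)" for q
      by (simp add: comult3_Hc tau_minus tau_add(1) tau_diff sigma_square algebra_simps)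
    moreover have "comult3 Hc a $ (Inl (- tri d), Inl q, Inl d) = a $ Inl (q + d - tri d)" for q
      by (simp add: comult3_Hc algebra_simps)
    ultimately show ?thesis
      by (simp only: s comult3_Hc(3-8) tt mult_1_left mult_zero_left scale_zero_left sum.neutral_const add_0_left add_0_right)
  qed
  finally show ?B .
qed

section \<open>Yetter-Drinfel'd modules as representations of generators and relations\<close>

text \<open>
  Operators are total functions, but only their values on the underlying space of a module matter.
\<close>

definition endo_on :: "('k \<Rightarrow> 'v::ab_group_add \<Rightarrow> 'v) \<Rightarrow> 'v set \<Rightarrow> ('v \<Rightarrow> 'v) \<Rightarrow> bool" where
  "endo_on sc V f \<longleftrightarrow> (\<forall>v\<in>V. f v \<in> V) \<and> (\<forall>v\<in>V. \<forall>w\<in>V. f (v + w) = f v + f w) \<and>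
     (\<forall>c. \<forall>v\<in>V. f (sc c v) = sc c (f v))"

text \<open>
  A presentation of the Drinfel'd double by its action: \<open>E g\<close>, \<open>T\<close>, \<open>Z g\<close>, \<open>C g\<close> stand for \<open>e\<^sub>g\<close>, \<open>t\<close>,
  \<open>\<zeta>\<^sub>g\<close>, \<open>\<chi>\<^sub>g\<close>.  The relations \<open>EE\<close> to \<open>TT\<close> are those of the algebra \<open>H\<^sub>c\<close>, the relations \<open>ZZ\<close> to \<open>ZC0\<close> those of
  the algebra dual to its coalgebra structure, and the last four are the compatibility condition for
  \<open>e\<^sub>u\<close> and \<open>t\<close>.
\<close>

locale double_rep = vector_space sc
  for sc :: "'k::field \<Rightarrow> 'v::ab_group_add \<Rightarrow> 'v" +
  fixes V :: "'v set" and E :: "G \<Rightarrow> 'v \<Rightarrow> 'v" and T :: "'v \<Rightarrow> 'v" and Z C :: "G \<Rightarrow> 'v \<Rightarrow> 'v"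
  assumes subspace_V: "subspace V"
    and endo: "\<And>g. endo_on sc V (E g)" "endo_on sc V T" "\<And>g. endo_on sc V (Z g)" "\<And>g. endo_on sc V (C g)"
    and EE: "\<And>g h v. v \<in> V \<Longrightarrow> E g (E h v) = (if g = h then E g v else 0)"
    and sum_E: "\<And>v. v \<in> V \<Longrightarrow> (\<Sum>g\<in>UNIV. E g v) = v"
    and TE: "\<And>g v. v \<in> V \<Longrightarrow> T (E g v) = E (tri g) (T v)"
    and TT: "\<And>v. v \<in> V \<Longrightarrow> T (T v) = (\<Sum>g\<in>UNIV. sc (sigma_t g) (E g v))"
    and ZZ: "\<And>g h v. v \<in> V \<Longrightarrow> Z g (Z h v) = Z (g + h) v"
    and CC: "\<And>g h v. v \<in> V \<Longrightarrow> C g (C h v) = sc (tau_t g h) (C (g + h) v)"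
    and ZC: "\<And>g h v. v \<in> V \<Longrightarrow> Z g (C h v) = 0"
    and CZ: "\<And>g h v. v \<in> V \<Longrightarrow> C g (Z h v) = 0"
    and ZC0: "\<And>v. v \<in> V \<Longrightarrow> Z 0 v + C 0 v = v"
    and ZE: "\<And>g u v. v \<in> V \<Longrightarrow> Z g (E u v) = E u (Z g v)"
    and CE: "\<And>g u v. v \<in> V \<Longrightarrow> C g (E u v) = E (u + tri g - g) (C g v)"
    and ZT: "\<And>g v. v \<in> V \<Longrightarrow> Z g (T v) = (\<Sum>q\<in>UNIV. sc (tau_t q g * tau_t g q) (E q (T (Z (tri g) v))))"
    and CT: "\<And>g v. v \<in> V \<Longrightarrow> C g (T v) = (\<Sum>q\<in>UNIV. sc (tau_t q g * tau_t (tri g) q) (E q (T (C (tri g) v))))"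
begin

lemma mem: "v \<in> V \<Longrightarrow> E g v \<in> V" "v \<in> V \<Longrightarrow> T v \<in> V" "v \<in> V \<Longrightarrow> Z g v \<in> V" "v \<in> V \<Longrightarrow> C g v \<in> V"
  using endo by (auto simp: endo_on_def)

lemma add: "v \<in> V \<Longrightarrow> w \<in> V \<Longrightarrow> E g (v + w) = E g v + E g w"
  "v \<in> V \<Longrightarrow> w \<in> V \<Longrightarrow> T (v + w) = T v + T w"
  "v \<in> V \<Longrightarrow> w \<in> V \<Longrightarrow> Z g (v + w) = Z g v + Z g w"
  "v \<in> V \<Longrightarrow> w \<in> V \<Longrightarrow> C g (v + w) = C g v + C g w"
  using endo by (auto simp: endo_on_def)

lemma hom: "v \<in> V \<Longrightarrow> E g (sc c v) = sc c (E g v)"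
  "v \<in> V \<Longrightarrow> T (sc c v) = sc c (T v)"
  "v \<in> V \<Longrightarrow> Z g (sc c v) = sc c (Z g v)"
  "v \<in> V \<Longrightarrow> C g (sc c v) = sc c (C g v)"
  using endo by (auto simp: endo_on_def)

lemma endo_zero: "endo_on sc V f \<Longrightarrow> f 0 = 0"
  using subspace_0[OF subspace_V] unfolding endo_on_def by (metis scale_zero_left)

lemma endo_sum: "endo_on sc V f \<Longrightarrow> (\<And>i. i \<in> I \<Longrightarrow> x i \<in> V) \<Longrightarrow> f (\<Sum>i\<in>I. x i) = (\<Sum>i\<in>I. f (x i))"
proof (induction I rule: infinite_finite_induct)
  case (insert i I)
  then have "(\<Sum>i\<in>I. x i) \<in> V" by (intro subspace_sum subspace_V) auto
  with insert show ?case by (simp add: endo_on_def)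
qed (auto simp: endo_zero)

lemma zero: "E g 0 = 0" "T 0 = 0" "Z g 0 = 0" "C g 0 = 0"
  using endo endo_zero by auto

lemma E_sum: "v \<in> V \<Longrightarrow> E u (\<Sum>q\<in>UNIV. sc (F q) (E q v)) = sc (F u) (E u v)"
proof -
  assume v: "v \<in> V"
  have "E u (\<Sum>q\<in>UNIV. sc (F q) (E q v)) = (\<Sum>q\<in>UNIV. E u (sc (F q) (E q v)))"
    by (intro endo_sum endo subspace_scale subspace_V mem v)
  also have "\<dots> = (\<Sum>q\<in>UNIV. if u = q then sc (F q) (E q v) else 0)"
    by (intro sum.cong refl) (auto simp: hom mem v EE)
  finally show ?thesis by simp
qed

end

text \<open>
  Each relation is one axiom evaluated at the basis vectors \<open>e\<^sub>u\<close> or at \<open>t = \<Sum>\<^sub>g e\<^sub>g t\<close>.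
\<close>

lemma double_rep_of_yd_module:
  assumes "yd_module Hc sc M"
  shows "double_rep sc (vs M) (\<lambda>g. act M (bas (Inl g))) (act M t_H)
    (\<lambda>g v. coact M v $ Inl g) (\<lambda>g v. coact M v $ Inr g)"
proof -
  interpret vector_space sc using assms by (simp add: yd_module_def)
  have sub: "subspace (vs M)" and lm: "left_module Hc sc M" and rc: "right_comodule Hc sc M"
    and yc: "yd_compatible Hc sc M" using assms by (simp_all add: yd_module_def)
  have act_sum: "act M (\<Sum>g\<in>I. a g) v = (\<Sum>g\<in>I. act M (a g) v)" if "v \<in> vs M" "finite I" for a v and I :: "G set"
  proof -
    have 0: "act M 0 v = 0" using lm that unfolding left_module_def by (metis vector_smult_lzero scale_zero_left)
    show ?thesis using that(2) by (induction I) (use lm that 0 in \<open>auto simp: left_module_def\<close>)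
  qed
  have T_bas: "act M (bas (Inr q)) v = act M (bas (Inl q)) (act M t_H v)" if "v \<in> vs M" for q v
    using lm that Hc_relations(5)[of q, where 'k='a] unfolding left_module_def e_H_def by metis
  have cm: "coact M (coact M v $ q) $ p = (\<Sum>b\<in>UNIV. sc (comult Hc (bas b) $ (p, q)) (coact M v $ b))" if "v \<in> vs M" for v p q
    using rc that by (simp add: right_comodule_def)
  have cm1: "sc (comult Hc (bas (Inl g)) $ (p, q)) v = sc (of_bool (case (p, q) of (Inl h, Inl k) \<Rightarrow> h + k = g | _ \<Rightarrow> False)) v"
    "sc (comult Hc (bas (Inr g)) $ (p, q)) v = 
      (case (p, q) of (Inr h, Inr k) \<Rightarrow> sc (tau_t h k * of_bool (h + k = g)) v | _ \<Rightarrow> 0)" for g p q v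
    by (cases p; cases q; simp add: comult_Hc bas_nth)+
  have yc': "coact M (act M a v) $ d =
        (\<Sum>p\<in>UNIV. \<Sum>q\<in>UNIV. \<Sum>r\<in>UNIV. \<Sum>b\<in>UNIV.
           sc (comult3 Hc a $ (p, q, r) *
                  mul Hc (mul Hc (bas r) (bas b)) (inv (antipode Hc) (bas p)) $ d)
                 (act M (bas q) (coact M v $ b)))" if "v \<in> vs M" for a v d
    using yc that unfolding yd_compatible_def by blast
  have cv: "coact M v $ b \<in> vs M" if "v \<in> vs M" for v b
    using rc that by (simp add: right_comodule_def)
  note rhs = yd_right_hand_side[where f = "\<lambda>q. act M (bas q)"]
  note yi = yc'[where d="Inl _", unfolded rhs]
  note yr = yc'[where d="Inr _", unfolded rhs]
  show ?thesis
  proof (unfold_locales, goal_cases)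
    case 1 show ?case by (rule sub)
  next
    case (2 g) show ?case using lm by (auto simp: endo_on_def left_module_def)
  next
    case 3 show ?case using lm by (auto simp: endo_on_def left_module_def)
  next
    case (4 g) show ?case using rc by (auto simp: endo_on_def right_comodule_def)
  next
    case (5 g) show ?case using rc by (auto simp: endo_on_def right_comodule_def)
  next
    case (6 g h v)
    have "act M (bas (Inl g)) (act M (bas (Inl h)) v) = act M (mul Hc (bas (Inl g)) (bas (Inl h))) v"
      using lm 6 by (simp add: left_module_def)
    moreover have "act M 0 v = 0" using lm 6 unfolding left_module_def by (metis vector_smult_lzero scale_zero_left)
    ultimately show ?case using Hc_relations(2)[of g h, where 'k='a] by (simp add: e_H_def)
  next
    case (7 v)
    have "act M (unit Hc) v = v" using lm 7 by (simp add: left_module_def)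
    then show ?case using 7 by (simp add: Hc_relations(1) act_sum e_H_def)
  next
    case (8 g v)
    then show ?case using lm Hc_relations(3)[of g, where 'k='a] unfolding left_module_def e_H_def by metis
  next
    case (9 v)
    then have "act M t_H (act M t_H v) = act M (mul Hc t_H t_H) v"
      using lm by (simp add: left_module_def)
    then show ?case using 9 lm by (simp add: Hc_relations(4) act_sum e_H_def left_module_def)
  next
    case (10 g h v)
    then show ?case
      by (simp add: cm sum_UNIV_Plus cm1 sum_scale_delta)
  next
    case (11 g h v)
    then show ?case
      by (simp add: cm sum_UNIV_Plus cm1 sum_scale_delta)
  next
    case (12 g h v)
    then show ?case
      by (simp add: cm sum_UNIV_Plus cm1)
  next
    case (13 g h v)
    then show ?case
      by (simp add: cm sum_UNIV_Plus cm1)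
  next
    case (14 v)
    then have "(\<Sum>b\<in>UNIV. sc (counit Hc (bas b)) (coact M v $ b)) = v"
      using rc by (simp add: right_comodule_def)
    then show ?case
      by (simp add: sum_UNIV_Plus counit_bas sum_scale_delta)
  next
    case (15 g u v)
    then show ?case
      by (simp add: yi bas_nth sum_scale_delta)
  next
    case (16 g u v)
    have "q + g - tri g = u \<longleftrightarrow> q = u + tri g - g" for q by (auto simp: algebra_simps)
    with 16 show ?case
      by (simp add: yr bas_nth sum_scale_delta)
  next
    case (17 g v)
    then show ?case
      by (simp add: yi t_H_nth T_bas cv)
  next
    case (18 g v)
    then show ?case
      by (simp add: yr t_H_nth T_bas cv)
  qed
qed

text \<open>
  It is enough to know the compatibility condition for the generators: since \<open>E\<^sub>u\<close> picks a single
  summand of the sums over \<open>q\<close>, the relations for \<open>T\<close> give those for every \<open>e\<^sub>u t\<close>.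
\<close>

lemma yd_module_of_double_rep:
  fixes U :: "('k::field ^ 2) set"
  assumes "double_rep (*s) U E T Z C"
  shows "yd_module Hc (*s) (yd_of_ops U E T Z C)"
proof -
  interpret R: double_rep "(*s)" U E T Z C by fact
  let ?M = "yd_of_ops U E T Z C"
  note S = R.subspace_V
  have sel: "vs ?M = U" "act ?M a u = (\<Sum>g\<in>UNIV. a $ Inl g *s E g u + a $ Inr g *s E g (T u))"
    "coact ?M u $ Inl g = Z g u" "coact ?M u $ Inr g = C g u" for a u g
    by (simp_all add: yd_of_ops_def)
  have mem: "v \<in> U \<Longrightarrow> act ?M a v \<in> U" for a v
    unfolding sel by (intro vec.subspace_sum vec.subspace_add vec.subspace_scale S R.mem)
  have E_act: "E u (act ?M a v) = a $ Inl u *s E u v + a $ Inr u *s E u (T v)" if "v \<in> U" for a u v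
  proof -
    have "act ?M a v = (\<Sum>g\<in>UNIV. a $ Inl g *s E g v) + (\<Sum>g\<in>UNIV. a $ Inr g *s E g (T v))"
      by (simp add: sel sum.distrib)
    then show ?thesis using that
      by (simp add: R.add R.E_sum R.mem vec.subspace_sum vec.subspace_scale S)
  qed
  show ?thesis unfolding yd_module_def
  proof (intro conjI)
    show "vector_space ((*s) :: 'k \<Rightarrow> 'k ^ 2 \<Rightarrow> 'k ^ 2)" by (rule vec.vector_space_axioms)
    show "vec.subspace (vs ?M)" by (simp add: sel S)
    show "left_module Hc (*s) ?M"
      unfolding left_module_def
    proof (intro conjI allI ballI; (unfold sel(1))?)
      fix a b c v w assume v: "v \<in> U"
      show "act ?M a v \<in> U" using mem v .
      show "act ?M (unit Hc) v = v" using v by (simp add: sel unit_Hc R.sum_E)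
      show "act ?M a (c *s v) = c *s act ?M a v" using v
        by (simp add: sel R.hom R.mem vec.scale_sum_right vec.scale_right_distrib mult.commute)
      show "act ?M (a + b) v = act ?M a v + act ?M b v"
        by (simp add: sel vec.scale_left_distrib sum.distrib)
      show "act ?M (c *s a) v = c *s act ?M a v"
        by (simp add: sel vec.scale_sum_right vec.scale_right_distrib)
      { assume w: "w \<in> U"
        show "act ?M a (v + w) = act ?M a v + act ?M a w" using v w
        by (simp add: sel R.add R.mem vec.scale_right_distrib sum.distrib) }
      show "act ?M (mul Hc a b) v = act ?M a (act ?M b v)"
      proof -
        have sT: "E g (T (T v)) = sigma_t g *s E g v" for g using v by (simp add: R.TT R.E_sum)
        have "E g (T (act ?M b v)) = b $ Inl (tri g) *s E g (T v) + (b $ Inr (tri g) * sigma_t g) *s E g v" for g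
        proof -
          have "E g (T (act ?M b v)) = T (E (tri g) (act ?M b v))" using R.TE[OF mem[OF v], of "tri g"] by simp
          also have "\<dots> = b $ Inl (tri g) *s E g (T v) + b $ Inr (tri g) *s E g (T (T v))"
            using v by (simp add: E_act R.add R.hom R.mem vec.subspace_scale S R.TE)
          finally show ?thesis by (simp add: sT)
        qed
        then have "act ?M a (act ?M b v) = (\<Sum>g\<in>UNIV. a $ Inl g *s (b $ Inl g *s E g v + b $ Inr g *s E g (T v)) +
            a $ Inr g *s (b $ Inl (tri g) *s E g (T v) + (b $ Inr (tri g) * sigma_t g) *s E g v))"
          by (subst sel(2)) (simp only: E_act[OF v])
        also have "\<dots> = act ?M (mul Hc a b) v"
          by (simp add: sel(2) mul_Hc vec.scale_left_distrib vec.scale_right_distrib mult.assoc add_ac)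
        finally show ?thesis by simp
      qed
    qed
    show "right_comodule Hc (*s) ?M"
      unfolding right_comodule_def
    proof (intro conjI allI ballI; (unfold sel(1))?)
      fix b c v w p q assume v: "v \<in> U"
      show "coact ?M v $ b \<in> U" using v by (cases b) (auto simp: sel R.mem)
      { assume w: "w \<in> U"
        show "coact ?M (v + w) = coact ?M v + coact ?M w" using v w
          by (simp add: vec_eq_iff all_Plus sel R.add del: split_paired_All) }
      show "coact ?M (c *s v) = (\<chi> b. c *s coact ?M v $ b)" using v
        by (simp add: vec_eq_iff all_Plus sel R.hom del: split_paired_All)
      show "coact ?M (coact ?M v $ q) $ p = (\<Sum>b\<in>UNIV. comult Hc (bas b) $ (p, q) *s coact ?M v $ b)"
        using v by (cases p; cases q) (simp_all add: sel sum_UNIV_Plus comult_Hc bas_nth R.ZZ R.CC R.ZC R.CZ vec.sum_scale_delta)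
      show "(\<Sum>b\<in>UNIV. counit Hc (bas b) *s coact ?M v $ b) = v"
        using v by (simp add: sel sum_UNIV_Plus counit_bas vec.sum_scale_delta R.ZC0)
    qed
    show "yd_compatible Hc (*s) ?M"
      unfolding yd_compatible_def
    proof (intro allI ballI; (unfold sel(1))?)
      fix a v d assume v: "v \<in> U"
      show "coact ?M (act ?M a v) $ d = (\<Sum>p\<in>UNIV. \<Sum>q\<in>UNIV. \<Sum>r\<in>UNIV. \<Sum>b\<in>UNIV.
           (comult3 Hc a $ (p, q, r) *
                  mul Hc (mul Hc (bas r) (bas b)) (inv (antipode Hc) (bas p)) $ d) *s
                 (act ?M (bas q) (coact ?M v $ b)))"
      proof (cases d)
        case (Inl g)
        have "Z g (act ?M a v) = (\<Sum>u\<in>UNIV. a $ Inl u *s Z g (E u v) + a $ Inr u *s Z g (E u (T v)))"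
          unfolding sel using v
          by (subst R.endo_sum[OF R.endo(3)])
            (auto intro!: vec.subspace_add vec.subspace_scale S R.mem sum.cong simp: R.add R.hom R.mem vec.subspace_scale S)
        moreover have "Z g (E u (T v)) = (tau_t u g * tau_t g u) *s E u (T (Z (tri g) v))" for u
          using v by (simp add: R.ZE R.mem R.ZT R.E_sum)
        ultimately show ?thesis using v unfolding Inl vec.yd_right_hand_side[where f = "\<lambda>q. act ?M (bas q)"]
          by (simp add: sel bas_nth vec.sum_scale_delta R.ZE sum.distrib mult_ac)
      next
        case (Inr g)
        have "C g (act ?M a v) = (\<Sum>u\<in>UNIV. a $ Inl u *s C g (E u v) + a $ Inr u *s C g (E u (T v)))"
          unfolding sel using v
          by (subst R.endo_sum[OF R.endo(4)])
            (auto intro!: vec.subspace_add vec.subspace_scale S R.mem sum.cong simp: R.add R.hom R.mem vec.subspace_scale S)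
        also have "\<dots> = (\<Sum>q\<in>UNIV. a $ Inl (q + g - tri g) *s C g (E (q + g - tri g) v) + a $ Inr (q + g - tri g) *s C g (E (q + g - tri g) (T v)))"
          by (rule sum.reindex_bij_witness[where j="\<lambda>u. u + tri g - g" and i="\<lambda>q. q + g - tri g"]) auto
        finally have "C g (act ?M a v) = \<dots>" .
        moreover have "C g (E u (T v)) = (tau_t (u + tri g - g) g * tau_t (tri g) (u + tri g - g)) *s E (u + tri g - g) (T (C (tri g) v))" for u
          using v by (simp add: R.CE R.mem R.CT R.E_sum)
        ultimately show ?thesis using v unfolding Inr vec.yd_right_hand_side[where f = "\<lambda>q. act ?M (bas q)"]
          by (simp add: sel bas_nth vec.sum_scale_delta R.CE sum.distrib mult_ac)
      qed
    qed
  qed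
qed

section \<open>Three families of representations on lines and planes\<close>

lemma vec2_eq: "x = y \<longleftrightarrow> x $ 1 = y $ 1 \<and> x $ 2 = y $ 2" for x y :: "'k ^ 2"
  by (simp add: vec_eq_iff forall_2)

lemma diag_nth [simp]: "diag \<alpha> \<beta> u $ 1 = \<alpha> * u $ 1" "diag \<alpha> \<beta> u $ 2 = \<beta> * u $ 2"
  "adiag \<alpha> \<beta> u $ 1 = \<beta> * u $ 2" "adiag \<alpha> \<beta> u $ 2 = \<alpha> * u $ 1"
  by (simp_all add: diag_def adiag_def)

lemma endo_on_diag: "endo_on (*s) UNIV (diag \<alpha> \<beta>)" "endo_on (*s) UNIV (adiag \<alpha> \<beta>)"
  by (simp_all add: endo_on_def vec2_eq algebra_simps)

lemma sum_diag_delta: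
  "(\<Sum>q\<in>UNIV. F q *s diag (of_bool (q = \<mu>)) (of_bool (q = \<mu>')) u) = diag (F \<mu>) (F \<mu>') u"
  for \<mu> :: "'a::finite"
proof -
  have "(\<Sum>q\<in>UNIV. F q * (of_bool (q = c) * z)) = F c * z" for c and z :: 'b
    using sum_delta_bool(3)[of "\<lambda>q. F q * z" c] by (simp add: mult_ac del: sum_mult_of_bool_eq sum_of_bool_mult_eq)
  then show ?thesis
    by (simp add: vec2_eq)
qed

text \<open>
  For \<open>\<alpha>\<^sup>4 = 1 = \<beta>\<^sup>2\<close> this is the character of \<open>G\<close> with \<open>x \<mapsto> \<alpha>\<close>, \<open>y \<mapsto> \<beta>\<close>.
\<close>

definition lin_char :: "'k::field \<Rightarrow> 'k \<Rightarrow> G \<Rightarrow> 'k" where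
  "lin_char \<alpha> \<beta> g = \<alpha> ^ xexp g * \<beta> ^ yexp g"

text \<open>
  The sign by which \<open>Z\<^sub>g\<close> and \<open>T\<close> fail to commute in the relation for \<open>Z\<^sub>g T\<close>, on the image of \<open>E\<^sub>q\<close>.
\<close>

definition swap_sign :: "G \<Rightarrow> G \<Rightarrow> 'k::field" where
  "swap_sign q g = tau_t q g * tau_t g q"

lemma power_mod_eq: "a ^ n = 1 \<Longrightarrow> a ^ (m mod n) = (a ^ m :: 'a::monoid_mult)"
  by (metis mult_div_mod_eq power_add power_mult power_one mult_1_left)

lemma lin_char_xy: "\<alpha> ^ 4 = 1 \<Longrightarrow> \<beta> ^ 2 = 1 \<Longrightarrow> lin_char \<alpha> \<beta> (xy i j) = \<alpha> ^ i * \<beta> ^ j"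
  by (simp add: lin_char_def xexp_xy yexp_xy power_mod_eq)

lemma lin_char_add:
  assumes "\<alpha> ^ 4 = 1" "\<beta> ^ 2 = 1"
  shows "lin_char \<alpha> \<beta> (g + h) = lin_char \<alpha> \<beta> g * lin_char \<alpha> \<beta> h"
proof -
  have "lin_char \<alpha> \<beta> (xy (xexp g) (yexp g) + xy (xexp h) (yexp h)) =
      lin_char \<alpha> \<beta> (xy (xexp g) (yexp g)) * lin_char \<alpha> \<beta> (xy (xexp h) (yexp h))"
    by (simp only: xy_add lin_char_xy[OF assms] power_add mult_ac)
  then show ?thesis by (simp only: xy_exp)
qed

lemma lin_char_0: "lin_char \<alpha> \<beta> 0 = 1"
  by (simp add: lin_char_def xexp_xy yexp_xy flip: xy_0)

lemma swap_sign_add: "swap_sign q (g + h) = swap_sign q g * swap_sign q h"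
  by (simp add: swap_sign_def tau_add mult_ac)

lemma swap_sign_0: "swap_sign q 0 = 1"
  by (simp add: swap_sign_def tau_0)

lemma sigma_nonzero: "sigma_t g \<noteq> (0 :: 'k::field)"
  by (simp add: sigma_t_def)

lemma tau_nonzero: "tau_t g h \<noteq> (0 :: 'k::field)"
  by (simp add: tau_t_def)

text \<open>
  The formula for \<open>\<sigma>(q + g)\<close> is symmetric in \<open>q\<close> and \<open>g\<close>; comparing both versions gives
  \<open>\<tau>(q, g) \<tau>(tri q, tri g) = \<tau>(g, q) \<tau>(tri g, tri q)\<close>, and all signs square to \<open>1\<close>.
\<close>

lemma swap_sign_tri: "swap_sign q g * swap_sign (tri q) (tri g) = (1 :: 'k::field)"
proof -
  have "sigma_t (q + g) = (sigma_t q * sigma_t g * (tau_t q g * tau_t (tri q) (tri g)) :: 'k)"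
    "sigma_t (q + g) = (sigma_t q * sigma_t g * (tau_t g q * tau_t (tri g) (tri q)) :: 'k)"
    using sigma_add[of q g, where 'k='k] sigma_add[of g q, where 'k='k] by (simp_all add: add_ac mult_ac)
  then have "tau_t q g * tau_t (tri q) (tri g) = (tau_t g q * tau_t (tri g) (tri q) :: 'k)"
    using sigma_nonzero[of q, where 'k='k] sigma_nonzero[of g, where 'k='k] by (metis mult_left_cancel mult_eq_0_iff)
  then have "swap_sign q g * swap_sign (tri q) (tri g) =
      ((tau_t q g * tau_t q g) * (tau_t (tri q) (tri g) * tau_t (tri q) (tri g)) :: 'k)"
    unfolding swap_sign_def by (simp add: mult_ac)
  then show ?thesis by (simp add: tau_square)
qed

text \<open>
  The module induced from the one-dimensional representation \<open>E\<^sub>\<mu> = 1\<close>, \<open>Z\<^sub>g = lin_char \<alpha> \<beta> g\<close> of the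
  subalgebra generated by the \<open>E\<^sub>g\<close> and \<open>Z\<^sub>g\<close>; the second basis vector is the image of the first one
  under \<open>T\<close>, and its character is forced by the relation for \<open>Z\<^sub>g T\<close>.
\<close>

lemma double_rep_induced:
  fixes \<alpha> \<beta> :: "'k::field"
  assumes "\<alpha> ^ 4 = 1" "\<beta> ^ 2 = 1"
  shows "double_rep (*s) UNIV (\<lambda>g. diag (of_bool (g = \<mu>)) (of_bool (g = tri \<mu>))) (adiag 1 (sigma_t \<mu>))
     (\<lambda>g. diag (lin_char \<alpha> \<beta> g) (swap_sign (tri \<mu>) g * lin_char \<alpha> \<beta> (tri g))) (\<lambda>g u. 0)"
proof (unfold_locales, goal_cases)
  case (17 g v)
  note d = sum_diag_delta[of "\<lambda>q. tau_t q g * tau_t g q", folded swap_sign_def]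
  have *: "swap_sign \<mu> g * (x * (swap_sign (tri \<mu>) (tri g) * y)) = x * y" for x y :: 'k
    using swap_sign_tri[of \<mu> g, where 'k='k] by (metis mult.left_commute mult_1_left mult.assoc)
  show ?case unfolding swap_sign_def[symmetric] d
    by (simp add: vec2_eq * swap_sign_tri mult_ac)
next
  case (7 v)
  show ?case using sum_diag_delta[where F="\<lambda>_. 1" and \<mu>=\<mu> and \<mu>'="tri \<mu>" and u=v] by (simp add: vec2_eq)
next
  case (9 v)
  show ?case by (simp add: sum_diag_delta vec2_eq)
next
  case (6 g h v)
  show ?case by (auto simp: vec2_eq)
next
  case (10 g h v)
  show ?case by (simp add: vec2_eq lin_char_add[OF assms] swap_sign_add tri_add mult_ac)
qed (auto simp: endo_on_diag vec2_eq lin_char_0 swap_sign_0 tri_eq_iff simp del: split_paired_All, auto simp: endo_on_def)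

text \<open>
  The assumption \<open>inv\<close> says that \<open>T\<close> preserves the character of \<open>Z\<close>, so that the induced plane splits into
  lines.
\<close>

lemma double_rep_scalar:
  fixes \<alpha> \<beta> c :: "'k::field"
  assumes "\<alpha> ^ 4 = 1" "\<beta> ^ 2 = 1" "c * c = sigma_t \<mu>" "tri \<mu> = \<mu>"
    and inv: "\<And>g. lin_char \<alpha> \<beta> g = swap_sign \<mu> g * lin_char \<alpha> \<beta> (tri g)" 
  shows "double_rep (*s) (vec.span {axis 1 1}) (\<lambda>g u. of_bool (g = \<mu>) *s u) ((*s) c)
     (\<lambda>g. (*s) (lin_char \<alpha> \<beta> g)) (\<lambda>g (u :: 'k ^ 2). 0)"
proof -
  have 0: "of_bool (g = \<mu>) *s u = diag (of_bool (g = \<mu>)) (of_bool (g = \<mu>)) u" for g u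
    by (simp add: vec2_eq)
  show ?thesis
  proof (unfold_locales, goal_cases)
    case 1 show ?case by (rule vec.subspace_span)
  next
    case (17 g v)
    note d = sum_diag_delta[of "\<lambda>q. tau_t q g * tau_t g q", folded swap_sign_def]
    show ?case unfolding swap_sign_def[symmetric] 0 d
      using inv[of g] by (simp add: vec2_eq mult_ac)
  next
    case (9 v)
    show ?case unfolding 0 sum_diag_delta by (simp add: vec2_eq assms)
  next
    case (7 v)
    show ?case unfolding 0 using sum_diag_delta[where F="\<lambda>_. 1" and \<mu>=\<mu> and \<mu>'=\<mu> and u=v] by (simp add: vec2_eq)
  next
    case (10 g h v)
    show ?case by (simp add: lin_char_add[OF assms(1,2)])
  qed (auto simp: endo_on_def vec2_eq algebra_simps vec.span_scale vec.span_zero tri_eq_iff assms(4) lin_char_0)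
qed

text \<open>
  The entries of \<open>X\<^sup>i Y\<^sup>j\<close> for \<open>X = adiag 1 a\<close> and \<open>Y = diag b (- b)\<close>, where \<open>X\<^sup>2\<close> is the scalar \<open>a\<close>:
  \<open>chi_coeff\<close> belongs to the first basis vector and \<open>chi_coeff'\<close> to the second one.
\<close>

definition chi_coeff :: "'k::field \<Rightarrow> 'k \<Rightarrow> G \<Rightarrow> 'k" where
  "chi_coeff a b g = a ^ (xexp g div 2) * b ^ yexp g"
definition chi_coeff' :: "'k::field \<Rightarrow> 'k \<Rightarrow> G \<Rightarrow> 'k" where
  "chi_coeff' a b g = a ^ (Suc (xexp g) div 2) * (- b) ^ yexp g"

definition chi_op :: "'k::field \<Rightarrow> 'k \<Rightarrow> G \<Rightarrow> 'k ^ 2 \<Rightarrow> 'k ^ 2" where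
  "chi_op a b g = (if even (xexp g) then diag (chi_coeff a b g) (chi_coeff' a b g)
     else adiag (chi_coeff a b g) (chi_coeff' a b g))"

lemma diag_funpow: "(diag \<alpha> \<beta> ^^ n) u = diag (\<alpha> ^ n) (\<beta> ^ n) u"
  by (induction n) (auto simp: vec2_eq)

lemma pows_diag: "pows (diag \<alpha> \<beta>) (diag \<gamma> \<delta>) g = diag (lin_char \<alpha> \<gamma> g) (lin_char \<beta> \<delta> g)"
  by (rule ext) (simp add: pows_def diag_funpow lin_char_def vec2_eq)

lemma adiag_funpow: "(adiag 1 a ^^ n) u = (if even n then diag (a ^ (n div 2)) (a ^ (Suc n div 2)) u
    else adiag (a ^ (n div 2)) (a ^ (Suc n div 2)) u)"
  by (induction n) (auto simp: vec2_eq)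

lemma pows_adiag: "pows (adiag 1 a) (diag b (- b)) = chi_op a b"
  by (intro ext) (simp add: pows_def diag_funpow adiag_funpow chi_op_def chi_coeff_def chi_coeff'_def vec2_eq)

text \<open>
  Since \<open>tri g - g = (0, i)\<close> for \<open>g = (i, j)\<close>, the operator \<open>C\<^sub>g\<close> shifts the index of \<open>E\<close> by \<open>y\<close> exactly when
  the \<open>x\<close>-exponent of \<open>g\<close> is odd.
\<close>

lemma shift_tri: "u + tri g - g = (if even (xexp g) then u else u + xy 0 1)"
proof (cases g rule: xy_cases)
  case (1 i j)
  have "tri g - g = xy 0 i"
  proof -
    have "tri g = g + xy 0 i" unfolding 1 tri_xy xy_add by (simp add: add.commute)
    then show ?thesis by simp
  qed
  also have "xy 0 i = (if even i then 0 else xy 0 1)"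
    by (simp add: xy_eq_iff even_iff_mod_2_eq_zero odd_iff_mod_2_eq_one flip: xy_0)
  finally show ?thesis using 1 by (auto simp: xexp_xy add_diff_eq[symmetric])
qed

lemma shift_y: "u + xy 0 1 = v \<longleftrightarrow> u = v + xy 0 1"
proof -
  have "u + xy 0 1 + xy 0 1 = u" for u
    by (simp add: add.assoc xy_add) (simp add: xy_eq_iff flip: xy_0)
  then show ?thesis by metis
qed

text \<open>
  The formula extends to all natural exponents because \<open>a\<close> and \<open>b\<close> square to \<open>1\<close>; this makes products easy
  to compute.
\<close>

lemma chi_op_even_odd:
  assumes "a * a = 1" "b * b = 1"
  shows "chi_op a b (xy (2 * p) j) = diag (a ^ p * b ^ j) (a ^ p * (- b) ^ j)"
    and "chi_op a b (xy (2 * p + 1) j) = adiag (a ^ p * b ^ j) (a ^ (p + 1) * (- b) ^ j)"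
proof -
  have sq: "a ^ 2 = 1" "b ^ 2 = 1" "(- b) ^ 2 = 1" using assms by (simp_all add: power2_eq_square)
  have m: "(2 * p) mod 4 = 2 * (p mod 2)" "(2 * p + 1) mod 4 = 2 * (p mod 2) + 1" by presburger+
  show "chi_op a b (xy (2 * p) j) = diag (a ^ p * b ^ j) (a ^ p * (- b) ^ j)"
    by (simp add: chi_op_def chi_coeff_def chi_coeff'_def xexp_xy yexp_xy m power_mod_eq sq)
  show "chi_op a b (xy (2 * p + 1) j) = adiag (a ^ p * b ^ j) (a ^ (p + 1) * (- b) ^ j)"
    unfolding chi_op_def chi_coeff_def chi_coeff'_def xexp_xy yexp_xy m by (simp add: power_mod_eq sq)
qed

lemma chi_op_mult:
  fixes a b :: "'a::field"
  assumes ab: "a * a = 1" "b * b = 1"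
  shows "chi_op a b g (chi_op a b h u) = tau_t g h *s chi_op a b (g + h) u"
proof -
  have br: "(-1) ^ n * ((-1) ^ n * x) = x" for n and x :: 'a
    by (simp flip: power_mult_distrib mult.assoc)
  have *: "chi_op a b (xy i j) (chi_op a b (xy k l) u) = (-1) ^ (j * k) *s chi_op a b (xy (i + k) (j + l)) u" for i j k l
  proof -
    obtain p q where "i = 2 * p \<or> i = 2 * p + 1" "k = 2 * q \<or> k = 2 * q + 1"
      by (metis oddE evenE)
    then consider (ee) "i = 2 * p" "k = 2 * q" | (eo) "i = 2 * p" "k = 2 * q + 1"
      | (oe) "i = 2 * p + 1" "k = 2 * q" | (oo) "i = 2 * p + 1" "k = 2 * q + 1" by blast
    then show ?thesis
    proof cases
      case ee
      have "i + k = 2 * (p + q)" using ee by simp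
      then show ?thesis by (simp only: ee chi_op_even_odd[OF ab]) (simp add: vec2_eq power_add mult_ac)
    next
      case eo
      have "i + k = 2 * (p + q) + 1" using eo by simp
      then show ?thesis by (simp only: eo chi_op_even_odd[OF ab]) (simp add: vec2_eq power_add power_minus[of b] br mult_ac)
    next
      case oe
      have "i + k = 2 * (p + q) + 1" using oe by simp
      then show ?thesis by (simp only: oe chi_op_even_odd[OF ab]) (simp add: vec2_eq power_add mult_ac)
    next
      case oo
      have "i + k = 2 * (p + q + 1)" using oo by simp
      then show ?thesis by (simp only: oo chi_op_even_odd[OF ab]) (simp add: vec2_eq power_add power_minus[of b] br mult_ac)
    qed
  qed
  show ?thesis
    using *[of "xexp g" "yexp g" "xexp h" "yexp h"] unfolding xy_add[symmetric] xy_exp tau_t_def .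
qed

text \<open>
  The involution \<open>tri\<close> fixes \<open>\<mu>\<close> and \<open>\<mu>y\<close> if the \<open>x\<close>-exponent of \<open>\<mu>\<close> is even and exchanges them otherwise,
  whence the two shapes of \<open>T\<close>.  The condition on \<open>l\<close> is \<open>T\<^sup>2 = \<sigma>(\<mu>)\<close>.
\<close>

lemma double_rep_twisted:
  fixes a b :: "'k::field"
  assumes ab: "a * a = 1" "b * b = 1"
    and T: "T = adiag l (- (a * b * l)) \<and> odd (xexp \<mu>) \<and> - (a * b * l * l) = sigma_t \<mu> \<or> 
      T = diag l (- (b * l)) \<and> even (xexp \<mu>) \<and> l * l = sigma_t \<mu>"
    and \<mu>: "yexp \<mu> = 0"
  shows "double_rep (*s) UNIV (\<lambda>g. diag (of_bool (g = \<mu>)) (of_bool (g = \<mu> + xy 0 1))) T (\<lambda>g u. 0) (chi_op a b)"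
proof -
  have [simp]: "a * (a * x) = x" "b * (b * x) = x" for x
    using ab by (simp_all flip: mult.assoc)
  define m where "m = xexp \<mu>"
  have \<mu>m: "\<mu> = xy m 0" using xy_exp[of \<mu>] \<mu> by (simp add: m_def)
  have e: "endo_on (*s) UNIV T" using T by (auto simp: endo_on_diag)
  have s: "sigma_t (\<mu> + xy 0 1) = (sigma_t \<mu> :: 'k)"
    using xy_add[of "xexp \<mu>" "yexp \<mu>" 0 1] by (simp add: xy_exp) (simp add: sigma_t_def xexp_xy xexp_lt)
  have tri: "tri \<mu> = (if even (xexp \<mu>) then \<mu> else \<mu> + xy 0 1)"
    "tri (\<mu> + xy 0 1) = (if even (xexp \<mu>) then \<mu> + xy 0 1 else \<mu>)"
    unfolding \<mu>m xy_add tri_xy by (auto simp: xexp_xy xy_eq_iff even_iff_mod_2_eq_zero odd_iff_mod_2_eq_one mod_mod_cancel mod_Suc)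
  have e0: "diag x y 0 = (0 :: 'k ^ 2)" "chi_op a b g 0 = 0" "T 0 = 0" for g x y
    using T by (auto simp: vec2_eq chi_op_def)
  let ?E = "\<lambda>g. diag (of_bool (g = \<mu>)) (of_bool (g = \<mu> + xy 0 1)) :: 'k ^ 2 \<Rightarrow> 'k ^ 2"
  show ?thesis
  proof (unfold_locales)
    show "(\<Sum>g\<in>UNIV. ?E g v) = v" for v
      using sum_diag_delta[where F="\<lambda>_. 1" and \<mu>=\<mu> and \<mu>'="\<mu> + xy 0 1" and u=v] by (simp add: vec2_eq)
    show "T (?E g v) = ?E (tri g) (T v)" for g v
      using T by (auto simp: vec2_eq tri_eq_iff tri simp del: One_nat_def)
    show "T (T v) = (\<Sum>g\<in>UNIV. sigma_t g *s ?E g v)" for v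
    proof -
      have TT: "T (T v) = sigma_t \<mu> *s v"
        using T
      proof (elim disjE conjE)
        assume "T = adiag l (- (a * b * l))" "- (a * b * l * l) = sigma_t \<mu>"
        then show ?thesis by (simp add: vec2_eq mult_ac flip: \<open>- (a * b * l * l) = sigma_t \<mu>\<close>)
      next
        assume "T = diag l (- (b * l))" "l * l = sigma_t \<mu>"
        then show ?thesis by (simp add: vec2_eq mult_ac flip: \<open>l * l = sigma_t \<mu>\<close>)
      qed
      show ?thesis unfolding TT sum_diag_delta s by (simp add: vec2_eq)
    qed
    show "?E g (?E h v) = (if g = h then ?E g v else 0)" for g h v
      by (auto simp: vec2_eq simp del: One_nat_def)
    show "chi_op a b g (chi_op a b h v) = tau_t g h *s chi_op a b (g + h) v" for g h v
      by (rule chi_op_mult[OF ab])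
    show "0 + chi_op a b 0 v = v" for v
      by (simp add: chi_op_def chi_coeff_def chi_coeff'_def xexp_xy yexp_xy vec2_eq flip: xy_0)
    show "chi_op a b g (?E u v) = ?E (u + tri g - g) (chi_op a b g v)" for g u v
      by (auto simp: shift_tri chi_op_def vec2_eq shift_y simp del: One_nat_def)
    show "chi_op a b g (T v) = (\<Sum>q\<in>UNIV. (tau_t q g * tau_t (tri g) q) *s ?E q (T (chi_op a b (tri g) v)))" for g v
    proof -
      have p: "tau_t (xy m 0) (xy i j) = (1::'k)" "tau_t (xy m 1) (xy i j) = ((-1)^i::'k)" 
         "tau_t (xy i j) (xy m k) = (if even m then 1 else (-1) ^ j :: 'k)" for i j k
        by (simp_all add: tau_xy minus_one_power_iff)
      define i j where "i = xexp g" and "j = yexp g"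
      have g: "g = xy i j" by (simp add: i_def j_def xy_exp)
      have T': "T = adiag l (- (a * b * l)) \<and> odd m \<or> T = diag l (- (b * l)) \<and> even m"
        using T by (auto simp: m_def)
      obtain r where r: "i = 2 * r \<or> i = 2 * r + 1" by (metis oddE evenE)
      have br: "b ^ n * b ^ n = 1" "b ^ n * (b ^ n * x) = x" "(-1) ^ n * ((-1) ^ n * x) = x" for n and x :: 'k
        using ab(2) by (simp_all add: power2_eq_square flip: power_mult_distrib mult.assoc)
      from r have "chi_op a b g (T v) = diag (tau_t \<mu> g * tau_t (tri g) \<mu>)
         (tau_t (\<mu> + xy 0 1) g * tau_t (tri g) (\<mu> + xy 0 1)) (T (chi_op a b (tri g) v))"
      proof
        assume i: "i = 2 * r"
        show ?thesis using T' unfolding g \<mu>m xy_add tri_xy add_0_left add_0_right p i chi_op_even_odd[OF ab]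
          by (auto simp: vec2_eq power_add power_mult power_minus[of b] power2_eq_square ab br mult_ac)
      next
        assume i: "i = 2 * r + 1"
        show ?thesis using T' unfolding g \<mu>m xy_add tri_xy add_0_left add_0_right p i chi_op_even_odd[OF ab]
          by (auto simp: vec2_eq power_add power_mult power_minus[of b] power2_eq_square ab br mult_ac)
      qed
      then show ?thesis by (simp only: sum_diag_delta)
    qed
    show "endo_on (*s) UNIV (?E g)" "endo_on (*s) UNIV (chi_op a b g)" "endo_on (*s) UNIV (\<lambda>u :: 'k ^ 2. 0)" for g
      by (rule endo_on_diag) (simp only: chi_op_def endo_on_diag split: if_split, simp, simp add: endo_on_def)
    show "endo_on (*s) UNIV T" by (rule e)
    show "vec.subspace (UNIV :: ('k ^ 2) set)" by simp
  qed (simp_all only: e0 vec.scale_zero_right sum.neutral_const)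
qed

section \<open>Homomorphisms of Yetter-Drinfel'd modules\<close>

text \<open>
  As for \<open>yd_iso\<close>, all conditions are relative to the underlying spaces.
\<close>

definition yd_hom ::
    "('k::field \<Rightarrow> 'v::ab_group_add \<Rightarrow> 'v) \<Rightarrow> ('k \<Rightarrow> 'w::ab_group_add \<Rightarrow> 'w) \<Rightarrow>
     ('b::finite, 'k, 'v) yd \<Rightarrow> ('b, 'k, 'w) yd \<Rightarrow> ('v \<Rightarrow> 'w) \<Rightarrow> bool" where
  "yd_hom sc sc' M N f \<longleftrightarrow> (\<forall>v\<in>vs M. f v \<in> vs N) \<and>
     (\<forall>v\<in>vs M. \<forall>w\<in>vs M. f (v + w) = f v + f w) \<and>
     (\<forall>c. \<forall>v\<in>vs M. f (sc c v) = sc' c (f v)) \<and>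
     (\<forall>a. \<forall>v\<in>vs M. f (act M a v) = act N a (f v)) \<and>
     (\<forall>v\<in>vs M. \<forall>b. coact N (f v) $ b = f (coact M v $ b))"

lemma yd_homD:
  assumes "yd_hom sc sc' M N f" and "v \<in> vs M"
  shows "f v \<in> vs N" "w \<in> vs M \<Longrightarrow> f (v + w) = f v + f w" "f (sc c v) = sc' c (f v)"
    "f (act M a v) = act N a (f v)" "coact N (f v) $ b = f (coact M v $ b)"
  using assms by (simp_all add: yd_hom_def)

lemma yd_iso_iff: "yd_iso sc sc' M N \<longleftrightarrow> (\<exists>f. bij_betw f (vs M) (vs N) \<and> yd_hom sc sc' M N f)"
proof -
  have "bij_betw f (vs M) (vs N) \<Longrightarrow> \<forall>v\<in>vs M. f v \<in> vs N" for f by (simp add: bij_betw_apply)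
  then show ?thesis unfolding yd_iso_def yd_hom_def by blast
qed

lemma yd_closed:
  assumes "yd_module H sc M"
  shows "vector_space sc" "module.subspace sc (vs M)" "\<And>a v. v \<in> vs M \<Longrightarrow> act M a v \<in> vs M"
    "\<And>b v. v \<in> vs M \<Longrightarrow> coact M v $ b \<in> vs M"
  using assms by (auto simp: yd_module_def left_module_def right_comodule_def)

lemma yd_iso_refl: "yd_iso sc sc M M"
  unfolding yd_iso_def by (intro exI[of _ id]) auto

lemma yd_module_closed_ops:
  assumes M: "yd_module H sc M"
  shows "v \<in> vs M \<Longrightarrow> w \<in> vs M \<Longrightarrow> v + w \<in> vs M" "v \<in> vs M \<Longrightarrow> sc c v \<in> vs M"
proof -
  interpret vector_space sc using yd_closed(1)[OF M] .
  show "v \<in> vs M \<Longrightarrow> w \<in> vs M \<Longrightarrow> v + w \<in> vs M" "v \<in> vs M \<Longrightarrow> sc c v \<in> vs M"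
    using yd_closed(2)[OF M] by (auto intro: subspace_add subspace_scale)
qed

lemma yd_iso_sym:
  assumes "yd_module H sc M" "yd_iso sc sc' M N"
  shows "yd_iso sc' sc N M"
proof -
  from assms(2) obtain f where bij: "bij_betw f (vs M) (vs N)" and hom: "yd_hom sc sc' M N f"
    unfolding yd_iso_iff by blast
  define g where "g = inv_into (vs M) f"
  have bg: "bij_betw g (vs N) (vs M)" unfolding g_def by (rule bij_betw_inv_into[OF bij])
  have fg: "f (g y) = y" if "y \<in> vs N" for y
    using bij that by (simp add: g_def bij_betw_inv_into_right)
  have gf: "g (f x) = x" if "x \<in> vs M" for x
    using bij that by (simp add: g_def bij_betw_inv_into_left)
  have gm: "g y \<in> vs M" if "y \<in> vs N" for y using bg that by (rule bij_betw_apply)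
  note cl = yd_closed[OF assms(1)] yd_module_closed_ops[OF assms(1)]
  have "yd_hom sc' sc N M g"
    unfolding yd_hom_def
  proof (intro conjI ballI allI)
    fix v w c a b assume v: "v \<in> vs N"
    show "g v \<in> vs M" by (rule gm[OF v])
    { assume w: "w \<in> vs N"
      have "v + w = f (g v + g w)" using hom gm v w fg by (simp add: yd_hom_def)
      then show "g (v + w) = g v + g w" using gf cl gm v w by simp }
    have "sc' c v = f (sc c (g v))" using hom gm v fg by (simp add: yd_hom_def)
    then show "g (sc' c v) = sc c (g v)" using gf cl gm v by simp
    have "act N a v = f (act M a (g v))" using hom gm v fg by (simp add: yd_hom_def)
    then show "g (act N a v) = act M a (g v)" using gf cl gm v by simp
    have "coact N v $ b = f (coact M (g v) $ b)" using hom gm v fg by (metis yd_hom_def)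
    then show "coact M (g v) $ b = g (coact N v $ b)" using gf cl gm v by simp
  qed
  with bg show ?thesis unfolding yd_iso_iff by blast
qed

lemma yd_iso_trans:
  assumes "yd_iso sc sc' M N" "yd_iso sc' sc'' N L"
  shows "yd_iso sc sc'' M L"
proof -
  obtain f where f: "bij_betw f (vs M) (vs N)" "yd_hom sc sc' M N f"
    using assms(1) unfolding yd_iso_iff by blast
  obtain g where g: "bij_betw g (vs N) (vs L)" "yd_hom sc' sc'' N L g"
    using assms(2) unfolding yd_iso_iff by blast
  have "yd_hom sc sc'' M L (g \<circ> f)"
    using f(2) g(2) by (simp add: yd_hom_def)
  with bij_betw_trans[OF f(1) g(1)] show ?thesis unfolding yd_iso_iff by blast
qed

lemma yd_hom_zero:
  assumes "yd_module H sc M" "yd_module H sc' N" "yd_hom sc sc' M N f"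
  shows "f 0 = 0"
proof -
  interpret A: vector_space sc using yd_closed(1)[OF assms(1)] .
  interpret B: vector_space sc' using yd_closed(1)[OF assms(2)] .
  have "0 \<in> vs M" using yd_closed(2)[OF assms(1)] by (rule A.subspace_0)
  moreover have "\<forall>c. \<forall>v\<in>vs M. f (sc c v) = sc' c (f v)" using assms(3) by (simp add: yd_hom_def)
  ultimately have "f (sc 0 0) = sc' 0 (f 0)" by blast
  then show ?thesis by simp
qed

lemma yd_submodule_kernel:
  assumes "yd_module H sc M" "yd_module H sc' N" "yd_hom sc sc' M N f"
  shows "yd_submodule sc M {v \<in> vs M. f v = 0}"
proof -
  interpret A: vector_space sc using yd_closed(1)[OF assms(1)] .
  interpret B: vector_space sc' using yd_closed(1)[OF assms(2)] .
  have act0: "act N a 0 = 0" and coact0: "coact N 0 $ b = 0" for a b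
  proof -
    have "0 \<in> vs N" using yd_closed(2)[OF assms(2)] by (rule B.subspace_0)
    moreover have "\<forall>a c. \<forall>v\<in>vs N. act N a (sc' c v) = sc' c (act N a v)"
      "\<forall>c. \<forall>v\<in>vs N. coact N (sc' c v) = (\<chi> b. sc' c (coact N v $ b))"
      using assms(2) by (simp_all add: yd_module_def left_module_def right_comodule_def)
    ultimately have "act N a (sc' 0 0) = sc' 0 (act N a 0)" "coact N (sc' 0 0) = (\<chi> b. sc' 0 (coact N 0 $ b))"
      by blast+
    then show "act N a 0 = 0" "coact N 0 $ b = 0" by (simp_all add: vec_eq_iff)
  qed
  note cl = yd_closed[OF assms(1)] yd_module_closed_ops[OF assms(1)]
  show ?thesis
    unfolding yd_submodule_def
  proof (intro conjI allI ballI)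
    show "A.subspace {v \<in> vs M. f v = 0}"
      using assms(3) cl(2) yd_hom_zero[OF assms] cl
      by (intro A.subspaceI) (auto simp: yd_hom_def A.subspace_0)
    show "act M a u \<in> {v \<in> vs M. f v = 0}" if "u \<in> {v \<in> vs M. f v = 0}" for a u
      using that assms(3) cl act0 by (auto simp: yd_hom_def)
    show "coact M u $ b \<in> {v \<in> vs M. f v = 0}" if "u \<in> {v \<in> vs M. f v = 0}" for b u
    proof -
      have "u \<in> vs M" using that by simp
      from yd_homD(5)[OF assms(3) this] have "f (coact M u $ b) = coact N (f u) $ b" by simp
      then show ?thesis using that cl coact0 by auto
    qed
  qed auto
qed

lemma yd_submodule_image:
  assumes "yd_module H sc M" "yd_module H sc' N" "yd_hom sc sc' M N f"
  shows "yd_submodule sc' N (f ` vs M)"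
proof -
  interpret A: vector_space sc using yd_closed(1)[OF assms(1)] .
  interpret B: vector_space sc' using yd_closed(1)[OF assms(2)] .
  note cl = yd_closed[OF assms(1)] yd_module_closed_ops[OF assms(1)]
  show ?thesis
    unfolding yd_submodule_def
  proof (intro conjI allI ballI)
    show "f ` vs M \<subseteq> vs N" using assms(3) by (auto simp: yd_hom_def)
    show "B.subspace (f ` vs M)"
    proof (rule B.subspaceI)
      show "0 \<in> f ` vs M" using yd_hom_zero[OF assms] A.subspace_0[OF cl(2)] by (metis imageI)
    next
      fix x y assume "x \<in> f ` vs M" "y \<in> f ` vs M"
      then obtain v w where "v \<in> vs M" "w \<in> vs M" "x = f v" "y = f w" by auto
      then have "x + y = f (v + w)" "v + w \<in> vs M" using assms(3) cl by (auto simp: yd_hom_def)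
      then show "x + y \<in> f ` vs M" by auto
    next
      fix x c assume "x \<in> f ` vs M"
      then obtain v where "v \<in> vs M" "x = f v" by auto
      then have "sc' c x = f (sc c v)" "sc c v \<in> vs M" using assms(3) cl by (auto simp: yd_hom_def)
      then show "sc' c x \<in> f ` vs M" by auto
    qed
    fix u assume "u \<in> f ` vs M"
    then obtain v where v: "v \<in> vs M" "u = f v" by auto
    show "act N a u \<in> f ` vs M" for a
    proof -
      have "act N a u = f (act M a v)" using v assms(3) by (simp add: yd_hom_def)
      then show ?thesis using cl v by auto
    qed
    show "coact N u $ b \<in> f ` vs M" for b
    proof -
      have "coact N u $ b = f (coact M v $ b)" using v assms(3) by (simp add: yd_hom_def)
      then show ?thesis using cl v by auto
    qed
  qed
qed

text \<open>
  Schur's lemma: kernel and image of a homomorphism are submodules.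
\<close>

lemma yd_schur:
  assumes M: "simple_yd_module H sc M" and N: "simple_yd_module H sc' N"
    and hom: "yd_hom sc sc' M N f" and nz: "v \<in> vs M" "f v \<noteq> 0"
  shows "yd_iso sc sc' M N"
proof -
  have m: "yd_module H sc M" and n: "yd_module H sc' N" using M N by (auto simp: simple_yd_module_def)
  interpret A: vector_space sc using yd_closed(1)[OF m] .
  interpret B: vector_space sc' using yd_closed(1)[OF n] .
  have "{v \<in> vs M. f v = 0} \<noteq> vs M" using nz by auto
  then have ker: "{v \<in> vs M. f v = 0} = {0}"
    using M yd_submodule_kernel[OF m n hom] unfolding simple_yd_module_def by blast
  have "f ` vs M \<noteq> {0}" using nz by auto
  then have im: "f ` vs M = vs N"
    using N yd_submodule_image[OF m n hom] unfolding simple_yd_module_def by blast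
  have "inj_on f (vs M)"
  proof (rule inj_onI)
    fix x y assume xy: "x \<in> vs M" "y \<in> vs M" "f x = f y"
    then have d: "x + sc (-1) y \<in> vs M" and "sc (-1) y \<in> vs M" using yd_module_closed_ops[OF m] by blast+
    have "f (x + sc (-1) y) = f x + sc' (-1) (f y)"
      using yd_homD(2)[OF hom xy(1) \<open>sc (-1) y \<in> vs M\<close>] yd_homD(3)[OF hom xy(2)] by metis
    then have "f (x + sc (-1) y) = 0" by (simp add: xy(3))
    with d ker have "x + sc (-1) y = 0" by blast
    then show "x = y" by simp
  qed
  with im hom show ?thesis unfolding yd_iso_iff bij_betw_def by blast
qed

lemma bas_expand: "a = (\<Sum>g\<in>UNIV. a $ Inl g *s bas (Inl g)) + (\<Sum>g\<in>UNIV. a $ Inr g *s bas (Inr g))"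
  for a :: "'k::field ^ (G + G)"
  by (simp add: vec_eq_iff all_Plus bas_nth sum_delta_bool del: sum_mult_of_bool_eq sum_of_bool_mult_eq split_paired_All)

lemma act_expand:
  assumes M: "yd_module Hc sc M" and v: "v \<in> vs M"
  shows "act M a v = (\<Sum>g\<in>UNIV. sc (a $ Inl g) (act M (bas (Inl g)) v)) +
      (\<Sum>g\<in>UNIV. sc (a $ Inr g) (act M (bas (Inl g)) (act M t_H v)))"
proof -
  interpret vector_space sc using yd_closed(1)[OF M] .
  have lm: "left_module Hc sc M" using M by (simp add: yd_module_def)
  have 0: "act M 0 v = 0" using lm v unfolding left_module_def by (metis vector_smult_lzero scale_zero_left)
  have sum: "act M (\<Sum>g\<in>I. F g *s b g) v = (\<Sum>g\<in>I. sc (F g) (act M (b g) v))"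
    if "finite I" for F b and I :: "G set"
    using that by (induction I) (use lm v 0 in \<open>auto simp: left_module_def\<close>)
  have "act M (bas (Inr g)) v = act M (bas (Inl g)) (act M t_H v)" for g
    using lm v Hc_relations(5)[of g, where 'k='a] unfolding left_module_def e_H_def by metis
  moreover have "act M (x + y) v = act M x v + act M y v" for x y
    using lm v by (simp add: left_module_def)
  ultimately show ?thesis
    by (subst bas_expand[of a]) (simp add: sum)
qed

text \<open>
  The identity needs no separate treatment because \<open>y + y = 0\<close>.
\<close>

lemma G_generated:
  assumes x: "P (xy 1 0)" and y: "P (xy 0 1)" and add: "\<And>g h. P g \<Longrightarrow> P h \<Longrightarrow> P (g + h)"
  shows "P (g :: G)"
proof -
  have "xy 0 1 + xy 0 1 = 0" unfolding xy_add xy_0[symmetric] xy_eq_iff by simp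
  then have "P 0" using add[OF y y] by simp
  have "P (xy i j)" for i j
  proof (induction i)
    case 0
    show ?case
    proof (induction j)
      case 0
      show ?case using \<open>P 0\<close> by (simp add: xy_0)
    next
      case (Suc j)
      then show ?case using add[OF y, of "xy 0 j"] by (simp add: xy_add)
    qed
  next
    case (Suc i)
    then show ?case using add[OF x, of "xy i j"] by (simp add: xy_add)
  qed
  then show ?thesis by (metis xy_exp)
qed

text \<open>
  The \<open>Z\<^sub>g\<close> and the \<open>C\<^sub>g\<close> are, up to nonzero scalars, products of those for \<open>x\<close> and \<open>y\<close>, so a linear map has
  to be tested against finitely many operators only.
\<close>

lemma yd_hom_of_generators:
  assumes M: "yd_module Hc sc M" and N: "yd_module Hc sc' N"
    and f: "\<And>v. v \<in> vs M \<Longrightarrow> f v \<in> vs N" "\<And>v w. v \<in> vs M \<Longrightarrow> w \<in> vs M \<Longrightarrow> f (v + w) = f v + f w"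
      "\<And>c v. v \<in> vs M \<Longrightarrow> f (sc c v) = sc' c (f v)"
    and E: "\<And>g v. v \<in> vs M \<Longrightarrow> f (act M (bas (Inl g)) v) = act N (bas (Inl g)) (f v)"
    and T: "\<And>v. v \<in> vs M \<Longrightarrow> f (act M t_H v) = act N t_H (f v)"
    and Z: "\<And>v g. v \<in> vs M \<Longrightarrow> g \<in> {xy 1 0, xy 0 1} \<Longrightarrow> f (coact M v $ Inl g) = coact N (f v) $ Inl g"
    and C: "\<And>v g. v \<in> vs M \<Longrightarrow> g \<in> {xy 1 0, xy 0 1} \<Longrightarrow> f (coact M v $ Inr g) = coact N (f v) $ Inr g"
  shows "yd_hom sc sc' M N f"
proof -
  interpret R: double_rep sc "vs M" "\<lambda>g. act M (bas (Inl g))" "act M t_H"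
    "\<lambda>g v. coact M v $ Inl g" "\<lambda>g v. coact M v $ Inr g" by (rule double_rep_of_yd_module[OF M])
  interpret S: double_rep sc' "vs N" "\<lambda>g. act N (bas (Inl g))" "act N t_H"
    "\<lambda>g v. coact N v $ Inl g" "\<lambda>g v. coact N v $ Inr g" by (rule double_rep_of_yd_module[OF N])
  have fz: "f 0 = 0" using f(3)[OF R.subspace_0[OF R.subspace_V], of 0] by simp
  have fsum: "f (\<Sum>i\<in>I. x i) = (\<Sum>i\<in>I. f (x i))" if "finite I" "\<And>i. i \<in> I \<Longrightarrow> x i \<in> vs M" for I :: "G set" and x
    using that
  proof (induction I)
    case (insert i I)
    then have "sum x I \<in> vs M" by (intro R.subspace_sum R.subspace_V) auto
    with insert show ?case by (simp add: f(2))
  qed (simp add: fz)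
  have Z': "\<forall>v\<in>vs M. f (coact M v $ Inl g) = coact N (f v) $ Inl g" for g
  proof (rule G_generated[where P="\<lambda>g. \<forall>v\<in>vs M. f (coact M v $ Inl g) = coact N (f v) $ Inl g"], goal_cases)
    case (3 g h)
    show ?case
    proof
      fix v assume v: "v \<in> vs M"
      have "f (coact M v $ Inl (g + h)) = f (coact M (coact M v $ Inl h) $ Inl g)" using v by (simp add: R.ZZ)
      also have "\<dots> = coact N (coact N (f v) $ Inl h) $ Inl g" using 3 v R.mem by simp
      also have "\<dots> = coact N (f v) $ Inl (g + h)" using v f S.ZZ by simp
      finally show "f (coact M v $ Inl (g + h)) = coact N (f v) $ Inl (g + h)" .
    qed
  qed (simp_all add: Z)
  have C': "\<forall>v\<in>vs M. f (coact M v $ Inr g) = coact N (f v) $ Inr g" for g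
  proof (rule G_generated[where P="\<lambda>g. \<forall>v\<in>vs M. f (coact M v $ Inr g) = coact N (f v) $ Inr g"], goal_cases)
    case (3 g h)
    show ?case
    proof
      fix v assume v: "v \<in> vs M"
      have "sc' (tau_t g h) (f (coact M v $ Inr (g + h))) = f (coact M (coact M v $ Inr h) $ Inr g)"
        using v by (simp add: R.CC R.mem f(3))
      also have "\<dots> = coact N (coact N (f v) $ Inr h) $ Inr g" using 3 v R.mem by simp
      also have "\<dots> = sc' (tau_t g h) (coact N (f v) $ Inr (g + h))" using v f S.CC by simp
      finally show "f (coact M v $ Inr (g + h)) = coact N (f v) $ Inr (g + h)"
        by (simp add: tau_nonzero)
    qed
  qed (simp_all add: C)
  show ?thesis unfolding yd_hom_def
  proof (intro conjI ballI allI)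
    fix v a assume v: "v \<in> vs M"
    have "f (act M a v) = (\<Sum>g\<in>UNIV. f (sc (a $ Inl g) (act M (bas (Inl g)) v))) +
        (\<Sum>g\<in>UNIV. f (sc (a $ Inr g) (act M (bas (Inl g)) (act M t_H v))))"
      unfolding act_expand[OF M v, of a]
      using v by (simp add: f(2) fsum R.mem R.subspace_sum R.subspace_scale R.subspace_V)
    also have "\<dots> = act N a (f v)"
      unfolding act_expand[OF N f(1)[OF v], of a] using v by (simp add: f(3) R.mem E T)
    finally show "f (act M a v) = act N a (f v)" .
    show "coact N (f v) $ b = f (coact M v $ b)" for b
      using v Z' C' by (cases b) simp_all
  qed (simp_all add: f)
qed

section \<open>Simplicity and universal property of the three families\<close>

lemma yd_of_ops_sel:
  "vs (yd_of_ops U E T Z C) = U"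
  "act (yd_of_ops U E T Z C) (bas (Inl g)) u = E g u"
  "coact (yd_of_ops U E T Z C) u $ Inl g = Z g u"
  "coact (yd_of_ops U E T Z C) u $ Inr g = C g u"
  by (simp_all add: yd_of_ops_def bas_nth vec.sum_scale_delta)

lemma yd_of_ops_t:
  assumes "double_rep (*s) U E T Z C" "u \<in> U"
  shows "act (yd_of_ops U E T Z C) t_H u = T u"
proof -
  interpret R: double_rep "(*s)" U E T Z C by fact
  show ?thesis using assms(2) by (simp add: yd_of_ops_def t_H_nth R.sum_E R.mem)
qed

lemma yd_submodule_ops:
  assumes R: "double_rep (*s) V E T Z C" and U: "yd_submodule (*s) (yd_of_ops V E T Z C) U" and u: "u \<in> U"
  shows "E g u \<in> U" "T u \<in> U" "Z g u \<in> U" "C g u \<in> U" "vec.subspace U" "U \<subseteq> V"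
proof -
  show sub: "U \<subseteq> V" "vec.subspace U" using U by (auto simp: yd_submodule_def yd_of_ops_sel)
  have a: "act (yd_of_ops V E T Z C) x u \<in> U" "coact (yd_of_ops V E T Z C) u $ b \<in> U" for x b
    using U u unfolding yd_submodule_def by blast+
  have "u \<in> V" using sub u by blast
  then show "E g u \<in> U" "T u \<in> U" "Z g u \<in> U" "C g u \<in> U"
    using a(1)[of "bas (Inl g)"] a(1)[of t_H] a(2)[of "Inl g"] a(2)[of "Inr g"]
    by (simp_all add: yd_of_ops_sel yd_of_ops_t[OF R])
qed

text \<open>
  A nonzero invariant subspace contains the first basis vector, by a projection onto it (preceded by a swap
  of the coordinates if necessary), and with it the second one.
\<close>

lemma simple_plane:
  fixes E :: "G \<Rightarrow> 'k::field ^ 2 \<Rightarrow> 'k ^ 2"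
  assumes R: "double_rep (*s) UNIV E T Z C"
    and proj: "\<And>U u. yd_submodule (*s) (yd_of_ops UNIV E T Z C) U \<Longrightarrow> u \<in> U \<Longrightarrow> diag k 0 u \<in> U"
    and swap: "\<And>U u. yd_submodule (*s) (yd_of_ops UNIV E T Z C) U \<Longrightarrow> u \<in> U \<Longrightarrow> adiag p q u \<in> U"
    and nz: "k \<noteq> 0" "p \<noteq> 0" "q \<noteq> 0"
  shows "simple_yd_module Hc (*s) (yd_of_ops UNIV E T Z C)"
  unfolding simple_yd_module_def
proof (intro conjI allI impI)
  show "yd_module Hc (*s) (yd_of_ops UNIV E T Z C)" by (rule yd_module_of_double_rep[OF R])
  show "vs (yd_of_ops UNIV E T Z C) \<noteq> {0}"
    unfolding yd_of_ops_sel by (metis UNIV_I axis_eq_0_iff singletonD zero_neq_one)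
next
  fix U assume U: "yd_submodule (*s) (yd_of_ops UNIV E T Z C) U"
  have sub: "vec.subspace U" using U by (simp add: yd_submodule_def)
  note sc = vec.subspace_scale[OF sub]
  show "U = {0} \<or> U = vs (yd_of_ops UNIV E T Z C)"
  proof (cases "U = {0}")
    case False
    then obtain u where u: "u \<in> U" "u \<noteq> 0" using vec.subspace_0[OF sub] by blast
    have first: "axis 1 1 \<in> U" if w: "w \<in> U" "w $ 1 \<noteq> 0" for w
    proof -
      have "axis 1 1 = (1 / (k * w $ 1)) *s diag k 0 w" using nz w by (simp add: vec2_eq axis_def)
      then show ?thesis using sc proj[OF U w(1)] by metis
    qed
    have e1: "axis 1 1 \<in> U"
    proof (cases "u $ 1 = 0")
      case True
      then have "u $ 2 \<noteq> 0" using u(2) by (auto simp: vec2_eq)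
      then show ?thesis using first[OF swap[OF U u(1)]] nz by simp
    qed (use first u in auto)
    have "axis 2 1 = (1 / p) *s adiag p q (axis 1 1)" using nz by (simp add: vec2_eq axis_def)
    then have e2: "axis 2 1 \<in> U" using sc swap[OF U e1] by metis
    have "x \<in> U" for x
    proof -
      have "x = x $ 1 *s axis 1 1 + x $ 2 *s axis 2 1" by (simp add: vec2_eq axis_def)
      then show ?thesis using vec.subspace_add[OF sub sc[OF e1] sc[OF e2]] by metis
    qed
    then show ?thesis by (auto simp: yd_of_ops_sel)
  qed simp
qed

lemma simple_line:
  fixes E :: "G \<Rightarrow> 'k::field ^ 2 \<Rightarrow> 'k ^ 2"
  assumes R: "double_rep (*s) (vec.span {axis 1 1}) E T Z C"
  shows "simple_yd_module Hc (*s) (yd_of_ops (vec.span {axis 1 1}) E T Z C)"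
  unfolding simple_yd_module_def
proof (intro conjI allI impI)
  let ?M = "yd_of_ops (vec.span {axis 1 1}) E T Z C"
  show "yd_module Hc (*s) ?M" by (rule yd_module_of_double_rep[OF R])
  show "vs ?M \<noteq> {0}"
    unfolding yd_of_ops_sel by (metis axis_eq_0_iff singletonD insertI1 vec.span_base zero_neq_one)
  fix U assume U: "yd_submodule (*s) ?M U"
  have sub: "vec.subspace U" "U \<subseteq> vec.span {axis 1 1}" using U by (auto simp: yd_submodule_def yd_of_ops_sel)
  show "U = {0} \<or> U = vs ?M"
  proof (cases "U = {0}")
    case False
    then obtain u where u: "u \<in> U" "u \<noteq> 0" using vec.subspace_0[OF sub(1)] by blast
    then obtain c where c: "u = c *s axis 1 1" using sub by (auto simp: vec.span_singleton)
    with u have "axis 1 1 = (1 / c) *s u" by auto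
    then have "axis 1 1 \<in> U" using vec.subspace_scale[OF sub(1) u(1)] by metis
    then have "vec.span {axis 1 1} \<subseteq> U" by (intro vec.span_minimal sub(1)) simp
    then show ?thesis using sub by (auto simp: yd_of_ops_sel)
  qed simp
qed

definition induced_yd :: "G \<Rightarrow> 'k::field \<Rightarrow> 'k \<Rightarrow> (G + G, 'k, 'k ^ 2) yd" where
  "induced_yd \<mu> \<alpha> \<beta> = yd_of_ops UNIV
     (\<lambda>g. diag (of_bool (g = \<mu>)) (of_bool (g = tri \<mu>))) (adiag 1 (sigma_t \<mu>))
     (\<lambda>g. diag (lin_char \<alpha> \<beta> g) (swap_sign (tri \<mu>) g * lin_char \<alpha> \<beta> (tri g))) (\<lambda>g u. 0)"

definition scalar_yd :: "G \<Rightarrow> 'k::field \<Rightarrow> 'k \<Rightarrow> 'k \<Rightarrow> (G + G, 'k, 'k ^ 2) yd" where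
  "scalar_yd \<mu> \<alpha> \<beta> c = yd_of_ops (vec.span {axis 1 1})
     (\<lambda>g u. of_bool (g = \<mu>) *s u) ((*s) c) (\<lambda>g. (*s) (lin_char \<alpha> \<beta> g)) (\<lambda>g u. 0)"

definition twisted_yd :: "G \<Rightarrow> 'k::field \<Rightarrow> 'k \<Rightarrow> ('k ^ 2 \<Rightarrow> 'k ^ 2) \<Rightarrow> (G + G, 'k, 'k ^ 2) yd" where
  "twisted_yd \<mu> a b T = yd_of_ops UNIV
     (\<lambda>g. diag (of_bool (g = \<mu>)) (of_bool (g = \<mu> + xy 0 1))) T (\<lambda>g u. 0) (chi_op a b)"

text \<open>
  If \<open>tri \<mu> \<noteq> \<mu>\<close>, then \<open>E\<^sub>\<mu>\<close> is the projection onto the first coordinate.  Otherwise \<open>Z\<^sub>x\<close> separates the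
  coordinates: its eigenvalues \<open>\<alpha>\<close> and \<open>swap_sign \<mu> x * \<alpha> * \<beta>\<close> are different.
\<close>

lemma simple_induced:
  fixes \<alpha> \<beta> :: "'k::field"
  assumes ab: "\<alpha> ^ 4 = 1" "\<beta> ^ 2 = 1"
    and ne: "tri \<mu> \<noteq> \<mu> \<or> swap_sign \<mu> (xy 1 0) * \<beta> \<noteq> 1"
  shows "simple_yd_module Hc (*s) (induced_yd \<mu> \<alpha> \<beta>)"
proof -
  note R = double_rep_induced[OF ab, of \<mu>]
  \<comment> \<open>\<open>k\<close> is the scalar by which the projection onto the first coordinate that lies in the algebra is multiplied\<close>
  define k where "k = (if tri \<mu> \<noteq> \<mu> then 1 else \<alpha> - swap_sign \<mu> (xy 1 0) * (\<alpha> * \<beta>))"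
  have \<alpha>0: "\<alpha> \<noteq> 0" using ab(1) by auto
  have k: "k \<noteq> 0"
  proof
    assume "k = 0"
    then have "tri \<mu> = \<mu>" "\<alpha> * 1 = \<alpha> * (swap_sign \<mu> (xy 1 0) * \<beta>)" 
      by (auto simp: k_def mult_ac split: if_splits)
    with ne \<alpha>0 show False by (simp del: mult_1_right)
  qed
  show ?thesis
    unfolding induced_yd_def
  proof (rule simple_plane[OF R _ _ k, where p=1 and q="sigma_t \<mu>"])
    fix U u assume U: "yd_submodule (*s) (yd_of_ops UNIV (\<lambda>g. diag (of_bool (g = \<mu>)) (of_bool (g = tri \<mu>))) (adiag 1 (sigma_t \<mu>))
     (\<lambda>g. diag (lin_char \<alpha> \<beta> g) (swap_sign (tri \<mu>) g * lin_char \<alpha> \<beta> (tri g))) (\<lambda>g u. 0)) U" and u: "u \<in> U"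
    note cl = yd_submodule_ops[OF R U]
    show "adiag 1 (sigma_t \<mu>) u \<in> U" by (rule cl(2)[OF u])
    have lc: "lin_char \<alpha> \<beta> (xy 1 0) = \<alpha>" "lin_char \<alpha> \<beta> (tri (xy 1 0)) = \<alpha> * \<beta>"
      by (simp_all add: lin_char_xy[OF ab] tri_xy)
    show "diag k 0 u \<in> U"
    proof (cases "tri \<mu> = \<mu>")
      case True
      have "diag k 0 u = diag (lin_char \<alpha> \<beta> (xy 1 0)) (swap_sign (tri \<mu>) (xy 1 0) * lin_char \<alpha> \<beta> (tri (xy 1 0))) u
           + (- (swap_sign \<mu> (xy 1 0) * (\<alpha> * \<beta>))) *s u"
        unfolding lc by (simp add: vec2_eq True k_def algebra_simps)
      then show ?thesis using vec.subspace_add[OF cl(5)[OF u] cl(3)[OF u] vec.subspace_scale[OF cl(5)[OF u] u]] by metis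
    next
      case False
      then have "diag k 0 u = diag (of_bool (\<mu> = \<mu>)) (of_bool (\<mu> = tri \<mu>)) u" by (auto simp: k_def)
      then show ?thesis using cl(1)[OF u] by metis
    qed
  qed (simp_all add: sigma_nonzero)
qed

lemma simple_scalar:
  assumes "\<alpha> ^ 4 = 1" "\<beta> ^ 2 = 1" "c * c = sigma_t \<mu>" "tri \<mu> = \<mu>"
    and "\<And>g. lin_char \<alpha> \<beta> g = swap_sign \<mu> g * lin_char \<alpha> \<beta> (tri g)" 
  shows "simple_yd_module Hc (*s) (scalar_yd \<mu> \<alpha> \<beta> c)"
  unfolding scalar_yd_def by (rule simple_line[OF double_rep_scalar[OF assms]])

lemma y_shift_neq: "\<mu> + xy 0 1 \<noteq> \<mu>"
  by (simp add: xy_eq_iff flip: xy_0)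

lemma simple_twisted:
  fixes a b :: "'k::field"
  assumes ab: "a * a = 1" "b * b = 1"
    and T: "T = adiag l (- (a * b * l)) \<and> odd (xexp \<mu>) \<and> - (a * b * l * l) = sigma_t \<mu> \<or> 
      T = diag l (- (b * l)) \<and> even (xexp \<mu>) \<and> l * l = sigma_t \<mu>"
    and \<mu>: "yexp \<mu> = 0"
  shows "simple_yd_module Hc (*s) (twisted_yd \<mu> a b T)"
proof -
  note R = double_rep_twisted[OF assms]
  have x: "chi_op a b (xy 1 0) = adiag 1 a"
    using chi_op_even_odd(2)[OF ab, of 0 0] by simp
  show ?thesis
    unfolding twisted_yd_def
  proof (rule simple_plane[OF R, where k=1 and p=1 and q=a])
    fix U u assume U: "yd_submodule (*s) (yd_of_ops UNIV (\<lambda>g. diag (of_bool (g = \<mu>)) (of_bool (g = \<mu> + xy 0 1))) T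
      (\<lambda>g u. 0) (chi_op a b)) U" and u: "u \<in> U"
    note cl = yd_submodule_ops[OF R U u]
    show "adiag 1 a u \<in> U" using cl(4)[of "xy 1 0"] unfolding x .
    have "diag 1 0 u = diag (of_bool (\<mu> = \<mu>)) (of_bool (\<mu> = \<mu> + xy 0 1)) u"
      using y_shift_neq[of \<mu>] by (simp del: One_nat_def)
    then show "diag 1 0 u \<in> U" using cl(1) by metis
  qed (use ab in auto)
qed

lemma vec_combination_hom:
  fixes x y :: "'k::field ^ 2"
  assumes "vector_space sc"
  shows "sc ((x + y) $ 1) v + sc ((x + y) $ 2) w = sc (x $ 1) v + sc (x $ 2) w + (sc (y $ 1) v + sc (y $ 2) w)"
    and "sc ((c *s x) $ 1) v + sc ((c *s x) $ 2) w = sc c (sc (x $ 1) v + sc (x $ 2) w)"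
    and "sc ((axis 1 1 :: 'k ^ 2) $ 1) v + sc ((axis 1 1 :: 'k ^ 2) $ 2) w = v"
proof -
  interpret vector_space sc by fact
  show "sc ((x + y) $ 1) v + sc ((x + y) $ 2) w = sc (x $ 1) v + sc (x $ 2) w + (sc (y $ 1) v + sc (y $ 2) w)"
    "sc ((c *s x) $ 1) v + sc ((c *s x) $ 2) w = sc c (sc (x $ 1) v + sc (x $ 2) w)"
    "sc ((axis 1 1 :: 'k ^ 2) $ 1) v + sc ((axis 1 1 :: 'k ^ 2) $ 2) w = v"
    by (simp_all add: scale_left_distrib scale_right_distrib axis_def)
qed

context double_rep
begin

lemma E_weight: "v \<in> V \<Longrightarrow> E \<mu> v = v \<Longrightarrow> E g v = sc (of_bool (g = \<mu>)) v"
  using EE[of v g \<mu>] by auto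

lemma E_T_weight: "v \<in> V \<Longrightarrow> E \<mu> v = v \<Longrightarrow> E g (T v) = sc (of_bool (g = tri \<mu>)) (T v)"
  using TE[of v "tri g"] E_weight[of v \<mu> "tri g"] tri_eq_iff[of g \<mu>] by (simp add: hom)

lemma T_T_weight: "v \<in> V \<Longrightarrow> E \<mu> v = v \<Longrightarrow> T (T v) = sc (sigma_t \<mu>) v"
  by (simp add: TT E_weight[of v \<mu>] sum_scale_delta)

lemma C_vanish: "v \<in> V \<Longrightarrow> C 0 v = 0 \<Longrightarrow> C g v = 0"
  using CC[of v g 0] by (simp add: tau_0 zero)

lemma Z_vanish: "v \<in> V \<Longrightarrow> C 0 v = v \<Longrightarrow> Z g v = 0"
  using ZC[of v g 0] by simp

lemma C_T_vanish: "v \<in> V \<Longrightarrow> C 0 v = 0 \<Longrightarrow> C g (T v) = 0"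
  by (simp add: CT C_vanish zero)

lemma Z_weight:
  assumes v: "v \<in> V" "C 0 v = 0" and Z: "Z (xy 1 0) v = sc \<alpha> v" "Z (xy 0 1) v = sc \<beta> v"
    and ab: "\<alpha> ^ 4 = 1" "\<beta> ^ 2 = 1"
  shows "Z g v = sc (lin_char \<alpha> \<beta> g) v"
proof (rule G_generated[where P="\<lambda>g. Z g v = sc (lin_char \<alpha> \<beta> g) v"], goal_cases)
  case 1
  show ?case unfolding Z lin_char_xy[OF ab] by simp
next
  case 2
  show ?case unfolding Z lin_char_xy[OF ab] by simp
next
  case (3 g h)
  then show ?case using v ZZ[of v g h] by (simp add: hom lin_char_add[OF ab] mult.commute)
qed

text \<open>
  If \<open>v\<close> is a joint eigenvector of the \<open>E\<^sub>g\<close> and \<open>Z\<^sub>g\<close>, then so is \<open>T v\<close>, because \<open>T v\<close> lies in the image of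
  \<open>E\<^bsub>tri \<mu>\<^esub>\<close> and a single summand of the relation for \<open>Z\<^sub>g T\<close> survives.
\<close>

lemma Z_T_weight:
  assumes v: "v \<in> V" "E \<mu> v = v" "C 0 v = 0" and Z: "Z (xy 1 0) v = sc \<alpha> v" "Z (xy 0 1) v = sc \<beta> v"
    and ab: "\<alpha> ^ 4 = 1" "\<beta> ^ 2 = 1"
  shows "Z g (T v) = sc (swap_sign (tri \<mu>) g * lin_char \<alpha> \<beta> (tri g)) (T v)"
proof -
  have "Z g (T v) = (\<Sum>q\<in>UNIV. sc (swap_sign q g) (E q (T (sc (lin_char \<alpha> \<beta> (tri g)) v))))"
    using v by (simp add: ZT swap_sign_def Z_weight[OF v(1,3) Z ab])
  also have "\<dots> = (\<Sum>q\<in>UNIV. sc ((swap_sign q g * lin_char \<alpha> \<beta> (tri g)) * of_bool (q = tri \<mu>)) (T v))"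
    using v by (intro sum.cong refl) (simp add: hom mem E_T_weight[OF v(1,2)])
  also have "\<dots> = sc (swap_sign (tri \<mu>) g * lin_char \<alpha> \<beta> (tri g)) (T v)"
    by (rule sum_scale_delta)
  finally show ?thesis .
qed

end

text \<open>
  The linear map with \<open>(1, 0) \<mapsto> v\<close> and \<open>(0, 1) \<mapsto> w\<close> is a homomorphism if the operators act on \<open>v\<close>, \<open>w\<close> by the
  same matrices as on the basis.  On a line inside the plane the choice of \<open>w\<close> is immaterial.
\<close>

lemma yd_hom_of_ops:
  fixes E' :: "G \<Rightarrow> 'k::field ^ 2 \<Rightarrow> 'k ^ 2"
  assumes S: "double_rep (*s) U E' T' Z' C'" and M: "yd_module Hc sc M" and v: "v \<in> vs M" and w: "w \<in> vs M"
    and E: "\<And>g u. u \<in> U \<Longrightarrow> sc (E' g u $ 1) v + sc (E' g u $ 2) w =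
        sc (u $ 1) (act M (bas (Inl g)) v) + sc (u $ 2) (act M (bas (Inl g)) w)"
    and T: "\<And>u. u \<in> U \<Longrightarrow> sc (T' u $ 1) v + sc (T' u $ 2) w =
        sc (u $ 1) (act M t_H v) + sc (u $ 2) (act M t_H w)"
    and Z: "\<And>g u. u \<in> U \<Longrightarrow> g \<in> {xy 1 0, xy 0 1} \<Longrightarrow> sc (Z' g u $ 1) v + sc (Z' g u $ 2) w =
        sc (u $ 1) (coact M v $ Inl g) + sc (u $ 2) (coact M w $ Inl g)"
    and C: "\<And>g u. u \<in> U \<Longrightarrow> g \<in> {xy 1 0, xy 0 1} \<Longrightarrow> sc (C' g u $ 1) v + sc (C' g u $ 2) w =
        sc (u $ 1) (coact M v $ Inr g) + sc (u $ 2) (coact M w $ Inr g)"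
  shows "yd_hom (*s) sc (yd_of_ops U E' T' Z' C') M (\<lambda>u. sc (u $ 1) v + sc (u $ 2) w)"
proof -
  interpret R: double_rep sc "vs M" "\<lambda>g. act M (bas (Inl g))" "act M t_H"
    "\<lambda>g v. coact M v $ Inl g" "\<lambda>g v. coact M v $ Inr g" by (rule double_rep_of_yd_module[OF M])
  have lin: "F (sc x v + sc y w) = sc x (F v) + sc y (F w)" if "endo_on sc (vs M) F" for F x y
  proof -
    have "sc x v \<in> vs M" "sc y w \<in> vs M" using v w by (simp_all add: R.subspace_scale R.subspace_V)
    with that v w show ?thesis by (simp add: endo_on_def)
  qed
  show ?thesis
  proof (rule yd_hom_of_generators[OF yd_module_of_double_rep[OF S] M], goal_cases)
    case (1 u)
    show ?case by (intro R.subspace_add R.subspace_scale R.subspace_V v w)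
  next
    case (2 u u')
    show ?case by (rule vec_combination_hom[OF R.vector_space_axioms])
  next
    case (3 c u)
    show ?case by (rule vec_combination_hom[OF R.vector_space_axioms])
  next
    case (4 g u)
    then show ?case unfolding yd_of_ops_sel lin[OF R.endo(1)] by (rule E)
  next
    case (5 u)
    then show ?case unfolding yd_of_ops_sel yd_of_ops_t[OF S 5[unfolded yd_of_ops_sel]] lin[OF R.endo(2)] by (rule T)
  next
    case (6 u g)
    then show ?case unfolding yd_of_ops_sel lin[OF R.endo(3)] by (rule Z)
  next
    case (7 u g)
    then show ?case unfolding yd_of_ops_sel lin[OF R.endo(4)] by (rule C)
  qed
qed

text \<open>
  The universal property of the induced module.
\<close>

lemma yd_hom_induced:
  fixes \<alpha> \<beta> :: "'k::field"
  assumes M: "yd_module Hc sc M" and v: "v \<in> vs M" "act M (bas (Inl \<mu>)) v = v" "coact M v $ Inr 0 = 0"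
    "coact M v $ Inl (xy 1 0) = sc \<alpha> v" "coact M v $ Inl (xy 0 1) = sc \<beta> v"
    and ab: "\<alpha> ^ 4 = 1" "\<beta> ^ 2 = 1"
  shows "yd_hom (*s) sc (induced_yd \<mu> \<alpha> \<beta>) M (\<lambda>u. sc (u $ 1) v + sc (u $ 2) (act M t_H v))"
proof -
  interpret R: double_rep sc "vs M" "\<lambda>g. act M (bas (Inl g))" "act M t_H"
    "\<lambda>g v. coact M v $ Inl g" "\<lambda>g v. coact M v $ Inr g" by (rule double_rep_of_yd_module[OF M])
  show ?thesis unfolding induced_yd_def
  proof (rule yd_hom_of_ops[OF double_rep_induced[OF ab] M v(1) R.mem(2)[OF v(1)]], goal_cases)
    case (1 g u)
    show ?case by (simp add: R.E_weight[OF v(1,2)] R.E_T_weight[OF v(1,2)] mult.commute)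
  next
    case (2 u)
    show ?case by (simp add: R.T_T_weight[OF v(1,2)] mult.commute add.commute)
  next
    case (3 g u)
    show ?case
      by (simp add: R.Z_weight[OF v(1,3,4,5) ab] R.Z_T_weight[OF v ab] mult.commute)
  next
    case (4 g u)
    show ?case by (simp add: R.C_vanish[OF v(1,3)] R.C_T_vanish[OF v(1,3)])
  qed
qed

lemma yd_hom_scalar:
  fixes \<alpha> \<beta> :: "'k::field"
  assumes M: "yd_module Hc sc M" and v: "v \<in> vs M" "act M (bas (Inl \<mu>)) v = v" "coact M v $ Inr 0 = 0"
    "coact M v $ Inl (xy 1 0) = sc \<alpha> v" "coact M v $ Inl (xy 0 1) = sc \<beta> v" "act M t_H v = sc c v"
    and ab: "\<alpha> ^ 4 = 1" "\<beta> ^ 2 = 1" "c * c = sigma_t \<mu>" "tri \<mu> = \<mu>"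
      "\<And>g. lin_char \<alpha> \<beta> g = swap_sign \<mu> g * lin_char \<alpha> \<beta> (tri g)" 
  shows "yd_hom (*s) sc (scalar_yd \<mu> \<alpha> \<beta> c) M (\<lambda>u. sc (u $ 1) v + sc (u $ 2) 0)"
proof -
  interpret R: double_rep sc "vs M" "\<lambda>g. act M (bas (Inl g))" "act M t_H"
    "\<lambda>g v. coact M v $ Inl g" "\<lambda>g v. coact M v $ Inr g" by (rule double_rep_of_yd_module[OF M])
  show ?thesis unfolding scalar_yd_def
  proof (rule yd_hom_of_ops[OF double_rep_scalar[OF ab] M v(1) R.subspace_0[OF R.subspace_V]], goal_cases)
    case (1 g u)
    show ?case by (simp add: R.E_weight[OF v(1,2)] R.zero mult.commute)
  next
    case (2 u)
    show ?case by (simp add: v R.zero mult.commute)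
  next
    case (3 g u)
    show ?case by (simp add: R.Z_weight[OF v(1,3,4,5) ab(1,2)] R.zero mult.commute)
  next
    case (4 g u)
    show ?case by (simp add: R.C_vanish[OF v(1,3)] R.zero)
  qed
qed

text \<open>
  With \<open>w = C\<^sub>x v\<close>, all operators are determined on \<open>v\<close> and \<open>w\<close>.  The only one that takes work is \<open>T\<close> on
  \<open>w\<close>: as \<open>tri (xy) = x\<close>, the relation for \<open>C\<^bsub>xy\<^esub> T v\<close> expresses \<open>T w\<close> by \<open>T v\<close>.
\<close>

lemma yd_hom_twisted:
  fixes a b :: "'k::field"
  assumes M: "yd_module Hc sc M" and v: "v \<in> vs M" "act M (bas (Inl \<mu>)) v = v" "coact M v $ Inr 0 = v"
    "coact M v $ Inr (xy 0 1) = sc b v" "coact M v $ Inr (xy 2 0) = sc a v"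
    and ab: "a * a = 1" "b * b = 1"
    and T: "T = adiag l (- (a * b * l)) \<and> odd (xexp \<mu>) \<and> - (a * b * l * l) = sigma_t \<mu> \<and> act M t_H v = sc l (coact M v $ Inr (xy 1 0)) \<or> 
      T = diag l (- (b * l)) \<and> even (xexp \<mu>) \<and> l * l = sigma_t \<mu> \<and> act M t_H v = sc l v"
    and \<mu>: "yexp \<mu> = 0"
  shows "yd_hom (*s) sc (twisted_yd \<mu> a b T) M (\<lambda>u. sc (u $ 1) v + sc (u $ 2) (coact M v $ Inr (xy 1 0)))"
proof -
  interpret R: double_rep sc "vs M" "\<lambda>g. act M (bas (Inl g))" "act M t_H"
    "\<lambda>g v. coact M v $ Inl g" "\<lambda>g v. coact M v $ Inr g" by (rule double_rep_of_yd_module[OF M])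
  define w where "w = coact M v $ Inr (xy 1 0)"
  have w: "w \<in> vs M" unfolding w_def by (rule R.mem(4)[OF v(1)])
  have x: "chi_op a b (xy 1 0) = adiag 1 a" "chi_op a b (xy 0 1) = diag b (- b)"
    using chi_op_even_odd(2)[OF ab, of 0 0] chi_op_even_odd(1)[OF ab, of 0 1] by simp_all
  have Cw: "coact M w $ Inr (xy 1 0) = sc a v" "coact M w $ Inr (xy 0 1) = sc (- b) w"
  proof -
    have "coact M w $ Inr (xy 1 0) = sc (tau_t (xy 1 0) (xy 1 0)) (coact M v $ Inr (xy 1 0 + xy 1 0))"
      unfolding w_def by (rule R.CC[OF v(1)])
    then show "coact M w $ Inr (xy 1 0) = sc a v" unfolding tau_xy xy_add using v(5) by (simp add: numeral_2_eq_2)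
    have 1: "coact M w $ Inr (xy 0 1) = sc (tau_t (xy 0 1) (xy 1 0)) (coact M v $ Inr (xy 0 1 + xy 1 0))"
      unfolding w_def by (rule R.CC[OF v(1)])
    have "coact M (coact M v $ Inr (xy 0 1)) $ Inr (xy 1 0) = sc (tau_t (xy 1 0) (xy 0 1)) (coact M v $ Inr (xy 1 0 + xy 0 1))"
      by (rule R.CC[OF v(1)])
    then have "sc b w = coact M v $ Inr (xy 0 1 + xy 1 0)"
      unfolding v(4) tau_xy R.hom(4)[OF v(1)] w_def[symmetric] by (simp add: add.commute)
    then show "coact M w $ Inr (xy 0 1) = sc (- b) w" unfolding 1 tau_xy by simp
  qed
  have Ew: "act M (bas (Inl g)) w = sc (of_bool (g = \<mu> + xy 0 1)) w" for g
  proof -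
    have "act M (bas (Inl (g + xy 0 1 + tri (xy 1 0) - xy 1 0))) w = coact M (act M (bas (Inl (g + xy 0 1))) v) $ Inr (xy 1 0)"
      unfolding w_def by (rule R.CE[OF v(1), symmetric])
    also have "g + xy 0 1 + tri (xy 1 0) - xy 1 0 = g"
      unfolding shift_tri using shift_y[of "g + xy 0 1" g] by (simp add: xexp_xy)
    also have "act M (bas (Inl (g + xy 0 1))) v = sc (of_bool (g = \<mu> + xy 0 1)) v"
      unfolding R.E_weight[OF v(1,2)] shift_y ..
    finally show ?thesis by (simp add: R.hom(4)[OF v(1)] w_def)
  qed
  have Tw: "act M t_H w = (if odd (xexp \<mu>) then sc (- (a * b * l)) v else sc (- (b * l)) w)"
  proof -
    \<comment> \<open>the index of \<open>E\<close> at which \<open>T w\<close> sits\<close>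
    define \<mu>' where "\<mu>' = tri (\<mu> + xy 0 1)"
    have \<mu>': "yexp \<mu>' = (if odd (xexp \<mu>) then 0 else 1)"
    proof -
      have "\<mu>' = xy (xexp \<mu>) (xexp \<mu> + 1)" 
        using xy_exp[of \<mu>] \<mu> unfolding \<mu>'_def by (metis xy_add tri_xy add_0 add_0_right)
      then show ?thesis by (auto simp: yexp_xy mod_Suc even_iff_mod_2_eq_zero odd_iff_mod_2_eq_one)
    qed
    have "act M (bas (Inl (\<mu> + xy 0 1))) w = w" by (simp add: Ew)
    note ET = R.E_T_weight[OF w this, folded \<mu>'_def]
    \<comment> \<open>the sign \<open>\<tau>(q, xy) \<tau>(x, q)\<close> depends on the \<open>y\<close>-exponent of the index \<open>q\<close> of \<open>E\<close> at which \<open>T w\<close> sits\<close>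
    have "tri (xy 1 1) = xy 1 0" unfolding tri_xy xy_eq_iff by simp
    then have "coact M (act M t_H v) $ Inr (xy 1 1) =
       (\<Sum>q\<in>UNIV. sc (tau_t q (xy 1 1) * tau_t (xy 1 0) q) (act M (bas (Inl q)) (act M t_H w)))"
      using R.CT[OF v(1), of "xy 1 1"] by (simp only: w_def)
    also have "\<dots> = sc (tau_t \<mu>' (xy 1 1) * tau_t (xy 1 0) \<mu>') (act M t_H w)"
      unfolding ET R.scale_scale by (rule R.sum_scale_delta)
    also have "tau_t \<mu>' (xy 1 1) * tau_t (xy 1 0) \<mu>' = (if odd (xexp \<mu>) then 1 else -1 :: 'k)"
      by (simp add: tau_t_def xexp_xy yexp_xy \<mu>')
    finally have *: "coact M (act M t_H v) $ Inr (xy 1 1) = sc (if odd (xexp \<mu>) then 1 else -1) (act M t_H w)" .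
    have C11: "coact M u $ Inr (xy 1 1) = coact M (coact M u $ Inr (xy 0 1)) $ Inr (xy 1 0)" if "u \<in> vs M" for u
    proof -
      have "coact M (coact M u $ Inr (xy 0 1)) $ Inr (xy 1 0) = sc (tau_t (xy 1 0) (xy 0 1)) (coact M u $ Inr (xy 1 0 + xy 0 1))"
        by (rule R.CC[OF that])
      then show ?thesis unfolding tau_xy xy_add by simp
    qed
    from T show ?thesis
    proof (elim disjE conjE)
      assume o: "odd (xexp \<mu>)" and t: "act M t_H v = sc l (coact M v $ Inr (xy 1 0))"
      have "act M t_H w = coact M (sc l w) $ Inr (xy 1 1)" using * o t by (simp add: w_def)
      also have "\<dots> = sc l (sc (- b) (sc a v))"
        using w by (simp only: R.hom C11 Cw R.mem v(1))
      finally show ?thesis using o by (simp add: mult_ac)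
    next
      assume e: "even (xexp \<mu>)" and t: "act M t_H v = sc l v"
      have "sc (-1) (act M t_H w) = coact M (sc l v) $ Inr (xy 1 1)" using * e t by simp
      also have "\<dots> = sc l (sc b w)"
        using v by (simp only: R.hom C11 w_def)
      finally have "- act M t_H w = sc (b * l) w" by (simp add: mult_ac)
      then show ?thesis using e by (metis R.scale_minus_left minus_minus)
    qed
  qed
  have T': "T = adiag l (- (a * b * l)) \<and> odd (xexp \<mu>) \<and> - (a * b * l * l) = sigma_t \<mu> \<or> 
      T = diag l (- (b * l)) \<and> even (xexp \<mu>) \<and> l * l = sigma_t \<mu>"
    using T by (rule disj_forward) (elim conjE, intro conjI, assumption+)+
  show ?thesis unfolding twisted_yd_def w_def[symmetric]
  proof (rule yd_hom_of_ops[OF double_rep_twisted[OF ab T' \<mu>] M v(1) w], goal_cases)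
    case (1 g u)
    show ?case by (simp add: R.E_weight[OF v(1,2)] Ew mult.commute del: One_nat_def)
  next
    case (2 u)
    from T show ?case
    proof (elim disjE conjE)
      assume 1: "T = adiag l (- (a * b * l))" "odd (xexp \<mu>)" "act M t_H v = sc l (coact M v $ Inr (xy 1 0))"
      show ?thesis unfolding 1(1,3) Tw w_def[symmetric] using 1(2) by (simp add: mult_ac)
    next
      assume 1: "T = diag l (- (b * l))" "even (xexp \<mu>)" "act M t_H v = sc l v"
      show ?thesis unfolding 1(1,3) Tw using 1(2) by (simp add: mult_ac)
    qed
  next
    case (3 g u)
    have "coact M w $ Inl g = 0" unfolding w_def by (rule R.ZC[OF v(1)])
    then show ?case by (simp add: R.Z_vanish[OF v(1,3)])
  next
    case (4 g u)
    then consider "g = xy 1 0" | "g = xy 0 1" by blast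
    then show ?case
    proof cases
      case 1
      show ?thesis unfolding 1 x Cw w_def[symmetric] by (simp add: mult.commute add.commute)
    next
      case 2
      show ?thesis unfolding 2 x Cw v(4) by (simp add: mult.commute)
    qed
  qed
qed

section \<open>Joint eigenvectors\<close>

context double_rep
begin

text \<open>
  Joint eigenvectors are found by passing to eigenspaces of one operator after the other;
  \<open>eigen_endo\<close> keeps the remaining operators acting on them.
\<close>

lemma eigen_subspace:
  assumes "subspace S" "endo_on sc S F"
  shows "subspace {v \<in> S. F v = sc c v}"
proof -
  have F0: "F 0 = 0" using assms subspace_0[OF assms(1)] unfolding endo_on_def by (metis scale_zero_left)
  show ?thesis
    by (rule subspaceI) (use assms F0 subspace_0[OF assms(1)] in
      \<open>auto simp: endo_on_def subspace_add subspace_scale scale_right_distrib scale_left_commute\<close>)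
qed

lemma eigen_endo:
  assumes "endo_on sc S F" "endo_on sc S K" "\<And>v. v \<in> S \<Longrightarrow> F (K v) = K (F v)"
  shows "endo_on sc {v \<in> S. F v = sc c v} K"
  using assms by (auto simp: endo_on_def)

text \<open>
  If \<open>F\<^sup>2 = c\<^sup>2\<close> on \<open>v\<close>, then \<open>F v + c v\<close> is an eigenvector for \<open>c\<close> unless it vanishes, in which case \<open>v\<close> is
  one for \<open>- c\<close>.
\<close>

lemma square_eigenvector:
  assumes S: "subspace S" "endo_on sc S F" and v: "v \<in> S" "v \<noteq> 0" and sq: "F (F v) = sc (c * c) v"
  obtains u d where "u \<in> S" "u \<noteq> 0" "F u = sc d u" "d = c \<or> d = - c"
proof (cases "F v + sc c v = 0")
  case True
  then have "F v = sc (- c) v" by (simp add: eq_neg_iff_add_eq_0)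
  then show ?thesis using v that by blast
next
  case False
  have Fv: "F v \<in> S" using S v by (auto simp: endo_on_def)
  then have m: "F v + sc c v \<in> S" "sc c v \<in> S" using S v by (auto intro: subspace_add subspace_scale)
  have "F (F v + sc c v) = F (F v) + F (sc c v)" using S(2) Fv m by (simp add: endo_on_def)
  also have "\<dots> = sc c (F v + sc c v)" using S(2) v sq by (simp add: endo_on_def scale_right_distrib add.commute)
  finally show ?thesis using that m False by blast
qed

lemma C_E_weight: "v \<in> V \<Longrightarrow> E \<mu> v = v \<Longrightarrow> E (\<mu> + tri g - g) (C g v) = C g v"
  using CE[of v g \<mu>] by simp

text \<open>
  \<open>C\<^bsub>tri g\<^esub>\<close> moves \<open>v\<close> to the image of \<open>E\<close> at \<open>\<mu> + g - tri g\<close>, and \<open>T\<close> applies \<open>tri\<close> to that index.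
\<close>

lemma C_T_weight:
  assumes v: "v \<in> V" "E \<mu> v = v" and q: "q = tri (\<mu> + g - tri g)"
  shows "C g (T v) = sc (tau_t q g * tau_t (tri g) q) (T (C (tri g) v))"
proof -
  have "E (\<mu> + g - tri g) (C (tri g) v) = C (tri g) v" using C_E_weight[OF v, of "tri g"] by simp
  note E_T_weight[OF mem(4)[OF v(1)] this, folded q]
  then have "C g (T v) = (\<Sum>r\<in>UNIV. sc ((tau_t r g * tau_t (tri g) r) * of_bool (r = q)) (T (C (tri g) v)))"
    using CT[OF v(1), of g] by simp
  then show ?thesis by (simp only: sum_scale_delta)
qed

lemma exists_E_weight:
  assumes "v \<in> V" "v \<noteq> 0"
  obtains \<mu> where "E \<mu> v \<noteq> 0"
proof -
  have "\<exists>\<mu>. E \<mu> v \<noteq> 0"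
  proof (rule ccontr)
    assume "\<nexists>\<mu>. E \<mu> v \<noteq> 0"
    then have "(\<Sum>g\<in>UNIV. E g v) = 0" by (intro sum.neutral) blast
    then show False using sum_E[OF assms(1)] assms(2) by simp
  qed
  then show ?thesis using that by blast
qed

lemma C0_commute: "v \<in> V \<Longrightarrow> C 0 (E g v) = E g (C 0 v)" "v \<in> V \<Longrightarrow> C 0 (C g v) = C g v"
    "v \<in> V \<Longrightarrow> C g (C 0 v) = C g v" "v \<in> V \<Longrightarrow> C 0 (T v) = T (C 0 v)"
  using CE[of v 0 g] CC[of v 0 g] CC[of v g 0] CT[of v 0] sum_E[of "T (C 0 v)"] by (simp_all add: tau_0 mem)

lemma T_nonzero: "v \<in> V \<Longrightarrow> E \<mu> v = v \<Longrightarrow> v \<noteq> 0 \<Longrightarrow> T v \<noteq> 0"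
  using T_T_weight[of v \<mu>] sigma_nonzero[of \<mu>, where 'k='k] by (auto simp: zero)

text \<open>
  Since \<open>Z\<^sub>x\<^sup>4 = 1\<close>, an eigenvector of \<open>Z\<^sub>x\<close> is found in two steps: first one of \<open>Z\<^sub>x\<^sup>2\<close>, with eigenvalue
  \<open>\<plusminus>1 = c\<^sup>2\<close> for \<open>c \<in> {1, \<xi>}\<close>, then one of \<open>Z\<^sub>x\<close>.
\<close>

lemma untwisted_joint_eigenvector:
  assumes \<xi>: "\<xi> * \<xi> = (-1 :: 'k)" and v: "v \<in> V" "v \<noteq> 0" "C 0 v = 0" "E \<mu> v = v"
  obtains u \<alpha> \<beta> where "u \<in> V" "u \<noteq> 0" "C 0 u = 0" "E \<mu> u = u"
    "Z (xy 1 0) u = sc \<alpha> u" "Z (xy 0 1) u = sc \<beta> u" "\<alpha> \<in> {1, -1, \<xi>, -\<xi>}" "\<beta> \<in> {1, -1}"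
proof -
  define S0 where "S0 = {v \<in> V. C 0 v = sc 0 v}"
  define S1 where "S1 = {v \<in> S0. E \<mu> v = sc 1 v}"
  have ZC': "C g (Z h v) = Z h (C g v)" if "v \<in> V" for g h v using that by (simp add: ZC CZ)
  have s0: "subspace S0" unfolding S0_def by (intro eigen_subspace subspace_V endo)
  have e0: "endo_on sc S0 (Z g)" "endo_on sc S0 (E g)" for g
    unfolding S0_def by (intro eigen_endo endo; simp add: ZC' C0_commute)+
  have sub: "S0 \<subseteq> V" by (auto simp: S0_def)
  have s1: "subspace S1" unfolding S1_def by (intro eigen_subspace s0 e0)
  have e1: "endo_on sc S1 (Z g)" for g
    unfolding S1_def using sub by (intro eigen_endo e0) (auto simp: ZE)
  have v1: "v \<in> S1" using v by (simp add: S1_def S0_def)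
  have in1: "u \<in> V \<and> C 0 u = 0 \<and> E \<mu> u = u" if "u \<in> S1" for u
    using that by (auto simp: S1_def S0_def)
  have Z0: "Z 0 u = u" if "u \<in> S1" for u using ZC0[of u] in1[OF that] by simp
  have yy: "xy 0 1 + xy 0 1 = 0" "xy 2 0 + xy 2 0 = 0" "xy 1 0 + xy 1 0 = xy 2 0" 
    unfolding xy_add xy_0[symmetric] xy_eq_iff by simp_all
  have "Z (xy 0 1) (Z (xy 0 1) v) = sc (1 * 1) v"
    using in1[OF v1] Z0[OF v1] by (simp add: ZZ yy del: One_nat_def)
  from square_eigenvector[OF s1 e1 v1 v(2) this]
  obtain u \<beta> where u: "u \<in> S1" "u \<noteq> 0" "Z (xy 0 1) u = sc \<beta> u" and \<beta>: "\<beta> = 1 \<or> \<beta> = -1" .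
  define S2 where "S2 = {v \<in> S1. Z (xy 0 1) v = sc \<beta> v}"
  have s2: "subspace S2" unfolding S2_def by (intro eigen_subspace s1 e1)
  have e2: "endo_on sc S2 (Z g)" for g
    unfolding S2_def using in1 by (intro eigen_endo e1) (auto simp: ZZ add.commute)
  have u2: "u \<in> S2" using u by (simp add: S2_def)
  have "Z (xy 2 0) (Z (xy 2 0) u) = sc (1 * 1) u"
    using in1[OF u(1)] Z0[OF u(1)] by (simp add: ZZ yy)
  from square_eigenvector[OF s2 e2 u2 u(2) this]
  obtain u' e where u': "u' \<in> S2" "u' \<noteq> 0" "Z (xy 2 0) u' = sc e u'" and e: "e = 1 \<or> e = -1" .
  obtain c where c: "e = c * c" "c = 1 \<or> c = \<xi>" using e \<xi> by force
  have "u' \<in> S1" using u' by (simp add: S2_def)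
  then have "Z (xy 1 0) (Z (xy 1 0) u') = sc (c * c) u'"
    using in1 u'(3) by (simp add: ZZ yy c(1) del: One_nat_def)
  from square_eigenvector[OF s2 e2 u'(1,2) this]
  obtain w \<alpha> where w: "w \<in> S2" "w \<noteq> 0" "Z (xy 1 0) w = sc \<alpha> w" and \<alpha>: "\<alpha> = c \<or> \<alpha> = - c" .
  show ?thesis
    using that[of w \<alpha> \<beta>] w \<alpha> \<beta> c in1 by (auto simp: S2_def)
qed

text \<open>
  \<open>T\<close> preserves the joint eigenspace by the assumption \<open>inv\<close>, and \<open>T\<^sup>2 = \<sigma>(\<mu>) = c\<^sup>2\<close> on it.
\<close>

lemma T_eigenvector_untwisted:
  assumes v: "v \<in> V" "v \<noteq> 0" "C 0 v = 0" "E \<mu> v = v" "Z (xy 1 0) v = sc \<alpha> v" "Z (xy 0 1) v = sc \<beta> v"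
    and ab: "\<alpha> ^ 4 = 1" "\<beta> ^ 2 = 1" and \<mu>: "tri \<mu> = \<mu>" "c * c = sigma_t \<mu>"
    and inv: "\<And>g. lin_char \<alpha> \<beta> g = swap_sign \<mu> g * lin_char \<alpha> \<beta> (tri g)"
  obtains u d where "u \<in> V" "u \<noteq> 0" "C 0 u = 0" "E \<mu> u = u" "Z (xy 1 0) u = sc \<alpha> u" "Z (xy 0 1) u = sc \<beta> u"
    "T u = sc d u" "d = c \<or> d = - c"
proof -
  define S where "S = {v \<in> V. C 0 v = 0 \<and> E \<mu> v = v \<and> Z (xy 1 0) v = sc \<alpha> v \<and> Z (xy 0 1) v = sc \<beta> v}"
  have s: "subspace S"
    by (rule subspaceI) (auto simp: S_def subspace_0[OF subspace_V] zero add hom subspace_add[OF subspace_V]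
        subspace_scale[OF subspace_V] scale_right_distrib scale_left_commute)
  have e: "endo_on sc S T"
  proof -
    have "T u \<in> S" if "u \<in> S" for u
    proof -
      have u: "u \<in> V" "E \<mu> u = u" "C 0 u = 0" "Z (xy 1 0) u = sc \<alpha> u" "Z (xy 0 1) u = sc \<beta> u"
        using that by (auto simp: S_def)
      show ?thesis
        using u Z_T_weight[OF u ab, of "xy 1 0"] Z_T_weight[OF u ab, of "xy 0 1"]
          lin_char_xy[OF ab, of 1 0] lin_char_xy[OF ab, of 0 1]
        by (simp add: S_def mem C_T_vanish E_T_weight[OF u(1,2)] \<mu> inv[symmetric])
    qed
    then show ?thesis by (auto simp: endo_on_def S_def add hom)
  qed
  have "v \<in> S" using v by (simp add: S_def)
  moreover have "T (T v) = sc (c * c) v" using T_T_weight[OF v(1,4)] by (simp add: \<mu>)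
  ultimately obtain u d where "u \<in> S" "u \<noteq> 0" "T u = sc d u" "d = c \<or> d = - c"
    using square_eigenvector[OF s e _ v(2)] by blast
  then show ?thesis using that[of u d] by (auto simp: S_def)
qed

text \<open>
  \<open>C\<^sub>y\<close> and \<open>C\<^sub>x\<^sup>2\<close> commute with each other and with the \<open>E\<^sub>g\<close>, their indices having even \<open>x\<close>-exponent.
\<close>

lemma twisted_joint_eigenvector:
  assumes v: "v \<in> V" "v \<noteq> 0" "C 0 v = v" "E \<mu> v = v"
  obtains u a b where "u \<in> V" "u \<noteq> 0" "C 0 u = u" "E \<mu> u = u"
    "C (xy 0 1) u = sc b u" "C (xy 2 0) u = sc a u" "a \<in> {1, -1}" "b \<in> {1, -1}"
proof -
  define S0 where "S0 = {v \<in> V. C 0 v = sc 1 v}"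
  define S1 where "S1 = {v \<in> S0. E \<mu> v = sc 1 v}"
  have s0: "subspace S0" unfolding S0_def by (intro eigen_subspace subspace_V endo)
  have e0: "endo_on sc S0 (C g)" "endo_on sc S0 (E g)" for g
    unfolding S0_def by (intro eigen_endo endo; simp add: C0_commute)+
  have sub: "S0 \<subseteq> V" by (auto simp: S0_def)
  have s1: "subspace S1" unfolding S1_def by (intro eigen_subspace s0 e0)
  have e1: "endo_on sc S1 (C g)" if "even (xexp g)" for g
    unfolding S1_def using sub that by (intro eigen_endo e0) (auto simp: CE shift_tri)
  have v1: "v \<in> S1" using v by (simp add: S1_def S0_def)
  have in1: "u \<in> V \<and> C 0 u = u \<and> E \<mu> u = u" if "u \<in> S1" for u
    using that by (auto simp: S1_def S0_def)
  have ev: "even (xexp (xy 0 1))" "even (xexp (xy 2 0))" by (simp_all add: xexp_xy)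
  have yy: "xy 0 1 + xy 0 1 = 0" "xy 2 0 + xy 2 0 = 0"
    unfolding xy_add xy_0[symmetric] xy_eq_iff by simp_all
  have "C (xy 0 1) (C (xy 0 1) v) = sc (1 * 1) v"
    using in1[OF v1] by (simp add: CC yy tau_xy del: One_nat_def)
  from square_eigenvector[OF s1 e1[OF ev(1)] v1 v(2) this]
  obtain u b where u: "u \<in> S1" "u \<noteq> 0" "C (xy 0 1) u = sc b u" and b: "b = 1 \<or> b = -1" .
  define S2 where "S2 = {v \<in> S1. C (xy 0 1) v = sc b v}"
  have s2: "subspace S2" unfolding S2_def by (intro eigen_subspace s1 e1 ev)
  have e2: "endo_on sc S2 (C (xy 2 0))"
    unfolding S2_def using in1 by (intro eigen_endo e1 ev) (auto simp: CC add.commute tau_xy simp del: One_nat_def)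
  have u2: "u \<in> S2" using u by (simp add: S2_def)
  have "C (xy 2 0) (C (xy 2 0) u) = sc (1 * 1) u"
    using in1[OF u(1)] by (simp add: CC yy tau_xy)
  from square_eigenvector[OF s2 e2 u2 u(2) this]
  obtain w a where w: "w \<in> S2" "w \<noteq> 0" "C (xy 2 0) w = sc a w" and a: "a = 1 \<or> a = -1" .
  show ?thesis
    using that[of w b a] w a b in1 by (auto simp: S2_def)
qed

lemma T_eigenvector_twisted_even:
  assumes v: "v \<in> V" "v \<noteq> 0" "C 0 v = v" "E \<mu> v = v" "C (xy 0 1) v = sc b v" "C (xy 2 0) v = sc a v"
    and \<mu>: "\<mu> = xy m 0" "even m" "c * c = sigma_t \<mu>"
  obtains u d where "u \<in> V" "u \<noteq> 0" "C 0 u = u" "E \<mu> u = u" "C (xy 0 1) u = sc b u" "C (xy 2 0) u = sc a u"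
    "T u = sc d u" "d = c \<or> d = - c"
proof -
  define S where "S = {v \<in> V. C 0 v = v \<and> E \<mu> v = v \<and> C (xy 0 1) v = sc b v \<and> C (xy 2 0) v = sc a v}"
  have s: "subspace S"
    by (rule subspaceI) (auto simp: S_def subspace_0[OF subspace_V] zero add hom subspace_add[OF subspace_V]
        subspace_scale[OF subspace_V] scale_right_distrib scale_left_commute)
  have tri: "tri \<mu> = \<mu>" "tri (xy 0 1) = xy 0 1" "tri (xy 2 0) = xy 2 0"
    unfolding \<mu> tri_xy xy_eq_iff using \<mu>(2) by (simp_all add: even_iff_mod_2_eq_zero)
  have e: "endo_on sc S T"
  proof -
    have "T u \<in> S" if "u \<in> S" for u
    proof -
      have u: "u \<in> V" "E \<mu> u = u" "C 0 u = u" "C (xy 0 1) u = sc b u" "C (xy 2 0) u = sc a u"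
        using that by (auto simp: S_def)
      have "C (xy 0 1) (T u) = T (C (xy 0 1) u)" "C (xy 2 0) (T u) = T (C (xy 2 0) u)"
        using C_T_weight[OF u(1,2) refl, of "xy 0 1"] C_T_weight[OF u(1,2) refl, of "xy 2 0"] \<mu>(2)
        by (simp_all add: tri(2,3) tri(1)[unfolded \<mu>(1)] tau_xy \<mu>(1) del: One_nat_def)
      then show ?thesis
        using u by (simp add: S_def mem C0_commute hom E_T_weight[OF u(1,2)] tri(1) del: One_nat_def)
    qed
    then show ?thesis by (auto simp: endo_on_def S_def add hom)
  qed
  have "v \<in> S" using v by (simp add: S_def)
  moreover have "T (T v) = sc (c * c) v" using T_T_weight[OF v(1,4)] by (simp add: \<mu>)
  ultimately obtain u d where "u \<in> S" "u \<noteq> 0" "T u = sc d u" "d = c \<or> d = - c"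
    using square_eigenvector[OF s e _ v(2)] by blast
  then show ?thesis using that[of u d] by (auto simp: S_def)
qed

text \<open>
  For odd \<open>m\<close> it is \<open>R = C\<^sub>x T\<close> that preserves the joint eigenspace, and \<open>R\<^sup>2 = - a b \<sigma>(\<mu>)\<close> there.  From
  \<open>R u = d u\<close> and \<open>C\<^sub>x\<^sup>2 = a\<close> on \<open>T u\<close> follows \<open>T u = a d C\<^sub>x u\<close>.
\<close>

lemma T_eigenvector_twisted_odd:
  assumes v: "v \<in> V" "v \<noteq> 0" "C 0 v = v" "E \<mu> v = v" "C (xy 0 1) v = sc b v" "C (xy 2 0) v = sc a v"
    and ab: "a * a = 1" "b * b = 1"
    and \<mu>: "\<mu> = xy m 0" "odd m" "c * c = - (a * b * sigma_t \<mu>)"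
  obtains u d where "u \<in> V" "u \<noteq> 0" "C 0 u = u" "E \<mu> u = u" "C (xy 0 1) u = sc b u" "C (xy 2 0) u = sc a u"
    "T u = sc d (C (xy 1 0) u)" "d = c \<or> d = - c"
proof -
  define S where "S = {v \<in> V. C 0 v = v \<and> E \<mu> v = v \<and> C (xy 0 1) v = sc b v \<and> C (xy 2 0) v = sc a v}"
  have s: "subspace S"
    by (rule subspaceI) (auto simp: S_def subspace_0[OF subspace_V] zero add hom subspace_add[OF subspace_V]
        subspace_scale[OF subspace_V] scale_right_distrib scale_left_commute)
  have tri: "tri \<mu> = xy m 1" "tri (xy 0 1) = xy 0 1" "tri (xy 2 0) = xy 2 0" "tri (xy 1 1) = xy 1 0"
    unfolding \<mu> tri_xy xy_eq_iff using \<mu>(2) by (simp_all add: odd_iff_mod_2_eq_one)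
  have CT': "C (xy 0 1) (T u) = sc (- b) (T u)" "C (xy 2 0) (T u) = sc a (T u)" if "u \<in> S" for u
  proof -
    have u: "u \<in> V" "E \<mu> u = u" "C (xy 0 1) u = sc b u" "C (xy 2 0) u = sc a u"
      using that by (auto simp: S_def)
    show "C (xy 0 1) (T u) = sc (- b) (T u)" "C (xy 2 0) (T u) = sc a (T u)"
      using C_T_weight[OF u(1,2) refl, of "xy 0 1"] C_T_weight[OF u(1,2) refl, of "xy 2 0"] \<mu>(2)
      by (simp_all add: tri tau_xy u hom del: One_nat_def)
  qed
  have e: "endo_on sc S (\<lambda>u. C (xy 1 0) (T u))"
  proof -
    have "C (xy 1 0) (T u) \<in> S" if "u \<in> S" for u
    proof -
      have u: "u \<in> V" "E \<mu> u = u" "C 0 u = u"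
        using that by (auto simp: S_def)
      have "E (xy m 1) (T u) = T u" using E_T_weight[OF u(1,2), of "xy m 1"] by (simp add: tri)
      then have "E (xy m 1 + tri (xy 1 0) - xy 1 0) (C (xy 1 0) (T u)) = C (xy 1 0) (T u)"
        using u by (intro C_E_weight mem)
      moreover have "xy m 1 + tri (xy 1 0) - xy 1 0 = \<mu>"
        unfolding shift_tri \<mu> by (simp add: xexp_xy xy_add xy_eq_iff)
      ultimately have E: "E \<mu> (C (xy 1 0) (T u)) = C (xy 1 0) (T u)" by simp
      have "C (xy 0 1) (C (xy 1 0) (T u)) = sc (-1) (C (xy 1 0) (C (xy 0 1) (T u)))"
        "C (xy 2 0) (C (xy 1 0) (T u)) = C (xy 1 0) (C (xy 2 0) (T u))"
        using u by (simp_all add: CC mem tau_xy add.commute del: One_nat_def)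
      then have "C (xy 0 1) (C (xy 1 0) (T u)) = sc b (C (xy 1 0) (T u))"
        "C (xy 2 0) (C (xy 1 0) (T u)) = sc a (C (xy 1 0) (T u))"
        unfolding CT'[OF that] hom(4)[OF mem(2)[OF u(1)]] by simp_all
      with E show ?thesis using u by (simp add: S_def mem C0_commute)
    qed
    then show ?thesis by (auto simp: endo_on_def S_def add hom mem)
  qed
  have vS: "v \<in> S" using v by (simp add: S_def)
  have sq: "C (xy 1 0) (T (C (xy 1 0) (T v))) = sc (c * c) v"
  proof -
    have Tv: "T v \<in> V" "E (xy m 1) (T v) = T v" using E_T_weight[OF v(1,4), of "xy m 1"] v(1) by (simp_all add: tri mem)
    have sh: "xy m 1 + xy 1 1 - tri (xy 1 1) = \<mu>"
      using shift_tri[of "xy m 1" "xy 1 0"] unfolding tri \<mu>(1) by (simp add: tri_xy xexp_xy xy_add xy_eq_iff)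
    have "C (xy 1 1) (T (T v)) = sc (tau_t (xy m 1) (xy 1 1) * tau_t (xy 1 0) (xy m 1)) (T (C (xy 1 0) (T v)))"
      using C_T_weight[OF Tv, of "xy m 1" "xy 1 1"] unfolding sh unfolding tri by blast
    then have "T (C (xy 1 0) (T v)) = sc (- sigma_t \<mu>) (C (xy 1 1) v)"
      using T_T_weight[OF v(1,4)] v(1) by (simp add: tau_xy hom minus_equation_iff del: One_nat_def)
    then have "C (xy 1 0) (T (C (xy 1 0) (T v))) = sc (- sigma_t \<mu>) (C (xy 1 0) (C (xy 1 1) v))"
      using hom(4)[OF mem(4)[OF v(1)]] by (simp only:)
    also have "C (xy 1 0) (C (xy 1 1) v) = C (xy 2 0) (C (xy 0 1) v)"
      using v(1) by (simp add: CC tau_xy xy_add numeral_2_eq_2)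
    also have "\<dots> = sc (b * a) v" using v by (simp add: hom del: One_nat_def)
    finally show ?thesis by (simp add: \<mu>(3) mult_ac)
  qed
  obtain u d where u: "u \<in> S" "u \<noteq> 0" "C (xy 1 0) (T u) = sc d u" and d: "d = c \<or> d = - c"
    by (rule square_eigenvector[OF s e vS v(2) sq])
  have uV: "u \<in> V" using u by (simp add: S_def)
  have "sc a (T u) = C (xy 1 0) (C (xy 1 0) (T u))"
    using uV CT'(2)[OF u(1)] by (simp add: CC mem tau_xy xy_add numeral_2_eq_2)
  also have "\<dots> = sc d (C (xy 1 0) u)" using uV u(3) by (simp add: hom del: One_nat_def)
  finally have "sc (a * a) (T u) = sc (a * d) (C (xy 1 0) u)" by (metis scale_scale)
  then have T: "T u = sc (a * d) (C (xy 1 0) u)" by (simp add: ab)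
  have "a = 1 \<or> a = -1" using ab(1) by (simp add: square_eq_1_iff)
  then have "a * d = c \<or> a * d = - c" using d by auto
  then show ?thesis using that[of u "a * d"] u T by (auto simp: S_def)
qed

end

section \<open>The listed modules and their weight vectors\<close>

text \<open>
  The equations satisfied by the first basis vector of the listed module.  They determine the module: they
  fix the eigenvalue data of (S0)-(S4) and leave the second basis vector of a plane to be \<open>T v\<close> or \<open>C\<^sub>x v\<close>.
\<close>

fun weight_eqs :: "'k::field \<Rightarrow> ('k \<Rightarrow> 'v::ab_group_add \<Rightarrow> 'v) \<Rightarrow> (G \<Rightarrow> 'v \<Rightarrow> 'v) \<Rightarrow> ('v \<Rightarrow> 'v) \<Rightarrow>
    (G \<Rightarrow> 'v \<Rightarrow> 'v) \<Rightarrow> (G \<Rightarrow> 'v \<Rightarrow> 'v) \<Rightarrow> 'k label \<Rightarrow> 'v \<Rightarrow> bool" where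
  "weight_eqs \<xi> sc E T Z C (LV \<mu> i s) v \<longleftrightarrow> E \<mu> v = v \<and> C 0 v = 0 \<and>
     Z (xy 1 0) v = sc (\<xi> ^ i) v \<and> Z (xy 0 1) v = sc ((-1) ^ yexp \<mu>) v \<and>
     T v = sc (sign_val s * (if \<mu> \<in> {xy 0 0, xy 0 1} then 1 else \<xi>)) v"
| "weight_eqs \<xi> sc E T Z C (LW \<mu> i s) v \<longleftrightarrow> E \<mu> v = v \<and> C 0 v = 0 \<and>
     Z (xy 1 0) v = sc (sign_val s * \<xi> ^ i) v \<and> Z (xy 0 1) v = sc (- sign_val s) v"
| "weight_eqs \<xi> sc E T Z C (LX \<mu> i) v \<longleftrightarrow> E \<mu> v = v \<and> C 0 v = 0 \<and>
     Z (xy 1 0) v = sc (\<xi> ^ i) v \<and> Z (xy 0 1) v = sc (- ((-1) ^ yexp \<mu>)) v"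
| "weight_eqs \<xi> sc E T Z C (LY \<mu> a b l) v \<longleftrightarrow> E \<mu> v = v \<and> C 0 v = v \<and>
     C (xy 0 1) v = sc b v \<and> C (xy 2 0) v = sc a v \<and> T v = sc l (C (xy 1 0) v)"
| "weight_eqs \<xi> sc E T Z C (LZ \<mu> a b l) v \<longleftrightarrow> E \<mu> v = v \<and> C 0 v = v \<and>
     C (xy 0 1) v = sc b v \<and> C (xy 2 0) v = sc a v \<and> T v = sc l v"

definition weight_vector :: "'k::field \<Rightarrow> ('k \<Rightarrow> 'v::ab_group_add \<Rightarrow> 'v) \<Rightarrow> (G + G, 'k, 'v) yd \<Rightarrow> 'k label \<Rightarrow> 'v \<Rightarrow> bool" where
  "weight_vector \<xi> sc M l v \<longleftrightarrow> v \<in> vs M \<and> v \<noteq> 0 \<and>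
     weight_eqs \<xi> sc (\<lambda>g. act M (bas (Inl g))) (act M t_H)
       (\<lambda>g v. coact M v $ Inl g) (\<lambda>g v. coact M v $ Inr g) l v"

lemma swap_sign_char: "swap_sign q g = lin_char ((-1) ^ yexp q) ((-1) ^ xexp q) g"
  by (simp add: swap_sign_def tau_t_def lin_char_def flip: power_mult) (simp add: mult.commute)

lemma lin_char_tri: "\<alpha> ^ 4 = 1 \<Longrightarrow> \<beta> ^ 2 = 1 \<Longrightarrow> lin_char \<alpha> \<beta> (tri g) = lin_char (\<alpha> * \<beta>) \<beta> g"
  unfolding tri_def by (simp add: lin_char_xy power_add power_mult_distrib) (simp add: lin_char_def power_mult_distrib)

lemma lin_char_mult: "lin_char \<alpha> \<beta> g * lin_char \<gamma> \<delta> g = lin_char (\<alpha> * \<gamma>) (\<beta> * \<delta>) g"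
  by (simp add: lin_char_def power_mult_distrib mult_ac)

text \<open>
  The character of \<open>T v\<close> when \<open>v\<close> has the character \<open>lin_char \<alpha> \<beta>\<close>.
\<close>

lemma swapped_char: "\<alpha> ^ 4 = 1 \<Longrightarrow> \<beta> ^ 2 = 1 \<Longrightarrow> swap_sign q g * lin_char \<alpha> \<beta> (tri g) =
   lin_char ((-1) ^ yexp q * (\<alpha> * \<beta>)) ((-1) ^ xexp q * \<beta>) g"
  by (simp add: swap_sign_char lin_char_tri lin_char_mult)

lemma primitive_root_square:
  assumes "primitive_root_of_unity 4 (\<xi> :: 'k::field)"
  shows "\<xi> * \<xi> = -1"
proof -
  have "\<xi> ^ 4 = 1" "\<xi> ^ 2 \<noteq> 1" using assms by (auto simp: primitive_root_of_unity_def)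
  then have "(\<xi> ^ 2 - 1) * (\<xi> ^ 2 + 1) = 0" by (simp add: algebra_simps flip: power_add)
  with \<open>\<xi> ^ 2 \<noteq> 1\<close> show ?thesis by (simp add: power2_eq_square eq_neg_iff_add_eq_0)
qed

lemma even_elements: "\<mu> \<in> {xy 0 0, xy 0 1, xy 2 0, xy 2 1} \<Longrightarrow> even (xexp \<mu>) \<and> tri \<mu> = \<mu>"
  by (auto simp: xexp_xy tri_xy xy_eq_iff)

lemma sigma_values: "sigma_t (xy 0 j) = (1 :: 'k::field)" "sigma_t (xy 2 j) = (-1 :: 'k)" "sigma_t (xy 1 j) = (1 :: 'k)" "sigma_t (xy 3 j) = (-1 :: 'k)"
  by (simp_all add: sigma_t_def xexp_xy)

lemma labels_cases:
  fixes l :: "'k::field label"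
  assumes "l \<in> labels_S0 \<union> labels_dim2"
  obtains (V) \<mu> i s where "l = LV \<mu> i s" "\<mu> \<in> {xy 0 0, xy 0 1, xy 2 0, xy 2 1}" "i < 4"
    | (W) \<mu> i s where "l = LW \<mu> i s" "\<mu> \<in> {xy 1 0, xy 3 0}" "i < 4"
    | (X) \<mu> i where "l = LX \<mu> i" "\<mu> \<in> {xy 0 0, xy 0 1, xy 2 0, xy 2 1}" "i < 2"
    | (Y) \<mu> a b r where "l = LY \<mu> a b r" "a \<in> {1, -1}" "b \<in> {1, -1}" "\<mu> = xy 1 0 \<and> r ^ 2 = - (a * b) \<or> \<mu> = xy 3 0 \<and> r ^ 2 = a * b"
    | (Z) \<mu> a b r where "l = LZ \<mu> a b r" "a \<in> {1, -1}" "b \<in> {1, -1}" "\<mu> = xy 0 0 \<and> r ^ 2 = 1 \<or> \<mu> = xy 2 0 \<and> r ^ 2 = -1"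
  using assms unfolding labels_S0_def labels_dim2_def labels_S1_def labels_S2_def labels_S3_def labels_S4_def
  by blast

lemma labels_memI:
  "\<mu> \<in> {xy 0 0, xy 0 1, xy 2 0, xy 2 1} \<Longrightarrow> i < 4 \<Longrightarrow> LV \<mu> i s \<in> labels_S0 \<union> labels_dim2"
  "\<mu> \<in> {xy 1 0, xy 3 0} \<Longrightarrow> i < 4 \<Longrightarrow> LW \<mu> i s \<in> labels_S0 \<union> labels_dim2"
  "\<mu> \<in> {xy 0 0, xy 0 1, xy 2 0, xy 2 1} \<Longrightarrow> i < 2 \<Longrightarrow> LX \<mu> i \<in> labels_S0 \<union> labels_dim2"
  "a \<in> {1, -1} \<Longrightarrow> b \<in> {1, -1} \<Longrightarrow> \<mu> = xy 1 0 \<and> r ^ 2 = - (a * b) \<or> \<mu> = xy 3 0 \<and> r ^ 2 = a * b \<Longrightarrow>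
     LY \<mu> a b r \<in> labels_S0 \<union> labels_dim2"
  "a \<in> {1, -1} \<Longrightarrow> b \<in> {1, -1} \<Longrightarrow> \<mu> = xy 0 0 \<and> r ^ 2 = 1 \<or> \<mu> = xy 2 0 \<and> r ^ 2 = -1 \<Longrightarrow>
     LZ \<mu> a b r \<in> labels_S0 \<union> labels_dim2"
  unfolding labels_S0_def labels_dim2_def labels_S1_def labels_S2_def labels_S3_def labels_S4_def by blast+

context
  fixes \<xi> :: "'k::field" 
  assumes \<xi>: "\<xi> * \<xi> = -1" and char_ne_2: "(1 :: 'k) \<noteq> -1"
begin

lemma root_power4: "(\<xi> ^ i) ^ 4 = 1"
proof -
  have "\<xi> ^ 4 = (\<xi> * \<xi>) * (\<xi> * \<xi>)" by (simp add: power4_eq_xxxx mult_ac)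
  then have "\<xi> ^ 4 = 1" using \<xi> by simp
  then show ?thesis by (metis power_mult mult.commute power_one)
qed

lemma mod_V_eq: "mod_V \<xi> \<mu> i s = scalar_yd \<mu> (\<xi> ^ i) ((-1) ^ yexp \<mu>) (sign_val s * (if \<mu> \<in> {xy 0 0, xy 0 1} then 1 else \<xi>))"
  by (simp add: mod_V_def scalar_yd_def lin_char_def power_mult)

lemma mod_V_conditions:
  assumes "\<mu> \<in> {xy 0 0, xy 0 1, xy 2 0, xy 2 1}"
  shows "(\<xi> ^ i) ^ 4 = 1" "((-1 :: 'k) ^ yexp \<mu>) ^ 2 = 1"
    "(sign_val s * (if \<mu> \<in> {xy 0 0, xy 0 1} then 1 else \<xi>)) * (sign_val s * (if \<mu> \<in> {xy 0 0, xy 0 1} then 1 else \<xi>)) = sigma_t \<mu>"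
    "tri \<mu> = \<mu>"
    "lin_char (\<xi> ^ i) ((-1) ^ yexp \<mu>) g = swap_sign \<mu> g * lin_char (\<xi> ^ i) ((-1) ^ yexp \<mu>) (tri g)"
proof -
  show 1: "(\<xi> ^ i) ^ 4 = 1" "((-1 :: 'k) ^ yexp \<mu>) ^ 2 = 1" by (rule root_power4) (simp flip: power_mult)
  show "(sign_val s * (if \<mu> \<in> {xy 0 0, xy 0 1} then 1 else \<xi>)) * (sign_val s * (if \<mu> \<in> {xy 0 0, xy 0 1} then 1 else \<xi>)) = sigma_t \<mu>"
    using assms \<xi> by (cases s) (auto simp: sigma_values xy_eq_iff)
  show "tri \<mu> = \<mu>" using even_elements[OF assms] by simp
  have e: "(-1 :: 'k) ^ yexp \<mu> * (x * (-1) ^ yexp \<mu>) = x" for x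
    by (simp add: mult.left_commute flip: power_mult_distrib)
  show "lin_char (\<xi> ^ i) ((-1) ^ yexp \<mu>) g = swap_sign \<mu> g * lin_char (\<xi> ^ i) ((-1) ^ yexp \<mu>) (tri g)"
    using even_elements[OF assms] by (simp add: swapped_char[OF 1] e)
qed

lemma mod_W_eq:
  assumes "\<mu> \<in> {xy 1 0, xy 3 0}"
  shows "mod_W \<xi> \<mu> i s = induced_yd \<mu> (sign_val s * \<xi> ^ i) (- sign_val s)"
proof -
  have ab: "(sign_val s * \<xi> ^ i) ^ 4 = 1" "(- sign_val s :: 'k) ^ 2 = 1"
    by (cases s; simp add: root_power4)+
  have t: "tri \<mu> = \<mu> + xy 0 1" "yexp (tri \<mu>) = 1" "odd (xexp (tri \<mu>))" "sigma_t \<mu> = (if \<mu> = xy 1 0 then 1 else -1 :: 'k)"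
    using assms by (auto simp: tri_xy xy_add xy_eq_iff yexp_xy xexp_xy sigma_values sigma_values(3)[unfolded One_nat_def])
  have sq: "sign_val s * sign_val s = (1 :: 'k)" by (cases s) auto
  have Z: "(case s of Plus \<Rightarrow> pows (diag (\<xi> ^ i) (\<xi> ^ i)) (diag (-1) 1)
              | Minus \<Rightarrow> pows (diag (- (\<xi> ^ i)) (\<xi> ^ i)) (diag 1 (-1))) =
    (\<lambda>g. diag (lin_char (sign_val s * \<xi> ^ i) (- sign_val s) g) (swap_sign (tri \<mu>) g * lin_char (sign_val s * \<xi> ^ i) (- sign_val s) (tri g)))"
    unfolding swapped_char[OF ab] using t by (cases s) (simp_all add: pows_diag fun_eq_iff)
  show ?thesis unfolding mod_W_def induced_yd_def Z t(1,4) ..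
qed

lemma mod_W_conditions:
  assumes "\<mu> \<in> {xy 1 0, xy 3 0}"
  shows "(sign_val s * \<xi> ^ i) ^ 4 = 1" "(- sign_val s :: 'k) ^ 2 = 1" "tri \<mu> \<noteq> \<mu>"
  using assms by (cases s; auto simp: root_power4 tri_xy xy_eq_iff)+

lemma mod_X_eq:
  assumes "\<mu> \<in> {xy 0 0, xy 0 1, xy 2 0, xy 2 1}"
  shows "mod_X \<xi> \<mu> i = induced_yd \<mu> (\<xi> ^ i) (- ((-1) ^ yexp \<mu>))"
proof -
  have ab: "(\<xi> ^ i) ^ 4 = 1" "(- ((-1 :: 'k) ^ yexp \<mu>)) ^ 2 = 1" by (rule root_power4) (simp flip: power_mult)
  have t: "tri \<mu> = \<mu>" "even (xexp \<mu>)" using even_elements[OF assms] by auto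
  have e: "(-1 :: 'k) ^ yexp \<mu> * (x * (-1) ^ yexp \<mu>) = x" for x
    by (simp add: mult.left_commute flip: power_mult_distrib)
  have d: "(if \<mu> \<in> {xy 0 0, xy 2 0} then diag (-1) (-1) else diag 1 1) = diag (- ((-1) ^ yexp \<mu>)) (- ((-1 :: 'k) ^ yexp \<mu>))"
    using assms by (auto simp: yexp_xy xy_eq_iff)
  have Z: "pows (diag (\<xi> ^ i) (- (\<xi> ^ i))) (if \<mu> \<in> {xy 0 0, xy 2 0} then diag (-1) (-1) else diag 1 1) = 
    (\<lambda>g. diag (lin_char (\<xi> ^ i) (- ((-1) ^ yexp \<mu>)) g) (swap_sign (tri \<mu>) g * lin_char (\<xi> ^ i) (- ((-1) ^ yexp \<mu>)) (tri g)))"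
    unfolding swapped_char[OF ab] t(1) d using t(2) by (intro ext) (simp add: pows_diag e)
  have E: "(\<lambda>g u. of_bool (g = \<mu>) *s u) = (\<lambda>g. diag (of_bool (g = \<mu>)) (of_bool (g = tri \<mu>)) :: 'k ^ 2 \<Rightarrow> _)"
    by (simp add: fun_eq_iff vec2_eq t(1))
  have "(if \<mu> \<in> {xy 0 0, xy 0 1} then 1 else -1) = (sigma_t \<mu> :: 'k)"
    using assms by (auto simp: sigma_values xy_eq_iff)
  then show ?thesis unfolding mod_X_def induced_yd_def Z E by simp
qed

lemma mod_X_conditions:
  assumes "\<mu> \<in> {xy 0 0, xy 0 1, xy 2 0, xy 2 1}"
  shows "(\<xi> ^ i) ^ 4 = 1" "(- ((-1 :: 'k) ^ yexp \<mu>)) ^ 2 = 1" "swap_sign \<mu> (xy 1 0) * (- ((-1 :: 'k) ^ yexp \<mu>)) \<noteq> 1"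
proof -
  show "(\<xi> ^ i) ^ 4 = 1" "(- ((-1 :: 'k) ^ yexp \<mu>)) ^ 2 = 1" by (rule root_power4) (simp flip: power_mult)
  have "swap_sign \<mu> (xy 1 0) = ((-1) ^ yexp \<mu> :: 'k)"
    by (simp add: swap_sign_def tau_t_def xexp_xy yexp_xy)
  then show "swap_sign \<mu> (xy 1 0) * (- ((-1 :: 'k) ^ yexp \<mu>)) \<noteq> 1"
    using char_ne_2 by (simp flip: power_mult_distrib)
qed

lemma mod_Y_eq: "mod_Y \<mu> a b l = twisted_yd \<mu> a b (adiag l (- (a * b * l)))"
  and mod_Z_eq: "mod_Z \<mu> a b l = twisted_yd \<mu> a b (diag l (- (b * l)))"
  by (simp_all add: mod_Y_def mod_Z_def twisted_yd_def pows_adiag)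

lemma mod_Y_conditions:
  fixes a b l :: 'k
  assumes "a \<in> {1, -1}" "b \<in> {1, -1}" "\<mu> = xy 1 0 \<and> l ^ 2 = - (a * b) \<or> \<mu> = xy 3 0 \<and> l ^ 2 = (a * b :: 'k)"
  shows "a * a = 1" "b * b = 1" "yexp \<mu> = 0" "odd (xexp \<mu>)" "- (a * b * l * l) = sigma_t \<mu>"
proof -
  show ab: "a * a = 1" "b * b = 1" using assms by auto
  have "a * b * l * l = (a * b) * l ^ 2" by (simp add: power2_eq_square mult_ac)
  moreover have "(a * b) * (a * b) = (a * a) * (b * b)" by (simp only: mult_ac)
  then have "(a * b) * (a * b) = 1" using ab by simp
  ultimately have "l ^ 2 = - (a * b) \<Longrightarrow> - (a * b * l * l) = 1" "l ^ 2 = a * b \<Longrightarrow> - (a * b * l * l) = -1"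
    by (simp_all only: mult_minus_right minus_minus)
  then show "- (a * b * l * l) = sigma_t \<mu>" using assms(3) sigma_values(3)[of 0, where 'k='k] sigma_values(4)[of 0, where 'k='k] by metis
  show "yexp \<mu> = 0" "odd (xexp \<mu>)" using assms(3) by (auto simp: xexp_xy yexp_xy)
qed

lemma mod_Z_conditions:
  fixes a b l :: 'k
  assumes "a \<in> {1, -1}" "b \<in> {1, -1}" "\<mu> = xy 0 0 \<and> l ^ 2 = 1 \<or> \<mu> = xy 2 0 \<and> l ^ 2 = (-1 :: 'k)"
  shows "a * a = 1" "b * b = 1" "yexp \<mu> = 0" "even (xexp \<mu>)" "l * l = sigma_t \<mu>"
  using assms by (auto simp: xexp_xy yexp_xy sigma_values power2_eq_square)

text \<open>
  (S0) are scalar modules, (S1) and (S2) are induced modules that are separated by \<open>E\<close> and by \<open>Z\<close>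
  respectively, (S3) and (S4) are twisted modules.
\<close>

lemma listed_simple:
  assumes "l \<in> labels_S0 \<union> labels_dim2"
  shows "simple_yd_module Hc (*s) (listed \<xi> l)"
proof -
  from assms show ?thesis
  proof (cases rule: labels_cases)
    case (V \<mu> i s)
    then show ?thesis using simple_scalar[OF mod_V_conditions[OF V(2)]] by (simp add: mod_V_eq)
  next
    case (W \<mu> i s)
    then show ?thesis using simple_induced[OF mod_W_conditions(1,2)[OF W(2)] disjI1[OF mod_W_conditions(3)[OF W(2)]]]
      by (simp add: mod_W_eq[OF W(2)])
  next
    case (X \<mu> i)
    then show ?thesis using simple_induced[OF mod_X_conditions(1,2)[OF X(2)] disjI2[OF mod_X_conditions(3)[OF X(2)]]]
      by (simp add: mod_X_eq[OF X(2)])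
  next
    case (Y \<mu> a b r)
    note c = mod_Y_conditions[OF Y(2-4)]
    show ?thesis unfolding Y(1) listed.simps mod_Y_eq
      by (rule simple_twisted[OF c(1,2) _ c(3), where l=r]) (intro disjI1 conjI refl c)
  next
    case (Z \<mu> a b r)
    note c = mod_Z_conditions[OF Z(2-4)]
    show ?thesis unfolding Z(1) listed.simps mod_Z_eq
      by (rule simple_twisted[OF c(1,2) _ c(3), where l=r]) (intro disjI2 conjI refl c)
  qed
qed

text \<open>
  The second basis vector goes to \<open>0\<close> for (S0), where it lies outside the module, to \<open>T v\<close> for (S1) and (S2),
  and to \<open>C\<^sub>x v\<close> for (S3) and (S4).
\<close>

lemma weight_vector_hom:
  assumes l: "l \<in> labels_S0 \<union> labels_dim2" and M: "yd_module Hc sc M" and v: "weight_vector \<xi> sc M l v"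
  shows "\<exists>w. yd_hom (*s) sc (listed \<xi> l) M (\<lambda>u. sc (u $ 1) v + sc (u $ 2) w)"
proof -
  from l show ?thesis
  proof (cases rule: labels_cases)
    case (V \<mu> i s)
    note w = v[unfolded V weight_vector_def weight_eqs.simps]
    show ?thesis unfolding V(1) listed.simps mod_V_eq
      by (intro exI[of _ 0] yd_hom_scalar M mod_V_conditions[OF V(2)]) (use w in blast)+
  next
    case (W \<mu> i s)
    note w = v[unfolded W weight_vector_def weight_eqs.simps]
    show ?thesis unfolding W(1) listed.simps mod_W_eq[OF W(2)]
      by (rule exI, rule yd_hom_induced[OF M _ _ _ _ _ mod_W_conditions(1,2)[OF W(2)]]) (use w in blast)+
  next
    case (X \<mu> i)
    note w = v[unfolded X weight_vector_def weight_eqs.simps]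
    show ?thesis unfolding X(1) listed.simps mod_X_eq[OF X(2)]
      by (rule exI, rule yd_hom_induced[OF M _ _ _ _ _ mod_X_conditions(1,2)[OF X(2)]]) (use w in blast)+
  next
    case (Y \<mu> a b r)
    note w = v[unfolded Y(1) weight_vector_def weight_eqs.simps]
    note c = mod_Y_conditions[OF Y(2-4)]
    show ?thesis unfolding Y(1) listed.simps mod_Y_eq
      by (rule exI, rule yd_hom_twisted[OF M _ _ _ _ _ c(1,2) _ c(3), where l=r], (use w in blast)+)
        (intro disjI1 conjI refl c; use w in blast)
  next
    case (Z \<mu> a b r)
    note w = v[unfolded Z(1) weight_vector_def weight_eqs.simps]
    note c = mod_Z_conditions[OF Z(2-4)]
    show ?thesis unfolding Z(1) listed.simps mod_Z_eq
      by (rule exI, rule yd_hom_twisted[OF M _ _ _ _ _ c(1,2) _ c(3), where l=r], (use w in blast)+)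
        (intro disjI2 conjI refl c; use w in blast)
  qed
qed

end

section \<open>Every module contains a weight vector\<close>

context
  fixes \<xi> :: "'k::field" 
  assumes \<xi>: "\<xi> * \<xi> = -1" and char_ne_2: "(1 :: 'k) \<noteq> -1"
begin

lemma root_values: "{1, -1, \<xi>, -\<xi>} = (\<lambda>i. \<xi> ^ i) ` {..<4}"
proof -
  have "{..<4::nat} = {0, 1, 2, 3}" by auto
  moreover have "\<xi> ^ 2 = -1" "\<xi> ^ 3 = - \<xi>" using \<xi> by (simp_all add: power2_eq_square power3_eq_cube mult.assoc)
  ultimately show ?thesis by auto
qed

lemma root_power_inj: "i < 4 \<Longrightarrow> j < 4 \<Longrightarrow> \<xi> ^ i = \<xi> ^ j \<Longrightarrow> i = j"
proof -
  have "\<xi> \<noteq> 1" "\<xi> \<noteq> -1" "\<xi> \<noteq> 0" using \<xi> char_ne_2 by auto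
  then have d: "distinct [1, \<xi>, -1, - \<xi>]" using char_ne_2 \<xi> by (auto simp: equation_minus_iff[of 1] eq_neg_iff_add_eq_0 add.commute)
  have "\<xi> ^ 2 = -1" "\<xi> ^ 3 = - \<xi>" using \<xi> by (simp_all add: power2_eq_square power3_eq_cube mult.assoc)
  then have p: "\<xi> ^ i = [1, \<xi>, -1, - \<xi>] ! i" if "i < 4" for i
    using that by (auto simp: less_Suc_eq numeral_eq_Suc)
  assume "i < 4" "j < 4" "\<xi> ^ i = \<xi> ^ j"
  then show "i = j" using p d nth_eq_iff_index_eq[OF d] by simp
qed

text \<open>
  A nonzero \<open>v\<close> with \<open>C\<^sub>0 v = 0\<close> leads to a label of (S0)-(S2); otherwise \<open>C\<^sub>0 v\<close> leads to a label of (S3) or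
  (S4).  In both cases the eigenvalue \<open>\<mu>\<close> of \<open>E\<close> is first moved into the range of the list, by \<open>T\<close> in the former
  case and by \<open>C\<^sub>x\<close> in the latter, and then a joint eigenvector is taken.
\<close>

lemma exists_weight_vector:
  assumes M: "yd_module Hc sc M" and nz: "vs M \<noteq> {0}"
  shows "\<exists>l\<in>labels_S0 \<union> labels_dim2. \<exists>v. weight_vector \<xi> sc M l v"
proof -
  let ?E = "\<lambda>g. act M (bas (Inl g))" and ?T = "act M t_H"
  let ?Z = "\<lambda>g v. coact M v $ Inl g" and ?C = "\<lambda>g v. coact M v $ Inr g"
  interpret R: double_rep sc "vs M" ?E ?T ?Z ?C by (rule double_rep_of_yd_module[OF M])
  obtain v where v: "v \<in> vs M" "v \<noteq> 0" using nz R.subspace_0[OF R.subspace_V] by blast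
  have parity_cases: "\<mu> \<in> {xy 0 0, xy 0 1, xy 2 0, xy 2 1} \<or> \<mu> \<in> {xy 1 0, xy 3 0} \<or> \<mu> \<in> {xy 1 1, xy 3 1}" for \<mu>
    by (cases \<mu> rule: xy_cases) auto
  show ?thesis
  proof (cases "?C 0 v = 0")
    case True
    obtain \<mu> where \<mu>: "?E \<mu> v \<noteq> 0" using R.exists_E_weight[OF v] by blast
    define u where "u = ?E \<mu> v"
    have u: "u \<in> vs M" "u \<noteq> 0" "?C 0 u = 0" "?E \<mu> u = u"
      using \<mu> v True by (simp_all add: u_def R.mem R.EE R.C0_commute R.zero)
    have Tu: "?T u \<in> vs M" "?T u \<noteq> 0" "?C 0 (?T u) = 0" "?E (tri \<mu>) (?T u) = ?T u"
      using u R.T_nonzero[OF u(1,4,2)] by (simp_all add: R.mem R.C0_commute R.zero R.E_T_weight[OF u(1,4)])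
    have "\<exists>\<mu> u. \<mu> \<in> {xy 0 0, xy 0 1, xy 2 0, xy 2 1} \<union> {xy 1 0, xy 3 0} \<and> u \<in> vs M \<and> u \<noteq> 0 \<and> ?C 0 u = 0 \<and> ?E \<mu> u = u"
    proof (cases "\<mu> \<in> {xy 1 1, xy 3 1}")
      case True
      then have "tri \<mu> \<in> {xy 1 0, xy 3 0}" by (auto simp: tri_xy xy_eq_iff)
      then show ?thesis using Tu by blast
    next
      case False
      then show ?thesis using u parity_cases[of \<mu>] by blast
    qed
    then obtain \<mu> u where \<mu>: "\<mu> \<in> {xy 0 0, xy 0 1, xy 2 0, xy 2 1} \<or> \<mu> \<in> {xy 1 0, xy 3 0}"
      and u: "u \<in> vs M" "u \<noteq> 0" "?C 0 u = 0" "?E \<mu> u = u" by blast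
    obtain w \<alpha> \<beta> where w: "w \<in> vs M" "w \<noteq> 0" "?C 0 w = 0" "?E \<mu> w = w"
      "?Z (xy 1 0) w = sc \<alpha> w" "?Z (xy 0 1) w = sc \<beta> w" and ab: "\<alpha> \<in> {1, -1, \<xi>, -\<xi>}" "\<beta> \<in> {1, -1}"
      by (rule R.untwisted_joint_eigenvector[OF \<xi> u])
    from ab(1) obtain i where i: "i < 4" "\<alpha> = \<xi> ^ i" unfolding root_values by blast
    from \<mu> show ?thesis
    proof
      assume \<mu>: "\<mu> \<in> {xy 1 0, xy 3 0}"
      \<comment> \<open>the sign in the label is minus the eigenvalue of \<open>Z\<^sub>y\<close>, and it enters the eigenvalue of \<open>Z\<^sub>x\<close> as well\<close>
      obtain s where s: "\<beta> = - sign_val s" using ab(2) sign_val.simps by (metis insertE minus_minus singletonD)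
      have "sign_val s * \<alpha> \<in> {1, -1, \<xi>, -\<xi>}" using ab(1) by (cases s) auto
      then obtain j where j: "j < 4" "sign_val s * \<alpha> = \<xi> ^ j" unfolding root_values by blast
      have "\<alpha> = sign_val s * (sign_val s * \<alpha>)" by (cases s) auto
      then have "\<alpha> = sign_val s * \<xi> ^ j" by (simp only: j(2))
      then have "weight_vector \<xi> sc M (LW \<mu> j s) w" using w s by (simp add: weight_vector_def)
      moreover have "LW \<mu> j s \<in> labels_S0 \<union> labels_dim2" by (rule labels_memI(2)[OF \<mu> j(1)])
      ultimately show ?thesis by blast
    next
      assume \<mu>: "\<mu> \<in> {xy 0 0, xy 0 1, xy 2 0, xy 2 1}"
      have tri: "tri \<mu> = \<mu>" "even (xexp \<mu>)" using even_elements[OF \<mu>] by auto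
      have pm: "(-1) ^ yexp \<mu> \<in> {1, -1 :: 'k}" by (auto simp: minus_one_power_iff)
      then consider "\<beta> = (-1) ^ yexp \<mu>" | "\<beta> = - ((-1) ^ yexp \<mu>)" using ab(2) by auto
      then show ?thesis
      proof cases
        case 1
        note V = mod_V_conditions[OF \<xi> char_ne_2 \<mu>]
        have c: "\<alpha> ^ 4 = 1" "\<beta> ^ 2 = 1" "\<And>g. lin_char \<alpha> \<beta> g = swap_sign \<mu> g * lin_char \<alpha> \<beta> (tri g)"
          unfolding i(2) 1 by (rule V(1) V(2) V(5))+
        obtain x d where x: "x \<in> vs M" "x \<noteq> 0" "?C 0 x = 0" "?E \<mu> x = x" "?Z (xy 1 0) x = sc \<alpha> x" "?Z (xy 0 1) x = sc \<beta> x"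
          "?T x = sc d x" and d: "d = sign_val Plus * (if \<mu> \<in> {xy 0 0, xy 0 1} then 1 else \<xi>) \<or> 
            d = - (sign_val Plus * (if \<mu> \<in> {xy 0 0, xy 0 1} then 1 else \<xi>))"
          by (rule R.T_eigenvector_untwisted[OF w c(1,2) tri(1) V(3) c(3)])
        obtain s where "d = sign_val s * (if \<mu> \<in> {xy 0 0, xy 0 1} then 1 else \<xi>)"
          using d sign_val.simps by (metis mult_minus1 mult_1)
        then have "weight_vector \<xi> sc M (LV \<mu> i s) x" using x i 1 by (simp add: weight_vector_def)
        moreover have "LV \<mu> i s \<in> labels_S0 \<union> labels_dim2" by (rule labels_memI(1)[OF \<mu> i(1)])
        ultimately show ?thesis by blast
      next
        case 2
        \<comment> \<open>\<open>T\<close> changes the sign of \<open>\<alpha>\<close>, so \<open>\<alpha>\<close> may be assumed to be \<open>1\<close> or \<open>\<xi>\<close>\<close>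
        have "\<exists>j x. j < 2 \<and> x \<in> vs M \<and> x \<noteq> 0 \<and> ?C 0 x = 0 \<and> ?E \<mu> x = x \<and> ?Z (xy 1 0) x = sc (\<xi> ^ j) x \<and> ?Z (xy 0 1) x = sc \<beta> x"
        proof (cases "\<alpha> \<in> {1, \<xi>}")
          case True
          then obtain j where "j < 2" "\<alpha> = \<xi> ^ j" 
            by (metis insertE singletonD power_0 power_one_right one_less_numeral_iff semiring_norm(76) zero_less_numeral)
          then show ?thesis using w by blast
        next
          case False
          then have "- \<alpha> \<in> {1, \<xi>}" using ab by auto
          then obtain j where j: "j < 2" "- \<alpha> = \<xi> ^ j" 
            by (metis insertE singletonD power_0 power_one_right one_less_numeral_iff semiring_norm(76) zero_less_numeral)
          have c: "\<alpha> ^ 4 = 1" "\<beta> ^ 2 = 1" using root_power4[OF \<xi> char_ne_2, of i] i ab(2) by auto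
          note Z = R.Z_T_weight[OF w(1,4,3,5,6) c, unfolded swapped_char[OF c] tri]
          have "(-1) ^ yexp \<mu> * (\<alpha> * \<beta>) = - \<alpha>"
            unfolding 2 by (simp add: mult.left_commute flip: power_mult_distrib)
          then have "?Z (xy 1 0) (?T w) = sc (\<xi> ^ j) (?T w)" "?Z (xy 0 1) (?T w) = sc \<beta> (?T w)"
            using Z[of "xy 1 0"] Z[of "xy 0 1"] tri(2) j(2) by (simp_all add: lin_char_def xexp_xy yexp_xy)
          moreover have "?T w \<in> vs M" "?T w \<noteq> 0" "?C 0 (?T w) = 0" "?E \<mu> (?T w) = ?T w"
            using w R.T_nonzero[OF w(1,4,2)] by (simp_all add: R.mem R.C0_commute R.zero R.E_T_weight[OF w(1,4)] tri)
          ultimately show ?thesis using j(1) by blast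
        qed
        then obtain j x where "j < 2" and x: "x \<in> vs M" "x \<noteq> 0" "?C 0 x = 0" "?E \<mu> x = x" "?Z (xy 1 0) x = sc (\<xi> ^ j) x" "?Z (xy 0 1) x = sc \<beta> x"
          by blast
        from x 2 have "weight_vector \<xi> sc M (LX \<mu> j) x" by (simp add: weight_vector_def)
        moreover have "LX \<mu> j \<in> labels_S0 \<union> labels_dim2" by (rule labels_memI(3)[OF \<mu> \<open>j < 2\<close>])
        ultimately show ?thesis by blast
      qed
    qed
  next
    case False
    define v' where "v' = ?C 0 v"
    have v': "v' \<in> vs M" "v' \<noteq> 0" "?C 0 v' = v'" using False v by (simp_all add: v'_def R.mem R.C0_commute)
    obtain \<mu> where \<mu>: "?E \<mu> v' \<noteq> 0" using R.exists_E_weight[OF v'(1,2)] by blast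
    define u where "u = ?E \<mu> v'"
    have u: "u \<in> vs M" "u \<noteq> 0" "?C 0 u = u" "?E \<mu> u = u"
      using \<mu> v' by (simp_all add: u_def R.mem R.EE R.C0_commute)
    have "\<exists>m u. m < 4 \<and> u \<in> vs M \<and> u \<noteq> 0 \<and> ?C 0 u = u \<and> ?E (xy m 0) u = u"
    proof (cases "yexp \<mu> = 0")
      case True
      then show ?thesis using u xexp_lt[of \<mu>] xy_exp[of \<mu>] by metis
    next
      case False
      then have "yexp \<mu> = 1" using yexp_lt[of \<mu>] by linarith
      then have "\<mu> = xy (xexp \<mu>) 1" using xy_exp[of \<mu>] by (simp only:)
      moreover have "xy (xexp \<mu>) 1 + tri (xy 1 0) - xy 1 0 = xy (xexp \<mu>) 0"
        unfolding shift_tri by (simp add: xexp_xy xy_add xy_eq_iff)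
      ultimately have "?E (xy (xexp \<mu>) 0) (?C (xy 1 0) u) = ?C (xy 1 0) u"
        using R.C_E_weight[OF u(1,4), of "xy 1 0"] by simp
      moreover have "?C (xy 1 0) u \<in> vs M" "?C 0 (?C (xy 1 0) u) = ?C (xy 1 0) u" using u by (simp_all add: R.mem R.C0_commute)
      moreover have "?C (xy 1 0) u \<noteq> 0"
      proof
        assume 0: "?C (xy 1 0) u = 0"
        have "xy 3 0 + xy 1 0 = 0" unfolding xy_add xy_0[symmetric] xy_eq_iff by simp
        then have "?C (xy 3 0) (?C (xy 1 0) u) = u" by (simp add: R.CC[OF u(1)] u(3) tau_xy del: One_nat_def)
        then show False using 0 u(2) R.zero by simp
      qed
      ultimately show ?thesis using xexp_lt[of \<mu>] by blast
    qed
    then obtain m u where m: "m < 4" and u: "u \<in> vs M" "u \<noteq> 0" "?C 0 u = u" "?E (xy m 0) u = u" by blast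
    obtain w a b where w: "w \<in> vs M" "w \<noteq> 0" "?C 0 w = w" "?E (xy m 0) w = w"
      "?C (xy 0 1) w = sc b w" "?C (xy 2 0) w = sc a w" and ab: "a \<in> {1, -1}" "b \<in> {1, -1}"
      by (rule R.twisted_joint_eigenvector[OF u])
    have ab1: "a * a = 1" "b * b = 1" using ab by auto
    have sqrt: "\<exists>c. c * c = r" if "r \<in> {1, -1}" for r :: 'k using that \<xi> by (metis insertE singletonD mult_1)
    show ?thesis
    proof (cases "even m")
      case True
      then have m': "m = 0 \<or> m = 2" using m by presburger
      have "sigma_t (xy m 0) \<in> {1, -1 :: 'k}" using m' by (auto simp: sigma_values)
      then obtain c :: 'k where c: "c * c = sigma_t (xy m 0)" using sqrt by blast
      obtain x d where x: "x \<in> vs M" "x \<noteq> 0" "?C 0 x = x" "?E (xy m 0) x = x" "?C (xy 0 1) x = sc b x" "?C (xy 2 0) x = sc a x"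
        "?T x = sc d x" and d: "d = c \<or> d = - c"
        by (rule R.T_eigenvector_twisted_even[OF w refl True c])
      have "d ^ 2 = sigma_t (xy m 0)" using c d by (auto simp: power2_eq_square)
      then have "LZ (xy m 0) a b d \<in> labels_S0 \<union> labels_dim2" using m' sigma_values(1,2)[of 0, where 'k='k] by (intro labels_memI(5) ab) auto
      moreover have "weight_vector \<xi> sc M (LZ (xy m 0) a b d) x" using x by (simp add: weight_vector_def)
      ultimately show ?thesis by blast
    next
      case False
      then have m': "m = 1 \<or> m = 3" using m by presburger
      have "- (a * b * sigma_t (xy m 0)) \<in> {1, -1 :: 'k}" using m' ab sigma_values(3,4)[of 0, where 'k='k] by auto
      then obtain c :: 'k where c: "c * c = - (a * b * sigma_t (xy m 0))" using sqrt by blast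
      obtain x d where x: "x \<in> vs M" "x \<noteq> 0" "?C 0 x = x" "?E (xy m 0) x = x" "?C (xy 0 1) x = sc b x" "?C (xy 2 0) x = sc a x"
        "?T x = sc d (?C (xy 1 0) x)" and d: "d = c \<or> d = - c"
        by (rule R.T_eigenvector_twisted_odd[OF w ab1 refl False c])
      have "d ^ 2 = - (a * b * sigma_t (xy m 0))" using c d by (auto simp: power2_eq_square)
      then have "m = 1 \<and> d ^ 2 = - (a * b) \<or> m = 3 \<and> d ^ 2 = a * b"
        using m' sigma_values(3,4)[of 0, where 'k='k] by auto
      then have "LY (xy m 0) a b d \<in> labels_S0 \<union> labels_dim2" by (intro labels_memI(4) ab) auto
      moreover have "weight_vector \<xi> sc M (LY (xy m 0) a b d) x" using x by (simp add: weight_vector_def)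
      ultimately show ?thesis by blast
    qed
  qed
qed

text \<open>
  The homomorphism given by a weight vector is nonzero, so Schur's lemma applies.
\<close>

lemma simple_iso_listed:
  assumes M: "simple_yd_module Hc sc M"
  shows "\<exists>l\<in>labels_S0 \<union> labels_dim2. yd_iso sc (*s) M (listed \<xi> l)"
proof -
  have m: "yd_module Hc sc M" "vs M \<noteq> {0}" using M by (auto simp: simple_yd_module_def)
  obtain l v where l: "l \<in> labels_S0 \<union> labels_dim2" and v: "weight_vector \<xi> sc M l v"
    using exists_weight_vector[OF m] by blast
  obtain w where hom: "yd_hom (*s) sc (listed \<xi> l) M (\<lambda>u. sc (u $ 1) v + sc (u $ 2) w)"
    using weight_vector_hom[OF \<xi> char_ne_2 l m(1) v] by blast
  have s: "simple_yd_module Hc (*s) (listed \<xi> l)" by (rule listed_simple[OF \<xi> char_ne_2 l])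
  have e: "axis 1 1 \<in> vs (listed \<xi> l)"
    using l by (cases rule: labels_cases)
      (auto simp: mod_V_def mod_W_def mod_X_def mod_Y_def mod_Z_def yd_of_ops_sel vec.span_base)
  have "sc ((axis 1 1 :: 'k ^ 2) $ 1) v + sc ((axis 1 1 :: 'k ^ 2) $ 2) w \<noteq> 0"
    using vec_combination_hom(3)[OF yd_closed(1)[OF m(1)], of v w] v by (simp add: weight_vector_def)
  then have "yd_iso (*s) sc (listed \<xi> l) M" by (rule yd_schur[OF s M hom e])
  then have "yd_iso sc (*s) M (listed \<xi> l)"
    using s by (intro yd_iso_sym[where M="listed \<xi> l" and H=Hc]) (auto simp: simple_yd_module_def)
  then show ?thesis using l by blast
qed

end

section \<open>Transport of structure and dimension\<close>

definition transport_yd :: "('w::ab_group_add \<Rightarrow> 'v::ab_group_add) \<Rightarrow> ('b::finite, 'k, 'w) yd \<Rightarrow> ('b, 'k, 'v) yd" where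
  "transport_yd j M = \<lparr>vs = j ` vs M,
     act = (\<lambda>a y. j (act M a (inv_into (vs M) j y))),
     coact = (\<lambda>y. \<chi> b. j (coact M (inv_into (vs M) j y) $ b))\<rparr>"

lemma transport_yd_sel:
  assumes "inj_on j (vs M)"
  shows "vs (transport_yd j M) = j ` vs M"
    and "v \<in> vs M \<Longrightarrow> act (transport_yd j M) a (j v) = j (act M a v)"
    and "v \<in> vs M \<Longrightarrow> coact (transport_yd j M) (j v) $ b = j (coact M v $ b)"
  using assms by (simp_all add: transport_yd_def)

lemma transport_yd_module:
  assumes M: "yd_module H sc M" and lin: "Vector_Spaces.linear sc sc' j" and inj: "inj_on j (vs M)"
  shows "yd_module H sc' (transport_yd j M)"
proof -
  interpret j: Vector_Spaces.linear sc sc' j by (rule lin)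
  note sel = transport_yd_sel[OF inj]
  note cl = yd_closed[OF M] yd_module_closed_ops[OF M]
  have sub: "j.vs1.subspace (vs M)" by (rule cl(2))
  have L: "left_module H sc M" "right_comodule H sc M" "yd_compatible H sc M" using M by (auto simp: yd_module_def)
  have s: "j x + j y = j (x + y)" "sc' c (j x) = j (sc c x)" for x y c by (simp_all add: j.add j.scale)
  show ?thesis unfolding yd_module_def
  proof (intro conjI)
    show "vector_space sc'" by (rule j.vs2.vector_space_axioms)
    show "j.vs2.subspace (vs (transport_yd j M))" unfolding sel(1) by (rule j.subspace_image[OF sub])
    show "left_module H sc' (transport_yd j M)"
      unfolding left_module_def sel(1)
    proof (intro conjI allI ballI; elim imageE; hypsubst)
      fix a b c x y assume x: "x \<in> vs M"
      note l = L(1)[unfolded left_module_def]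
      show "act (transport_yd j M) a (j x) \<in> j ` vs M" using x cl by (simp add: sel)
      show "act (transport_yd j M) a (sc' c (j x)) = sc' c (act (transport_yd j M) a (j x))"
        unfolding s using x cl l by (simp add: sel s)
      show "act (transport_yd j M) (a + b) (j x) = act (transport_yd j M) a (j x) + act (transport_yd j M) b (j x)"
        using x l by (simp add: sel s)
      show "act (transport_yd j M) (c *s a) (j x) = sc' c (act (transport_yd j M) a (j x))"
        using x l by (simp add: sel s)
      show "act (transport_yd j M) (unit H) (j x) = j x" using x l by (simp add: sel)
      show "act (transport_yd j M) (mul H a b) (j x) = act (transport_yd j M) a (act (transport_yd j M) b (j x))"
        using x cl l by (simp add: sel)
      { assume y: "y \<in> vs M"
        show "act (transport_yd j M) a (j x + j y) = act (transport_yd j M) a (j x) + act (transport_yd j M) a (j y)"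
          unfolding s using x y cl l by (simp add: sel s) }
    qed
    show "right_comodule H sc' (transport_yd j M)"
      unfolding right_comodule_def sel(1)
    proof (intro conjI allI ballI; elim imageE; hypsubst)
      fix b c p q x y assume x: "x \<in> vs M"
      note r = L(2)[unfolded right_comodule_def]
      show "coact (transport_yd j M) (j x) $ b \<in> j ` vs M" using x cl by (simp add: sel)
      show "coact (transport_yd j M) (sc' c (j x)) = (\<chi> b. sc' c (coact (transport_yd j M) (j x) $ b))"
        unfolding s vec_eq_iff using x cl r by (simp add: sel s)
      show "coact (transport_yd j M) (coact (transport_yd j M) (j x) $ q) $ p =
        (\<Sum>b\<in>UNIV. sc' (comult H (bas b) $ (p, q)) (coact (transport_yd j M) (j x) $ b))"
        using x cl r by (simp add: sel s flip: j.sum)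
      show "(\<Sum>b\<in>UNIV. sc' (counit H (bas b)) (coact (transport_yd j M) (j x) $ b)) = j x"
        using x cl r by (simp add: sel s flip: j.sum)
      { assume y: "y \<in> vs M"
        show "coact (transport_yd j M) (j x + j y) = coact (transport_yd j M) (j x) + coact (transport_yd j M) (j y)"
          unfolding s vec_eq_iff using x y cl r by (simp add: sel s) }
    qed
    show "yd_compatible H sc' (transport_yd j M)"
      unfolding yd_compatible_def sel(1)
    proof (intro allI ballI; elim imageE; hypsubst)
      fix a d x assume x: "x \<in> vs M"
      have "coact M (act M a x) $ d = (\<Sum>p\<in>UNIV. \<Sum>q\<in>UNIV. \<Sum>r\<in>UNIV. \<Sum>b\<in>UNIV.
           sc (comult3 H a $ (p, q, r) * mul H (mul H (bas r) (bas b)) (inv (antipode H) (bas p)) $ d)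
                 (act M (bas q) (coact M x $ b)))" using L(3) x unfolding yd_compatible_def by blast
      then show "coact (transport_yd j M) (act (transport_yd j M) a (j x)) $ d =
        (\<Sum>p\<in>UNIV. \<Sum>q\<in>UNIV. \<Sum>r\<in>UNIV. \<Sum>b\<in>UNIV.
           sc' (comult3 H a $ (p, q, r) * mul H (mul H (bas r) (bas b)) (inv (antipode H) (bas p)) $ d)
                 (act (transport_yd j M) (bas q) (coact (transport_yd j M) (j x) $ b)))"
        using x cl by (simp only: sel s j.sum)
    qed
  qed
qed

lemma transport_yd_iso:
  assumes M: "yd_module H sc M" and lin: "Vector_Spaces.linear sc sc' j" and inj: "inj_on j (vs M)"
  shows "yd_iso sc sc' M (transport_yd j M)"
proof -
  interpret j: Vector_Spaces.linear sc sc' j by (rule lin)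
  note sel = transport_yd_sel[OF inj]
  have "yd_hom sc sc' M (transport_yd j M) j"
    unfolding yd_hom_def by (simp add: sel j.add j.scale)
  moreover have "bij_betw j (vs M) (vs (transport_yd j M))" using inj by (simp add: sel bij_betw_def)
  ultimately show ?thesis unfolding yd_iso_iff by blast
qed

lemma transport_yd_simple:
  assumes M: "simple_yd_module H sc M" and lin: "Vector_Spaces.linear sc sc' j" and inj: "inj_on j (vs M)"
  shows "simple_yd_module H sc' (transport_yd j M)"
proof -
  interpret j: Vector_Spaces.linear sc sc' j by (rule lin)
  have m: "yd_module H sc M" and nz: "vs M \<noteq> {0}" and simple: "\<And>U. yd_submodule sc M U \<Longrightarrow> U = {0} \<or> U = vs M"
    using M by (auto simp: simple_yd_module_def)
  note sel = transport_yd_sel[OF inj]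
  note cl = yd_closed[OF m] yd_module_closed_ops[OF m]
  have 0: "0 \<in> vs M" using cl(2) by (rule j.vs1.subspace_0)
  show ?thesis unfolding simple_yd_module_def
  proof (intro conjI allI impI)
    show "yd_module H sc' (transport_yd j M)" by (rule transport_yd_module[OF m lin inj])
    obtain x where x: "x \<in> vs M" "x \<noteq> 0" using nz 0 by blast
    then have "j x \<noteq> 0" using inj_onD[OF inj _ x(1) 0] by auto
    then show "vs (transport_yd j M) \<noteq> {0}" using x sel by auto
    fix U assume U: "yd_submodule sc' (transport_yd j M) U"
    then have Usub: "U \<subseteq> j ` vs M" and Us: "j.vs2.subspace U" by (auto simp: yd_submodule_def sel)
    have "yd_submodule sc M {x \<in> vs M. j x \<in> U}"
      unfolding yd_submodule_def
    proof (intro conjI allI ballI)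
      show "j.vs1.subspace {x \<in> vs M. j x \<in> U}"
        by (rule j.vs1.subspaceI) (use 0 cl Us in \<open>auto simp: j.add j.scale j.vs2.subspace_0 j.vs2.subspace_add j.vs2.subspace_scale\<close>)
      fix u assume "u \<in> {x \<in> vs M. j x \<in> U}"
      then have u: "u \<in> vs M" "j u \<in> U" by auto
      have "act (transport_yd j M) a (j u) \<in> U" "coact (transport_yd j M) (j u) $ b \<in> U" for a b
        using U u(2) unfolding yd_submodule_def by blast+
      then show "act M a u \<in> {x \<in> vs M. j x \<in> U}" "coact M u $ b \<in> {x \<in> vs M. j x \<in> U}" for a b
        using u cl by (auto simp: sel)
    qed auto
    then have "{x \<in> vs M. j x \<in> U} = {0} \<or> {x \<in> vs M. j x \<in> U} = vs M" by (rule simple)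
    moreover have "U = j ` {x \<in> vs M. j x \<in> U}" using Usub by auto
    ultimately have "U = j ` {0} \<or> U = j ` vs M" by metis
    then show "U = {0} \<or> U = vs (transport_yd j M)" by (simp add: sel)
  qed
qed

text \<open>
  An isomorphism is only defined on the underlying space, so it is extended to a linear map on the whole
  plane before bases are compared.
\<close>

lemma yd_iso_dim:
  fixes M :: "('b::finite, 'k::field, 'k ^ 2) yd" and N :: "('b, 'k, 'v::ab_group_add) yd"
  assumes vs: "vs M = UNIV \<or> vs M = vec.span {axis 1 1}" and sc: "vector_space sc" and iso: "yd_iso (*s) sc M N"
  shows "vector_space.dim sc (vs N) = vec.dim (vs M)"
proof -
  interpret vector_space sc by (rule sc)
  obtain f where f: "bij_betw f (vs M) (vs N)" "yd_hom (*s) sc M N f" using iso unfolding yd_iso_iff by blast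
  define F where "F u = sc (u $ 1) (f (axis 1 1)) + sc (u $ 2) (f (axis 2 1))" for u :: "'k ^ 2"
  have lin: "Vector_Spaces.linear (*s) sc F"
    by (unfold_locales) (simp_all add: F_def scale_left_distrib scale_right_distrib)
  interpret F: Vector_Spaces.linear "(*s)" sc F by (rule lin)
  have Ff: "F u = f u" if u: "u \<in> vs M" for u
    using vs
  proof
    assume U: "vs M = UNIV"
    have "f u = f (u $ 1 *s axis 1 1 + u $ 2 *s axis 2 1)" by (rule arg_cong[where f=f]) (simp add: vec2_eq axis_def)
    also have "\<dots> = F u" using f(2) U by (simp add: yd_hom_def F_def)
    finally show ?thesis by simp
  next
    assume U: "vs M = vec.span {axis 1 1}"
    then obtain c where c: "u = c *s axis 1 1" using u by (auto simp: vec.span_singleton)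
    have "axis 1 1 \<in> vs M" using U by (simp add: vec.span_base)
    then have "f u = sc c (f (axis 1 1))" using f(2) unfolding c by (simp add: yd_hom_def)
    also have "\<dots> = F u" by (simp add: F_def c axis_def)
    finally show ?thesis by simp
  qed
  have img: "F ` vs M = vs N" using f(1) Ff by (simp add: bij_betw_def)
  have inj: "inj_on F (vs M)" using f(1) Ff by (simp add: bij_betw_def inj_on_def)
  obtain B where B: "B \<subseteq> vs M" "vec.independent B" "vs M \<subseteq> vec.span B" "card B = vec.dim (vs M)"
    using vec.basis_exists[of "vs M"] by blast
  have "vec.subspace (vs M)" using vs by auto
  with B have spB: "vec.span B = vs M" by (metis vec.span_subspace)
  have "independent (F ` B)" using F.independent_injective_image[OF B(2)] inj spB by simp
  moreover have "span (F ` B) = F ` vs M" using F.span_image[of B] spB by simp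
  ultimately have "dim (F ` vs M) = card (F ` B)" by (metis dim_eq_card_independent dim_span)
  also have "\<dots> = vec.dim (vs M)" using B(1,4) inj by (metis card_image inj_on_subset)
  finally have "dim (F ` vs M) = vec.dim (vs M)" .
  then show ?thesis by (simp add: img)
qed

lemma class_in_quotient:
  assumes "simple_yd_module H sc N"
  shows "{M'. simple_yd_module H sc M' \<and> yd_iso sc sc N M'} \<in> simple_yd_classes H sc"
  using assms unfolding simple_yd_classes_def quotient_def by auto

section \<open>Pairwise non-isomorphism and the number of labels\<close>

lemma weight_vector_iso:
  assumes iso: "yd_iso sc sc' M N" and M: "yd_module Hc sc M" and N: "yd_module Hc sc' N" and v: "weight_vector \<xi> sc M l v"
  shows "\<exists>u. weight_vector \<xi> sc' N l u"
proof -
  obtain f where bij: "bij_betw f (vs M) (vs N)" and f: "yd_hom sc sc' M N f" using iso unfolding yd_iso_iff by blast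
  interpret R: double_rep sc "vs M" "\<lambda>g. act M (bas (Inl g))" "act M t_H"
    "\<lambda>g v. coact M v $ Inl g" "\<lambda>g v. coact M v $ Inr g" by (rule double_rep_of_yd_module[OF M])
  have v': "v \<in> vs M" "v \<noteq> 0" using v by (auto simp: weight_vector_def)
  have 0: "0 \<in> vs M" "f 0 = 0" using R.subspace_0[OF R.subspace_V] yd_hom_zero[OF M N f] by auto
  have "f v \<noteq> 0" using bij v' 0 unfolding bij_betw_def inj_on_def by metis
  have h: "act N a (f v) = f (act M a v)" "coact N (f v) $ b = f (coact M v $ b)" "f (sc c v) = sc' c (f v)"
    "f (sc c (coact M v $ b)) = sc' c (f (coact M v $ b))" for a b c
    using yd_homD(3,4,5)[OF f v'(1)] yd_homD(3)[OF f R.mem(4)[OF v'(1)]]  yd_homD(3)[OF f yd_closed(4)[OF M v'(1)]] by auto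
  have "weight_eqs \<xi> sc' (\<lambda>g. act N (bas (Inl g))) (act N t_H)
       (\<lambda>g v. coact N v $ Inl g) (\<lambda>g v. coact N v $ Inr g) l (f v)"
    using v 0 h(3,4) unfolding weight_vector_def by (cases l) (simp_all add: h(1,2) del: One_nat_def R.scale_minus_left)
  then show ?thesis using \<open>f v \<noteq> 0\<close> yd_homD(1)[OF f v'(1)] unfolding weight_vector_def by blast
qed

lemma twisted_yd_ops:
  fixes a b :: "'k::field"
  assumes ab: "a * a = 1" "b * b = 1"
    and T: "T = adiag l (- (a * b * l)) \<and> odd (xexp \<mu>) \<and> - (a * b * l * l) = sigma_t \<mu> \<or>
      T = diag l (- (b * l)) \<and> even (xexp \<mu>) \<and> l * l = sigma_t \<mu>"
    and \<mu>: "yexp \<mu> = 0"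
  defines "M \<equiv> twisted_yd \<mu> a b T"
  shows "act M (bas (Inl g)) u = diag (of_bool (g = \<mu>)) (of_bool (g = \<mu> + xy 0 1)) u"
    "coact M u $ Inr 0 = u" "coact M u $ Inr (xy 1 0) = adiag 1 a u" "coact M u $ Inr (xy 0 1) = diag b (- b) u"
    "coact M u $ Inr (xy 2 0) = diag a a u" "act M t_H u = T u"
proof -
  have ch: "chi_op a b 0 = diag 1 1" "chi_op a b (xy 1 0) = adiag 1 a" "chi_op a b (xy 0 1) = diag b (- b)" "chi_op a b (xy 2 0) = diag a a"
    using chi_op_even_odd(2)[OF ab, of 0 0] chi_op_even_odd(1)[OF ab, of 0 1] chi_op_even_odd(1)[OF ab, of 1 0]
      chi_op_even_odd(1)[OF ab, of 0 0] by (simp_all add: xy_0)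
  show "act M (bas (Inl g)) u = diag (of_bool (g = \<mu>)) (of_bool (g = \<mu> + xy 0 1)) u"
    "coact M u $ Inr 0 = u" "coact M u $ Inr (xy 1 0) = adiag 1 a u" "coact M u $ Inr (xy 0 1) = diag b (- b) u"
    "coact M u $ Inr (xy 2 0) = diag a a u" "act M t_H u = T u"
    unfolding M_def twisted_yd_def yd_of_ops_sel ch yd_of_ops_t[OF double_rep_twisted[OF ab T \<mu>] UNIV_I]
    by (simp_all add: vec2_eq)
qed

text \<open>
  \<open>C\<^sub>0\<close> tells (S0)-(S2) from (S3)-(S4), and the parity of the \<open>x\<close>-exponent of \<open>\<mu>\<close> tells (S1) from (S0) and (S2),
  and (S3) from (S4).  The eigenvalue of \<open>Z\<^sub>y\<close> is \<open>(-1)\<^sup>b\<close> for (S0) and \<open>- (-1)\<^sup>b\<close> for (S2), where \<open>\<mu> = x\<^sup>a y\<^sup>b\<close>.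
  Within a family the remaining eigenvalues give back the label.
\<close>

lemma listed_weight_unique:
  fixes \<xi> :: "'k::field"
  assumes \<xi>: "\<xi> * \<xi> = -1" "(1 :: 'k) \<noteq> -1" and l: "l \<in> labels_S0 \<union> labels_dim2" and l': "l' \<in> labels_S0 \<union> labels_dim2"
    and w: "weight_vector \<xi> (*s) (listed \<xi> l') l u"
  shows "l = l'"
proof -
  have u0: "u \<noteq> 0" "u \<in> vs (listed \<xi> l')" using w by (auto simp: weight_vector_def)
  have lcx: "lin_char \<alpha> \<beta> (xy 1 0) = \<alpha>" "lin_char \<alpha> \<beta> (xy 0 1) = \<beta>" for \<alpha> \<beta> :: 'k
    by (simp_all add: lin_char_def xexp_xy yexp_xy)
  from l' show ?thesis
  proof (cases rule: labels_cases)
    case (V \<mu>' i' s')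
    note eq = mod_V_eq[OF \<xi>, of \<mu>' i' s'] and c = mod_V_conditions[OF \<xi> V(2)]
    have N: "listed \<xi> l' = scalar_yd \<mu>' (\<xi> ^ i') ((-1) ^ yexp \<mu>') (sign_val s' * (if \<mu>' \<in> {xy 0 0, xy 0 1} then 1 else \<xi>))"
      by (simp only: V(1) listed.simps eq)
    have uV: "u \<in> vec.span {axis 1 1}" using u0 N by (simp add: scalar_yd_def yd_of_ops_sel)
    have ops: "act (listed \<xi> l') (bas (Inl g)) u = of_bool (g = \<mu>') *s u" 
      "coact (listed \<xi> l') u $ Inr g = 0" "coact (listed \<xi> l') u $ Inl (xy 1 0) = (\<xi> ^ i') *s u"
      "coact (listed \<xi> l') u $ Inl (xy 0 1) = ((-1) ^ yexp \<mu>') *s u"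
      "act (listed \<xi> l') t_H u = (sign_val s' * (if \<mu>' \<in> {xy 0 0, xy 0 1} then 1 else \<xi>)) *s u" for g
      unfolding N scalar_yd_def yd_of_ops_sel lcx yd_of_ops_t[OF double_rep_scalar[OF c(1,2,3,4) c(5)] uV] by simp_all
    have [simp]: "x *s u = y *s u \<longleftrightarrow> x = y" "x *s u = u \<longleftrightarrow> x = 1" for x y
      using u0 by (simp_all add: vec.scale_cancel_right) (metis vec.scale_cancel_right vec.scale_one)
    from l show ?thesis
    proof (cases rule: labels_cases)
      case (V \<mu> i s)
      have 1: "\<mu> = \<mu>'" "\<xi> ^ i' = \<xi> ^ i" 
        "sign_val s' * (if \<mu>' \<in> {xy 0 0, xy 0 1} then 1 else \<xi>) = sign_val s * (if \<mu> \<in> {xy 0 0, xy 0 1} then 1 else \<xi>)"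
        using w unfolding V(1) weight_vector_def weight_eqs.simps ops by auto
      have "\<xi> \<noteq> 0" using \<xi> by auto
      with 1 have "sign_val s' = (sign_val s :: 'k)" by (auto split: if_splits)
      then have "s = s'" using \<xi>(2) by (cases s; cases s') auto
      then show ?thesis using 1 root_power_inj[OF \<xi> V(3) \<open>i' < 4\<close>] V(1) \<open>l' = LV \<mu>' i' s'\<close> by simp
    next
      case (W \<mu> i s)
      then show ?thesis using w \<open>\<mu>' \<in> _\<close> unfolding W(1) weight_vector_def weight_eqs.simps ops by (auto simp: xy_eq_iff)
    next
      case (X \<mu> i)
      have "of_bool (\<mu> = \<mu>') *s u = u" "((-1) ^ yexp \<mu>') *s u = (- ((-1) ^ yexp \<mu>)) *s u"
        using w unfolding X(1) weight_vector_def weight_eqs.simps ops by blast+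
      then have "\<mu> = \<mu>'" "(-1 :: 'k) ^ yexp \<mu>' = - ((-1) ^ yexp \<mu>)"
        using u0(1) by (auto simp only: vec.scale_cancel_right vec.scale_zero_left of_bool_def split: if_splits)
      then show ?thesis using \<xi>(2) by (auto simp: minus_one_power_iff split: if_splits)
    qed (use w u0 in \<open>simp_all add: weight_vector_def ops\<close>)
  next
    case (W \<mu>' i' s')
    note eq = mod_W_eq[OF \<xi> W(2), of i' s']
    have N: "listed \<xi> l' = induced_yd \<mu>' (sign_val s' * \<xi> ^ i') (- sign_val s')"
      by (simp only: W(1) listed.simps eq)
    have t: "tri \<mu>' = \<mu>' + xy 0 1" using W(2) by (auto simp: tri_xy xy_add xy_eq_iff)
    have ops: "act (listed \<xi> l') (bas (Inl g)) u = diag (of_bool (g = \<mu>')) (of_bool (g = tri \<mu>')) u" 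
      "coact (listed \<xi> l') u $ Inr g = 0" "(coact (listed \<xi> l') u $ Inl (xy 1 0)) $ 1 = sign_val s' * \<xi> ^ i' * u $ 1"
      "(coact (listed \<xi> l') u $ Inl (xy 0 1)) $ 1 = (- sign_val s') * u $ 1" for g
      unfolding N induced_yd_def yd_of_ops_sel diag_nth lcx by simp_all
    from l show ?thesis
    proof (cases rule: labels_cases)
      case (V \<mu> i s)
      then have "\<mu> \<noteq> \<mu>'" "\<mu> \<noteq> tri \<mu>'" using W(2) by (auto simp: xy_eq_iff tri_xy)
      then show ?thesis using w u0 unfolding V(1) weight_vector_def weight_eqs.simps ops by (auto simp: vec2_eq)
    next
      case (X \<mu> i)
      then have "\<mu> \<noteq> \<mu>'" "\<mu> \<noteq> tri \<mu>'" using W(2) by (auto simp: xy_eq_iff tri_xy)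
      then show ?thesis using w u0 unfolding X(1) weight_vector_def weight_eqs.simps ops by (auto simp: vec2_eq)
    next
      case W2: (W \<mu> i s)
      have "\<mu> \<noteq> tri \<mu>'" using W(2) W2(2) by (auto simp: xy_eq_iff tri_xy)
      then have 1: "\<mu> = \<mu>'" "u $ 1 \<noteq> 0" using w u0 unfolding W2(1) weight_vector_def weight_eqs.simps ops by (auto simp: vec2_eq)
      have 2: "sign_val s' * \<xi> ^ i' * u $ 1 = sign_val s * \<xi> ^ i * u $ 1" "- sign_val s' * u $ 1 = - sign_val s * u $ 1"
        using w unfolding W2(1) weight_vector_def weight_eqs.simps ops(3,4)[symmetric] by simp_all
      then have 3: "sign_val s' = (sign_val s :: 'k)" using 1 by simp
      then have "s = s'" using \<xi>(2) by (cases s; cases s') auto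
      moreover have "\<xi> ^ i' = \<xi> ^ i" using 2(1) 1(2) 3 by (cases s) auto
      ultimately show ?thesis using root_power_inj[OF \<xi> W2(3) W(3)] 1 W(1) W2(1) by simp
    qed (use w u0 in \<open>simp_all add: weight_vector_def ops\<close>)
  next
    case (X \<mu>' i')
    have N: "listed \<xi> l' = mod_X \<xi> \<mu>' i'" by (simp add: X(1))
    have d: "(if \<mu>' \<in> {xy 0 0, xy 2 0} then diag (-1) (-1) else diag 1 1) = diag (- ((-1) ^ yexp \<mu>')) (- ((-1 :: 'k) ^ yexp \<mu>'))"
      using X(2) by (auto simp: yexp_xy xy_eq_iff)
    have ops: "act (listed \<xi> l') (bas (Inl g)) u = of_bool (g = \<mu>') *s u" 
      "coact (listed \<xi> l') u $ Inr g = 0" "coact (listed \<xi> l') u $ Inl (xy 1 0) = diag (\<xi> ^ i') (- (\<xi> ^ i')) u"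
      "coact (listed \<xi> l') u $ Inl (xy 0 1) = (- ((-1) ^ yexp \<mu>')) *s u" for g
      unfolding N mod_X_def yd_of_ops_sel d pows_diag lcx by (simp_all add: vec2_eq)
    have [simp]: "x *s u = y *s u \<longleftrightarrow> x = y" "x *s u = u \<longleftrightarrow> x = 1" for x y
      using u0 by (simp_all add: vec.scale_cancel_right) (metis vec.scale_cancel_right vec.scale_one)
    from l show ?thesis
    proof (cases rule: labels_cases)
      case (V \<mu> i s)
      have "of_bool (\<mu> = \<mu>') *s u = u" "(- ((-1) ^ yexp \<mu>')) *s u = ((-1) ^ yexp \<mu>) *s u"
        using w unfolding V(1) weight_vector_def weight_eqs.simps ops by blast+
      then have "\<mu> = \<mu>'" "- ((-1 :: 'k) ^ yexp \<mu>') = (-1) ^ yexp \<mu>"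
        using u0(1) by (auto simp only: vec.scale_cancel_right vec.scale_zero_left of_bool_def split: if_splits)
      then show ?thesis using \<xi>(2) by (auto simp: minus_one_power_iff split: if_splits)
    next
      case (W \<mu> i s)
      then show ?thesis using w \<open>\<mu>' \<in> _\<close> unfolding W(1) weight_vector_def weight_eqs.simps ops by (auto simp: xy_eq_iff)
    next
      case X2: (X \<mu> i)
      have \<mu>: "\<mu> = \<mu>'" and 2: "diag (\<xi> ^ i') (- (\<xi> ^ i')) u = (\<xi> ^ i) *s u"
        using w unfolding X2(1) weight_vector_def weight_eqs.simps ops by auto
      have "\<xi> ^ i' = \<xi> ^ i \<or> - (\<xi> ^ i') = \<xi> ^ i"
      proof -
        have "\<xi> ^ i' * u $ 1 = \<xi> ^ i * u $ 1" "(- (\<xi> ^ i')) * u $ 2 = \<xi> ^ i * u $ 2"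
          using 2 unfolding vec2_eq diag_nth vector_smult_component by blast+
        moreover have "u $ 1 \<noteq> 0 \<or> u $ 2 \<noteq> 0" using u0(1) by (simp add: vec2_eq)
        ultimately show ?thesis by (metis mult_cancel_right)
      qed
      \<comment> \<open>the two eigenvalues of \<open>Z\<^sub>x\<close> differ by a sign, so only \<open>\<xi>\<^sup>2\<^sup>i\<close> is determined, which is enough as \<open>i < 2\<close>\<close>
      then have "\<xi> ^ i' * \<xi> ^ i' = \<xi> ^ i * \<xi> ^ i" by (metis minus_mult_minus)
      then have "\<xi> ^ (2 * i') = \<xi> ^ (2 * i)" by (simp only: mult_2 power_add)
      then have "i' = i" using root_power_inj[OF \<xi>, of "2 * i'" "2 * i"] X(3) X2(3) by simp
      then show ?thesis using \<mu> X(1) X2(1) by simp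
    qed (use w u0 in \<open>simp_all add: weight_vector_def ops\<close>)
  next
    case (Y \<mu>' a' b' r')
    note c = mod_Y_conditions[OF \<xi> Y(2-4)]
    have N: "listed \<xi> l' = twisted_yd \<mu>' a' b' (adiag r' (- (a' * b' * r')))"
      by (simp add: Y(1) mod_Y_eq[OF \<xi>])
    note ops = twisted_yd_ops[OF c(1,2) disjI1[OF conjI[OF refl conjI[OF c(4,5)]]] c(3), folded N]
    from l show ?thesis
    proof (cases rule: labels_cases)
      case Y2: (Y \<mu> a b r)
      have "\<mu> \<noteq> \<mu>' + xy 0 1" using Y(4) Y2(4) by (auto simp: xy_eq_iff xy_add)
      then have 1: "\<mu> = \<mu>'" "u $ 1 \<noteq> 0" "b' = b" "a' = a" "r' = r"
        using w u0 unfolding Y2(1) weight_vector_def weight_eqs.simps ops by (auto simp: vec2_eq split: if_splits)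
      then show ?thesis using Y(1) Y2(1) by simp
    next
      case (Z \<mu> a b r)
      have "\<mu> \<noteq> \<mu>' + xy 0 1" "\<mu> \<noteq> \<mu>'" using Y(4) Z(4) by (auto simp: xy_eq_iff xy_add)
      then show ?thesis using w u0 unfolding Z(1) weight_vector_def weight_eqs.simps ops by (auto simp: vec2_eq)
    qed (use w u0 in \<open>simp_all add: weight_vector_def ops\<close>)
  next
    case (Z \<mu>' a' b' r')
    note c = mod_Z_conditions[OF \<xi> Z(2-4)]
    have N: "listed \<xi> l' = twisted_yd \<mu>' a' b' (diag r' (- (b' * r')))"
      by (simp add: Z(1) mod_Z_eq[OF \<xi>])
    note ops = twisted_yd_ops[OF c(1,2) disjI2[OF conjI[OF refl conjI[OF c(4,5)]]] c(3), folded N]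
    from l show ?thesis
    proof (cases rule: labels_cases)
      case Z2: (Z \<mu> a b r)
      have "\<mu> \<noteq> \<mu>' + xy 0 1" using Z(4) Z2(4) by (auto simp: xy_eq_iff xy_add)
      then have 1: "\<mu> = \<mu>'" "u $ 1 \<noteq> 0" "b' = b" "a' = a" "r' = r"
        using w u0 unfolding Z2(1) weight_vector_def weight_eqs.simps ops by (auto simp: vec2_eq split: if_splits)
      then show ?thesis using Z(1) Z2(1) by simp
    next
      case (Y \<mu> a b r)
      have "\<mu> \<noteq> \<mu>' + xy 0 1" "\<mu> \<noteq> \<mu>'" using Z(4) Y(4) by (auto simp: xy_eq_iff xy_add)
      then show ?thesis using w u0 unfolding Y(1) weight_vector_def weight_eqs.simps ops by (auto simp: vec2_eq)
    qed (use w u0 in \<open>simp_all add: weight_vector_def ops\<close>)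
  qed
qed

text \<open>
  There is a weight vector for some label, and by uniqueness this label can only be \<open>l\<close>.
\<close>

lemma listed_weight_vector:
  fixes \<xi> :: "'k::field"
  assumes \<xi>: "\<xi> * \<xi> = -1" "(1 :: 'k) \<noteq> -1" and l: "l \<in> labels_S0 \<union> labels_dim2"
  shows "\<exists>v. weight_vector \<xi> (*s) (listed \<xi> l) l v"
proof -
  have "yd_module Hc (*s) (listed \<xi> l)" "vs (listed \<xi> l) \<noteq> {0}"
    using listed_simple[OF \<xi> l] by (auto simp: simple_yd_module_def)
  from exists_weight_vector[OF \<xi> this] obtain l0 v
    where "l0 \<in> labels_S0 \<union> labels_dim2" "weight_vector \<xi> (*s) (listed \<xi> l) l0 v" by blast
  then show ?thesis using listed_weight_unique[OF \<xi> _ l] by metis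
qed

lemma listed_iso_unique:
  fixes \<xi> :: "'k::field"
  assumes \<xi>: "\<xi> * \<xi> = -1" "(1 :: 'k) \<noteq> -1" and l: "l \<in> labels_S0 \<union> labels_dim2" "l' \<in> labels_S0 \<union> labels_dim2"
    and iso: "yd_iso (*s) (*s) (listed \<xi> l) (listed \<xi> l')"
  shows "l = l'"
proof -
  have "yd_module Hc (*s) (listed \<xi> l)" "yd_module Hc (*s) (listed \<xi> l')"
    using listed_simple[OF \<xi> l(1)] listed_simple[OF \<xi> l(2)] by (auto simp: simple_yd_module_def)
  then show ?thesis
    using weight_vector_iso[OF iso] listed_weight_vector[OF \<xi> l(1)] listed_weight_unique[OF \<xi> l] by blast
qed

lemma vs_listed:
  "l \<in> labels_S0 \<Longrightarrow> vs (listed \<xi> l) = vec.span {axis 1 1}"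
  "l \<in> labels_dim2 \<Longrightarrow> vs (listed \<xi> l) = UNIV"
  by (auto simp: labels_S0_def labels_dim2_def labels_S1_def labels_S2_def labels_S3_def labels_S4_def
      mod_V_def mod_W_def mod_X_def mod_Y_def mod_Z_def yd_of_ops_sel)

lemma dim_listed:
  "l \<in> labels_S0 \<Longrightarrow> vec.dim (vs (listed \<xi> l)) = 1"
  "l \<in> labels_dim2 \<Longrightarrow> vec.dim (vs (listed \<xi> l)) = 2"
proof -
  show "vec.dim (vs (listed \<xi> l)) = 1" if "l \<in> labels_S0"
  proof -
    have "vec.independent {axis 1 1 :: 'a ^ 2}" by (simp add: axis_eq_0_iff)
    then show ?thesis unfolding vs_listed(1)[OF that] vec.dim_span
      using vec.dim_eq_card_independent[of "{axis 1 1 :: 'a ^ 2}"] by simp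
  qed
  show "vec.dim (vs (listed \<xi> l)) = 2" if "l \<in> labels_dim2"
    unfolding vs_listed(2)[OF that] by (simp only: vec.dim_UNIV vec.dimension_def) (simp add: card_cart_basis)
qed

lemma card_groups:
  "card {xy 0 0, xy 0 1, xy 2 0, xy 2 1} = 4" "card {xy 1 0, xy 3 0} = 2" "card {xy 0 0, xy 2 0} = 2"
  by (simp_all add: xy_eq_iff)

lemma card_labels_S0: "card (labels_S0 :: 'k::field label set) = 32" "finite (labels_S0 :: 'k label set)"
proof -
  have UNIV_sign: "(UNIV :: sign set) = {Plus, Minus}" using sign.exhaust by auto
  have eq: "labels_S0 = (\<lambda>(\<mu>, i, s). LV \<mu> i s :: 'k label) ` ({xy 0 0, xy 0 1, xy 2 0, xy 2 1} \<times> {..<4} \<times> UNIV)"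
    unfolding labels_S0_def by force
  have "card ({xy 0 0, xy 0 1, xy 2 0, xy 2 1} \<times> {..<4::nat} \<times> (UNIV :: sign set)) = 32"
    by (simp only: card_cartesian_product card_groups UNIV_sign) simp
  moreover have "inj_on (\<lambda>(\<mu>, i, s). LV \<mu> i s :: 'k label) A" for A by (auto simp: inj_on_def)
  ultimately show "card (labels_S0 :: 'k label set) = 32" unfolding eq by (simp only: card_image)
  show "finite (labels_S0 :: 'k label set)" unfolding eq UNIV_sign by (intro finite_imageI finite_cartesian_product) auto
qed

lemma parametrised_set_eq:
  assumes "\<And>x. x \<in> X \<longleftrightarrow> (\<exists>\<mu> a b l. x = F \<mu> a b l \<and> a \<in> A \<and> b \<in> B \<and> \<mu> \<in> M \<and> (\<exists>e\<in>D. l = e * r \<mu> a b))"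
  shows "X = (\<lambda>(\<mu>, a, b, e). F \<mu> a b (e * r \<mu> a b)) ` (M \<times> A \<times> B \<times> D)"
  by (rule set_eqI) (simp only: assms image_iff split_paired_Bex_Sigma prod.case, blast)

text \<open>
  For given \<open>\<mu>\<close>, \<open>a\<close>, \<open>b\<close> the square of \<open>\<lambda>\<close> is prescribed as \<open>1\<close> or \<open>-1\<close>, so \<open>\<lambda>\<close> is \<open>1\<close> or \<open>\<xi>\<close> up to sign;
  \<open>r3\<close> and \<open>r4\<close> choose one of the two roots, and a further sign parametrises the labels.
\<close>

lemma card_labels_dim2:
  fixes \<xi> :: "'k::field"
  assumes \<xi>: "\<xi> * \<xi> = -1" "(1 :: 'k) \<noteq> -1"
  shows "card (labels_dim2 :: 'k label set) = 56" "finite (labels_dim2 :: 'k label set)"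
proof -
  have UNIV_sign: "(UNIV :: sign set) = {Plus, Minus}" using sign.exhaust by auto
  have pm: "card {1, -1 :: 'k} = 2" using \<xi>(2) by simp
  have \<xi>0: "\<xi> \<noteq> 0" using \<xi> by auto
  have sq: "x ^ 2 = y * y \<longleftrightarrow> (\<exists>e\<in>{1, -1}. x = e * y)" for x y :: 'k
    by (simp add: power2_eq_square square_eq_iff)
  have 1: "labels_S1 = (\<lambda>(\<mu>, i, s). LW \<mu> i s :: 'k label) ` ({xy 1 0, xy 3 0} \<times> {..<4} \<times> UNIV)"
    unfolding labels_S1_def by force
  have 2: "labels_S2 = (\<lambda>(\<mu>, i). LX \<mu> i :: 'k label) ` ({xy 0 0, xy 0 1, xy 2 0, xy 2 1} \<times> {..<2})"
    unfolding labels_S2_def by force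
  define r3 where "r3 = (\<lambda>(\<mu> :: G) a (b :: 'k). if (\<mu> = xy 1 0) = (a = b) then \<xi> else 1)"
  define r4 where "r4 = (\<lambda>\<mu> :: G. if \<mu> = xy 0 0 then 1 else \<xi>)"
  have r3: "\<mu> = xy 1 0 \<and> l ^ 2 = - (a * b) \<or> \<mu> = xy 3 0 \<and> l ^ 2 = a * b \<longleftrightarrow>
      \<mu> \<in> {xy 1 0, xy 3 0} \<and> (\<exists>e\<in>{1, -1}. l = e * r3 \<mu> a b)"
    if "a \<in> {1, -1}" "b \<in> {1, -1}" for \<mu> l and a b :: 'k
  proof -
    have ne: "xy 1 0 \<noteq> xy 3 0" by (simp add: xy_eq_iff)
    have "\<mu> = xy 1 0 \<Longrightarrow> r3 \<mu> a b * r3 \<mu> a b = - (a * b)" "\<mu> = xy 3 0 \<Longrightarrow> r3 \<mu> a b * r3 \<mu> a b = a * b"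
      using that \<xi> ne ne[symmetric] by (auto simp: r3_def)
    then show ?thesis using ne unfolding sq[symmetric] by auto
  qed
  have r4: "\<mu> = xy 0 0 \<and> l ^ 2 = 1 \<or> \<mu> = xy 2 0 \<and> l ^ 2 = -1 \<longleftrightarrow>
      \<mu> \<in> {xy 0 0, xy 2 0} \<and> (\<exists>e\<in>{1, -1}. l = e * r4 \<mu>)" for \<mu> l
  proof -
    have ne: "xy 0 0 \<noteq> xy 2 0" by (simp add: xy_eq_iff)
    have "\<mu> = xy 0 0 \<Longrightarrow> r4 \<mu> * r4 \<mu> = 1" "\<mu> = xy 2 0 \<Longrightarrow> r4 \<mu> * r4 \<mu> = -1"
      using \<xi> ne by (auto simp: r4_def)
    then show ?thesis using ne unfolding sq[symmetric] by auto
  qed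
  have 3: "labels_S3 = (\<lambda>(\<mu>, a, b, e). LY \<mu> a b (e * r3 \<mu> a b)) ` ({xy 1 0, xy 3 0} \<times> {1, -1} \<times> {1, -1} \<times> {1, -1})"
    (is "_ = ?f3 ` ?A3")
  proof -
    have m: "x \<in> labels_S3 \<longleftrightarrow> (\<exists>\<mu> a b l. x = LY \<mu> a b l \<and> a \<in> {1, -1} \<and> b \<in> {1, -1} \<and> \<mu> \<in> {xy 1 0, xy 3 0} \<and> (\<exists>e\<in>{1, -1}. l = e * r3 \<mu> a b))" for x
      unfolding labels_S3_def mem_Collect_eq by (intro iff_exI conj_cong refl r3)
    then have "labels_S3 = ?f3 ` ?A3"
      by (rule parametrised_set_eq)
    then show ?thesis .
  qed
  have 4: "labels_S4 = (\<lambda>(\<mu>, a, b, e). LZ \<mu> a b (e * r4 \<mu>)) ` ({xy 0 0, xy 2 0} \<times> {1, -1} \<times> {1, -1} \<times> {1, -1})"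
    (is "_ = ?f4 ` ?A4")
  proof -
    have m: "x \<in> labels_S4 \<longleftrightarrow> (\<exists>\<mu> a b l. x = LZ \<mu> a b l \<and> a \<in> {1, -1} \<and> b \<in> {1, -1} \<and> \<mu> \<in> {xy 0 0, xy 2 0} \<and> (\<exists>e\<in>{1, -1}. l = e * r4 \<mu>))" for x
      unfolding labels_S4_def mem_Collect_eq by (intro iff_exI conj_cong refl r4)
    then have "labels_S4 = ?f4 ` ?A4"
      by (rule parametrised_set_eq)
    then show ?thesis .
  qed
  have nz: "r3 \<mu> a b \<noteq> 0" "r4 \<mu> \<noteq> 0" for \<mu> a b using \<xi>0 by (auto simp: r3_def r4_def)
  have inj: "inj_on (\<lambda>(\<mu>, i, s). LW \<mu> i s :: 'k label) A1" "inj_on (\<lambda>(\<mu>, i). LX \<mu> i :: 'k label) A2"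
    "inj_on (\<lambda>(\<mu>, a, b, e). LY \<mu> a b (e * r3 \<mu> a b)) A3" "inj_on (\<lambda>(\<mu>, a, b, e). LZ \<mu> a b (e * r4 \<mu>)) A4" for A1 A2 A3 A4
    by (auto simp: inj_on_def nz)
  have c: "card (labels_S1 :: 'k label set) = 16" "card (labels_S2 :: 'k label set) = 8"
    "card (labels_S3 :: 'k label set) = 16" "card (labels_S4 :: 'k label set) = 16"
    unfolding 1 2 3 4 inj[THEN card_image]
    by (simp_all only: card_cartesian_product card_groups UNIV_sign pm card_lessThan) simp_all
  have f: "finite (labels_S1 :: 'k label set)" "finite (labels_S2 :: 'k label set)"
    "finite (labels_S3 :: 'k label set)" "finite (labels_S4 :: 'k label set)"
    unfolding 1 2 3 4 UNIV_sign by (intro finite_imageI finite_cartesian_product; auto)+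
  have d: "(labels_S1 \<union> labels_S2 \<union> labels_S3) \<inter> labels_S4 = ({} :: 'k label set)" "(labels_S1 \<union> labels_S2) \<inter> labels_S3 = ({} :: 'k label set)"
    "labels_S1 \<inter> labels_S2 = ({} :: 'k label set)"
    by (auto simp: labels_S1_def labels_S2_def labels_S3_def labels_S4_def)
  show "card (labels_dim2 :: 'k label set) = 56" "finite (labels_dim2 :: 'k label set)"
    unfolding labels_dim2_def by (simp_all add: card_Un_disjoint f d c)
qed

lemma labels_disjoint: "labels_S0 \<inter> labels_dim2 = {}"
  by (auto simp: labels_S0_def labels_dim2_def labels_S1_def labels_S2_def labels_S3_def labels_S4_def)

section \<open>The classification\<close>

text \<open>
  Two independent vectors give an embedding of the plane, hence copies of all listed modules inside the ambient
  space.  By the classification every class contains exactly one of these copies.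
\<close>

lemma simple_yd_classes_count:
  fixes \<xi> :: "'k::field" and sc :: "'k \<Rightarrow> 'v::ab_group_add \<Rightarrow> 'v"
  assumes \<xi>: "\<xi> * \<xi> = -1" "(1 :: 'k) \<noteq> -1" and sc: "vector_space sc"
    and uw: "u \<noteq> w" "\<not> module.dependent sc {u, w}"
  shows "card (simple_yd_classes Hc sc) = 88"
    "card {K \<in> simple_yd_classes Hc sc. \<forall>M\<in>K. vector_space.dim sc (vs M) = 1} = 32"
    "card {K \<in> simple_yd_classes Hc sc. \<forall>M\<in>K. vector_space.dim sc (vs M) = 2} = 56"
proof -
  interpret vector_space sc by (rule sc)
  define L :: "'k label set" where "L = labels_S0 \<union> labels_dim2"
  define j where "j x = sc (x $ 1) u + sc (x $ 2) w" for x :: "'k ^ 2"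
  have lin: "Vector_Spaces.linear (*s) sc j"
    by (unfold_locales) (simp_all add: j_def scale_left_distrib scale_right_distrib)
  interpret j: Vector_Spaces.linear "(*s)" sc j by (rule lin)
  have inj: "inj_on j A" for A
  proof -
    have "x = 0" if "j x = 0" for x
    proof -
      have "(\<Sum>v\<in>{u, w}. sc (if v = u then x $ 1 else x $ 2) v) = 0"
        using that uw(1) by (simp add: j_def)
      then have "x $ 1 = 0" "x $ 2 = 0"
        using uw independentD[of "{u, w}" "{u, w}" "\<lambda>v. if v = u then x $ 1 else x $ 2"] by (force split: if_splits)+
      then show ?thesis by (simp add: vec2_eq)
    qed
    then show ?thesis by (meson j.inj_iff_eq_0 inj_on_subset subset_UNIV)
  qed
  define N where "N l = transport_yd j (listed \<xi> l)" for l
  have simple: "simple_yd_module Hc (*s) (listed \<xi> l)" "simple_yd_module Hc sc (N l)"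
    and iso: "yd_iso (*s) sc (listed \<xi> l) (N l)" "yd_iso sc (*s) (N l) (listed \<xi> l)" if "l \<in> L" for l
  proof -
    show s: "simple_yd_module Hc (*s) (listed \<xi> l)" using listed_simple[OF \<xi>] that by (simp add: L_def)
    then have m: "yd_module Hc (*s) (listed \<xi> l)" by (simp add: simple_yd_module_def)
    show n: "simple_yd_module Hc sc (N l)" unfolding N_def by (rule transport_yd_simple[OF s lin inj])
    show i: "yd_iso (*s) sc (listed \<xi> l) (N l)" unfolding N_def
      by (rule transport_yd_iso[OF m lin inj])
    show "yd_iso sc (*s) (N l) (listed \<xi> l)" by (rule yd_iso_sym[OF m i])
  qed
  define \<phi> where "\<phi> l = {M. simple_yd_module Hc sc M \<and> yd_iso sc sc (N l) M}" for l
  have classes: "simple_yd_classes Hc sc = \<phi> ` L"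
  proof
    show "\<phi> ` L \<subseteq> simple_yd_classes Hc sc"
      unfolding \<phi>_def using class_in_quotient[OF simple(2)] by blast
    show "simple_yd_classes Hc sc \<subseteq> \<phi> ` L"
    proof
      fix K assume "K \<in> simple_yd_classes Hc sc"
      then obtain M where M: "simple_yd_module Hc sc M"
        and K: "K = {M'. simple_yd_module Hc sc M' \<and> yd_iso sc sc M M'}"
        unfolding simple_yd_classes_def quotient_def by auto
      obtain l where l: "l \<in> L" and Ml: "yd_iso sc (*s) M (listed \<xi> l)"
        using simple_iso_listed[OF \<xi> M] by (auto simp: L_def)
      have MN: "yd_iso sc sc M (N l)" by (rule yd_iso_trans[OF Ml iso(1)[OF l]])
      have NM: "yd_iso sc sc (N l) M"
        using yd_iso_sym[OF _ MN] M unfolding simple_yd_module_def by blast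
      have "K = \<phi> l" unfolding K \<phi>_def using yd_iso_trans[OF MN] yd_iso_trans[OF NM] by blast
      then show "K \<in> \<phi> ` L" using l by blast
    qed
  qed
  have self: "N l \<in> \<phi> l" if "l \<in> L" for l unfolding \<phi>_def using simple(2)[OF that] yd_iso_refl by blast
  have inj\<phi>: "inj_on \<phi> L"
  proof (rule inj_onI)
    fix l l' assume l: "l \<in> L" "l' \<in> L" and eq: "\<phi> l = \<phi> l'"
    then have "yd_iso sc sc (N l) (N l')" using self[OF l(2)] unfolding \<phi>_def by blast
    then have "yd_iso (*s) (*s) (listed \<xi> l) (listed \<xi> l')"
      using yd_iso_trans[OF iso(1)[OF l(1)]] yd_iso_trans[OF _ iso(2)[OF l(2)]] by blast
    then show "l = l'" using listed_iso_unique[OF \<xi>] l by (simp add: L_def)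
  qed
  have dim: "dim (vs M) = vec.dim (vs (listed \<xi> l))" if l: "l \<in> L" and M: "M \<in> \<phi> l" for l M
  proof (rule yd_iso_dim[OF _ sc])
    show "vs (listed \<xi> l) = UNIV \<or> vs (listed \<xi> l) = vec.span {axis 1 1}"
      using l vs_listed[of l \<xi>] by (auto simp: L_def)
    show "yd_iso (*s) sc (listed \<xi> l) M"
      using yd_iso_trans[OF iso(1)[OF l]] M unfolding \<phi>_def by blast
  qed
  have d: "{K \<in> simple_yd_classes Hc sc. \<forall>M\<in>K. dim (vs M) = n} = \<phi> ` {l \<in> L. vec.dim (vs (listed \<xi> l)) = n}" for n
    unfolding classes using self dim by fastforce
  have d1: "{l \<in> L. vec.dim (vs (listed \<xi> l)) = 1} = labels_S0" "{l \<in> L. vec.dim (vs (listed \<xi> l)) = 2} = labels_dim2"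
    using dim_listed[of _ \<xi>] by (auto simp: L_def)
  have L: "labels_S0 \<subseteq> L" "labels_dim2 \<subseteq> L" by (auto simp: L_def)
  have "card L = 88"
    unfolding L_def using card_Un_disjoint[OF card_labels_S0(2) card_labels_dim2(2)[OF \<xi>] labels_disjoint]
    by (simp add: card_labels_S0(1) card_labels_dim2(1)[OF \<xi>])
  then show "card (simple_yd_classes Hc sc) = 88" unfolding classes by (simp add: card_image[OF inj\<phi>])
  show "card {K \<in> simple_yd_classes Hc sc. \<forall>M\<in>K. dim (vs M) = 1} = 32"
    unfolding d d1 using card_image[OF inj_on_subset[OF inj\<phi> L(1)]] card_labels_S0(1) by simp
  show "card {K \<in> simple_yd_classes Hc sc. \<forall>M\<in>K. dim (vs M) = 2} = 56"
    unfolding d d1 using card_image[OF inj_on_subset[OF inj\<phi> L(2)]] card_labels_dim2(1)[OF \<xi>] by simp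
qed

theorem theorem4p3:
  fixes \<xi> :: "'k::{alg_closed_field, field_char_0}"
    and sc :: "'k \<Rightarrow> 'v::ab_group_add \<Rightarrow> 'v"
  assumes "primitive_root_of_unity 4 \<xi>"
    and "vector_space sc"
  shows
    "(\<forall>l\<in>labels_S0. simple_yd_module Hc (*s) (listed \<xi> l) \<and> vec.dim (vs (listed \<xi> l)) = 1) \<and>
     (\<forall>l\<in>labels_dim2. simple_yd_module Hc (*s) (listed \<xi> l) \<and> vec.dim (vs (listed \<xi> l)) = 2) \<and>
     card (labels_S0 :: 'k label set) = 32 \<and>
     card (labels_dim2 :: 'k label set) = 56 \<and>
     (\<forall>l\<in>labels_S0 \<union> labels_dim2. \<forall>l'\<in>labels_S0 \<union> labels_dim2.
        yd_iso (*s) (*s) (listed \<xi> l) (listed \<xi> l') \<longrightarrow> l = l') \<and>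
     (\<forall>M. simple_yd_module Hc sc M \<longrightarrow>
        (\<exists>l\<in>labels_S0 \<union> labels_dim2. yd_iso sc (*s) M (listed \<xi> l))) \<and>
     ((\<exists>u w. u \<noteq> w \<and> \<not> module.dependent sc {u, w}) \<longrightarrow>
        card (simple_yd_classes Hc sc) = 88 \<and>
        card {K \<in> simple_yd_classes Hc sc. \<forall>M\<in>K. vector_space.dim sc (vs M) = 1} = 32 \<and>
        card {K \<in> simple_yd_classes Hc sc. \<forall>M\<in>K. vector_space.dim sc (vs M) = 2} = 56)"
proof -
  have \<xi>: "\<xi> * \<xi> = -1" "(1 :: 'k) \<noteq> -1"
    using primitive_root_square[OF assms(1)] by (auto simp: eq_neg_iff_add_eq_0)
  show ?thesis
    using listed_simple[OF \<xi>] dim_listed[of _ \<xi>] card_labels_S0(1) card_labels_dim2(1)[OF \<xi>]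
      listed_iso_unique[OF \<xi>] simple_iso_listed[OF \<xi>] simple_yd_classes_count[OF \<xi> assms(2)]
    by (intro conjI ballI allI impI; (elim exE conjE)?) blast+
qed

end
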